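(* Let $k\ge1$, $\beta\in(0,1)$ and $\sigma>0$ be fixed, and let $d=d_\varepsilon\to\infty$ as $\varepsilon\to0$, with $k\le d$ and $\log\binom dk=o(\log\varepsilon^{-1})$ as $\varepsilon\to0$. Let $r_{\varepsilon,k}>0$ satisfy $$\limsup_{\varepsilon\to0}\frac{a_{\varepsilon,k}(r_{\varepsilon,k})}{\sqrt{\log\binom dk}}<\sqrt2\,\bigl(1+\sqrt{1-\beta}\bigr).$$ Then $$\liminf_{\varepsilon\to0}\ \inf_{\tilde{\boldsymbol\eta}}\ \sup_{\boldsymbol\eta\in\mathcal H^d_{k,\beta}}\ \sup_{\boldsymbol\theta\in\Theta^d_{k,\sigma}(r_{\varepsilon,k})}\ \mathrm E_{\boldsymbol\theta,\boldsymbol\eta}\sum_{u\in\mathcal U_{k,d}}|\eta_u-\tilde\eta_u|>0,$$ where the infimum is over all selectors $\tilde{\boldsymbol\eta}=(\tilde\eta_u)_{u\in\mathcal U_{k,d}}$, i.e. all measurable functions of the observations $(X_{\boldsymbol\ell})$ with values in $\{0,1\}^{\binom dk}$.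
   Context: For $1\le k\le d$ let $\mathcal U_{k,d}$ be the set of subsets $u\subseteq\{1,\dots,d\}$ with $\#u=k$. For $u\in\mathcal U_{k,d}$ let $\mathring{\mathbb Z}_u=\{\boldsymbol\ell=(l_1,\dots,l_d)\in\mathbb Z^d: l_j=0 \text{ for } j\notin u,\ l_j\neq0\text{ for } j\in u\}$, and $\mathring{\mathbb Z}^k=(\mathbb Z\setminus\{0\})^k$. For $\boldsymbol\ell$ in either set put $c_{\boldsymbol\ell}^2=\bigl(\sum_j(2\pi l_j)^2\bigr)^{\sigma}$. One observes, for noise level $\varepsilon>0$, $$X_{\boldsymbol\ell}=\eta_u\theta_{\boldsymbol\ell}(u)+\varepsilon\xi_{\boldsymbol\ell},\qquad \boldsymbol\ell\in\mathring{\mathbb Z}_u,\ u\in\mathcal U_{k,d},$$ with $\xi_{\boldsymbol\ell}$ i.i.d. $N(0,1)$ (the sequence-space form of the Gaussian white noise model with sparse regression function $f=\sum_u\eta_uf_u$). The unknown deterministic vector $\boldsymbol\eta=(\eta_u)$ lies in $\mathcal H^d_{k,\beta}=\{\boldsymbol\eta:\eta_u\in\{0,1\},\ \sum_u\eta_u=\binom dk^{1-\beta}(1+o(1))\text{ as }\varepsilon\to0\}$. For $r>0$, $$\mathring\Theta_{\mathbf c_u}(r)=\Bigl\{(\theta_{\boldsymbol\ell}(u))_{\boldsymbol\ell\in\mathring{\mathbb Z}_u}:\sum_{\boldsymbol\ell}\theta_{\boldsymbol\ell}^2(u)c_{\boldsymbol\ell}^2\le1,\ \sum_{\boldsymbol\ell}\theta^2_{\boldsymbol\ell}(u)\ge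 r^2\Bigr\},$$ $\Theta^d_{k,\sigma}(r)=\{(\boldsymbol\theta_u)_{u\in\mathcal U_{k,d}}:\boldsymbol\theta_u\in\mathring\Theta_{\mathbf c_u}(r)\ \forall u\}$, and, with $\mathring\Theta_{\mathbf c_k}(r)$ the analogous set indexed by $\mathring{\mathbb Z}^k$, $$a^2_{\varepsilon,k}(r)=\frac1{2\varepsilon^4}\inf_{\boldsymbol\theta\in\mathring\Theta_{\mathbf c_k}(r)}\sum_{\boldsymbol\ell\in\mathring{\mathbb Z}^k}\theta_{\boldsymbol\ell}^4 .$$ $\mathrm E_{\boldsymbol\theta,\boldsymbol\eta}$ is expectation under the model with parameters $\boldsymbol\theta,\boldsymbol\eta$. *)

theory Defs
  imports "HOL-Probability.Probability"
begin

text \<open>Coordinates are indexed by 0..<d instead of 1..d. A multi-index l is a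
finitely supported function nat => int; its support is the set of nonzero coordinates.\<close>

definition supp :: "(nat \<Rightarrow> int) \<Rightarrow> nat set" where
  "supp l = {j. l j \<noteq> 0}"

definition Ukd :: "nat \<Rightarrow> nat \<Rightarrow> nat set set" where
  "Ukd k d = {u. u \<subseteq> {0..<d} \<and> card u = k}"

text \<open>Z_u: multi-indices with l_j nonzero exactly for j in u.  Z^k (all k coordinates
nonzero) is Zu {0..<k}.\<close>
definition Zu :: "nat set \<Rightarrow> (nat \<Rightarrow> int) set" where
  "Zu u = {l. supp l = u}"

definition Idx :: "nat \<Rightarrow> nat \<Rightarrow> (nat \<Rightarrow> int) set" where
  "Idx k d = (\<Union>u\<in>Ukd k d. Zu u)"

definition csq :: "real \<Rightarrow> (nat \<Rightarrow> int) \<Rightarrow> real" where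
  "csq \<sigma> l = (\<Sum>j\<in>supp l. (2 * pi * real_of_int (l j))\<^sup>2) powr \<sigma>"

definition Theta_ring :: "real \<Rightarrow> (nat \<Rightarrow> int) set \<Rightarrow> real \<Rightarrow> ((nat \<Rightarrow> int) \<Rightarrow> real) set" where
  "Theta_ring \<sigma> Z r = {\<theta>. (\<lambda>l. (\<theta> l)\<^sup>2 * csq \<sigma> l) summable_on Z
       \<and> (\<Sum>\<^sub>\<infinity>l\<in>Z. (\<theta> l)\<^sup>2 * csq \<sigma> l) \<le> 1
       \<and> (\<lambda>l. (\<theta> l)\<^sup>2) summable_on Z
       \<and> (\<Sum>\<^sub>\<infinity>l\<in>Z. (\<theta> l)\<^sup>2) \<ge> r\<^sup>2}"

definition Theta_d :: "real \<Rightarrow> nat \<Rightarrow> nat \<Rightarrow> real \<Rightarrow> ((nat \<Rightarrow> int) \<Rightarrow> real) set" where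
  "Theta_d \<sigma> k d r = {\<theta>. \<forall>u\<in>Ukd k d. \<theta> \<in> Theta_ring \<sigma> (Zu u) r}"

text \<open>a^2_{eps,k}(r) (extended real; +infinity if the set is empty) and a_{eps,k}(r).\<close>
definition a_sq :: "real \<Rightarrow> nat \<Rightarrow> real \<Rightarrow> real \<Rightarrow> ereal" where
  "a_sq \<sigma> k \<epsilon> r = ereal (1 / (2 * \<epsilon> ^ 4)) *
     (INF \<theta>\<in>Theta_ring \<sigma> (Zu {0..<k}) r. ereal (\<Sum>\<^sub>\<infinity>l\<in>Zu {0..<k}. (\<theta> l) ^ 4))"

definition a_eps :: "real \<Rightarrow> nat \<Rightarrow> real \<Rightarrow> real \<Rightarrow> ereal" where
  "a_eps \<sigma> k \<epsilon> r = (if a_sq \<sigma> k \<epsilon> r = \<infinity> then \<infinity>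
                        else ereal (sqrt (real_of_ereal (a_sq \<sigma> k \<epsilon> r))))"

definition Hset :: "nat \<Rightarrow> nat \<Rightarrow> nat \<Rightarrow> (nat set \<Rightarrow> real) set" where
  "Hset k d p = {\<eta>. (\<forall>u\<in>Ukd k d. \<eta> u \<in> {0, 1}) \<and> (\<forall>u. u \<notin> Ukd k d \<longrightarrow> \<eta> u = 0)
                    \<and> card {u\<in>Ukd k d. \<eta> u = 1} = p}"

text \<open>Law of the observations X_l = eta_u theta_l + eps xi_l, l in Z_u, u in U_{k,d}.\<close>
definition obs :: "nat \<Rightarrow> nat \<Rightarrow> real \<Rightarrow> (nat set \<Rightarrow> real) \<Rightarrow> ((nat \<Rightarrow> int) \<Rightarrow> real)
                   \<Rightarrow> ((nat \<Rightarrow> int) \<Rightarrow> real) measure" where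
  "obs k d \<epsilon> \<eta> \<theta> = (\<Pi>\<^sub>M l\<in>Idx k d. density lborel (normal_density (\<eta> (supp l) * \<theta> l) \<epsilon>))"

definition selectors :: "nat \<Rightarrow> nat \<Rightarrow> (((nat \<Rightarrow> int) \<Rightarrow> real) \<Rightarrow> nat set \<Rightarrow> real) set" where
  "selectors k d = {\<eta>t. \<forall>u\<in>Ukd k d.
       (\<lambda>x. \<eta>t x u) \<in> borel_measurable (\<Pi>\<^sub>M l\<in>Idx k d. (borel :: real measure))
     \<and> (\<forall>x. \<eta>t x u \<in> {0, 1})}"

definition risk :: "nat \<Rightarrow> nat \<Rightarrow> real \<Rightarrow> (((nat \<Rightarrow> int) \<Rightarrow> real) \<Rightarrow> nat set \<Rightarrow> real)
                    \<Rightarrow> (nat set \<Rightarrow> real) \<Rightarrow> ((nat \<Rightarrow> int) \<Rightarrow> real) \<Rightarrow> real" where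
  "risk k d \<epsilon> \<eta>t \<eta> \<theta> = (\<integral>x. (\<Sum>u\<in>Ukd k d. \<bar>\<eta> u - \<eta>t x u\<bar>) \<partial>obs k d \<epsilon> \<eta> \<theta>)"

definition minimax_risk :: "real \<Rightarrow> nat \<Rightarrow> nat \<Rightarrow> nat \<Rightarrow> real \<Rightarrow> real \<Rightarrow> ereal" where
  "minimax_risk \<sigma> k d p \<epsilon> r =
     (INF \<eta>t\<in>selectors k d. SUP \<eta>\<in>Hset k d p. SUP \<theta>\<in>Theta_d \<sigma> k d r.
        ereal (risk k d \<epsilon> \<eta>t \<eta> \<theta>))"

end

theory Submission
  imports Defs "HOL-Real_Asymp.Real_Asymp"
begin

text \<open>
  Write \<open>N\<close> for the number of groups and put the uniform prior on the \<open>p\<close>-subsets \<open>S\<close> of active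
  groups, together with independent random signs \<open>\<theta> l = \<plusminus> \<epsilon> * h l\<close>. Averaging over the signs, the
  likelihood of \<open>S\<close> relative to pure noise is the product of the group statistics \<open>L u\<close>, \<open>u \<in> S\<close>, so
  the best selector picks the \<open>p\<close> largest \<open>L u\<close>. It can only be right if all active \<open>L u\<close> exceed
  a threshold \<open>\<tau>\<close> or all inactive ones stay below it, and both probabilities vanish once
  \<open>p * P1 (L < \<tau>)\<close> and \<open>N * P0 (L \<ge> \<tau>)\<close> tend to infinity.

  The amplitudes are extremal for the problem defining \<open>a_sq\<close>, but with value exactly
  \<open>x\<^sup>2 * ln N\<close> for some \<open>x < sqrt 2 * (1 + sqrt (1 - \<beta>))\<close> at least as large as the given level; by duality
  they are admissible for the given radius. As \<open>ln N\<close> is negligible against \<open>ln (1 / \<epsilon>)\<close>, the mass is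
  spread over so many coordinates that \<open>h\<close> is uniformly small. Then \<open>ln (L u)\<close> is nearly
  Gaussian with variance \<open>x\<^sup>2 * ln N\<close> and mean \<open>\<mp> x\<^sup>2 * ln N / 2\<close>, and a change of measure to a
  slightly inflated noise variance gives the two tail bounds
  \<open>P0 (L \<ge> \<tau>) \<ge> N powr (\<kappa> - 1) / 2\<close> and \<open>P1 (L < \<tau>) \<ge> N powr (\<kappa> - (1 - \<beta>)) / 2\<close>.
\<close>

section \<open>Product measures and independence\<close>

text \<open>Averaged over its sign, a coordinate with normalised value y has likelihood ratio
  \<open>cosh (h * y) * exp (- h\<^sup>2 / 2)\<close>, whose logarithm agrees to first order in h^2
  with that for a centred Gaussian of variance 1 + h^2. Hence variance 1 + s h^2 acts like the
  exponential tilt by s of the log-likelihood ratio: s = 0 is noise, s = 1 imitates the signal. With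
  V the sum of h^4, the log-ratio then concentrates at (s - 1/2) V / 2, at exponential cost s^2 V /
  4 against noise and (1 - s)^2 V / 4 against the signal. As V = 2 x^2 ln N, the two requirements on
  the threshold read s x < sqrt 2 and (1 - s) x < sqrt 2 sqrt (1 - beta). A common s exists because
  x < sqrt 2 (1 + sqrt (1 - beta)): this is the origin of the critical constant. Only exponential
  rates matter, so laws of large numbers under the tilted measure suffice and no central limit
  theorem is used. The index set is infinite, so densities are needed on infinite products; the
  extremal amplitudes have finite support, which keeps every likelihood a finite product.\<close>

lemma (in product_prob_space) indep_vars_coordinates:
  "P.indep_vars M (\<lambda>i x. x i) I"
proof (cases "I = {}")
  case True
  then show ?thesis
    unfolding P.indep_vars_def P.indep_sets_def by simp
next
  case False
  have "distr (PiM I M) (PiM I M) (\<lambda>x. \<lambda>i\<in>I. x i) = distr (PiM I M) (PiM I M) (\<lambda>x. x)"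
    by (intro distr_cong refl) (auto simp: space_PiM PiE_def extensional_def restrict_def fun_eq_iff)
  also have "\<dots> = PiM I (\<lambda>i. distr (PiM I M) (M i) (\<lambda>x. x i))"
    by (simp add: distr_id PiM_component cong: PiM_cong)
  finally show ?thesis
    using False by (subst P.indep_vars_iff_distr_eq_PiM') auto
qed

text \<open>Supplies the independence of the group statistics, each of which reads only the
  coordinates of its own group.\<close>

lemma (in product_prob_space) indep_vars_blocks:
  assumes "\<And>u. u \<in> U \<Longrightarrow> F u \<subseteq> I" "disjoint_family_on F U"
    and "\<And>u. u \<in> U \<Longrightarrow> g u \<in> borel_measurable (PiM (F u) M)"
  shows "P.indep_vars (\<lambda>_. borel) (\<lambda>u x. g u (restrict x (F u))) U"
  by (rule P.indep_vars_compose2[OF P.indep_vars_restrict[OF indep_vars_coordinates assms(1,2)] assms(3)])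
     auto

text \<open>A product measure is determined by its values on cylinders. There the density integral
  factorises by independence of the coordinates, and a coordinate of \<open>J\<close> outside the
  cylinder base contributes the total mass 1 of \<open>M' i\<close>. Serves both for the change of
  variance and for the signal shifts.\<close>

lemma PiM_density:
  assumes "\<And>i. prob_space (M i)" "\<And>i. prob_space (M' i)" "finite J" "J \<subseteq> I"
    and f[measurable]: "\<And>i. i \<in> J \<Longrightarrow> f i \<in> borel_measurable (M i)"
    and f0: "\<And>i x. i \<in> J \<Longrightarrow> (0::real) \<le> f i x"
    and M': "\<And>i. i \<in> J \<Longrightarrow> M' i = density (M i) (f i)" "\<And>i. i \<in> I - J \<Longrightarrow> M' i = M i"
  shows "PiM I M' = density (PiM I M) (\<lambda>x. \<Prod>i\<in>J. f i (x i))"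
proof -
  interpret M: product_prob_space M I
    using assms(1) by (simp add: product_prob_space_def product_sigma_finite_def
        product_prob_space_axioms_def prob_space_imp_sigma_finite)
  interpret M': product_prob_space M' I
    using assms(2) by (simp add: product_prob_space_def product_sigma_finite_def
        product_prob_space_axioms_def prob_space_imp_sigma_finite)
  have s: "sets (M' i) = sets (M i)" if "i \<in> I" for i
    using M' that by (cases "i \<in> J") auto
  have sp: "space (M' i) = space (M i)" if "i \<in> I" for i
    using s[OF that] by (rule sets_eq_imp_space_eq)
  have comp[measurable]: "i \<in> J \<Longrightarrow> (\<lambda>x. f i (x i)) \<in> borel_measurable (PiM I M)" for i
    using assms(4) f by (intro measurable_compose[OF measurable_component_singleton]) auto
  show ?thesis
  proof (rule M'.PiM_eq[symmetric])
    show "sets (density (PiM I M) (\<lambda>x. \<Prod>i\<in>J. f i (x i))) = sets (PiM I M')"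
      using s by (simp cong: sets_PiM_cong)
  next
    fix K F assume K: "finite K" "K \<subseteq> I" and F: "\<And>j. j \<in> K \<Longrightarrow> F j \<in> sets (M' j)"
    have F': "\<And>j. j \<in> K \<Longrightarrow> F j \<in> sets (M j)" using F s K by auto
    have fin: "finite (J \<union> K)" using K assms(3) by simp
    \<comment> \<open>Padding with ones lets density and cylinder run over the common index set
      \<open>J \<union> K\<close>.\<close>
    define g where "g i y = (if i \<in> J then ennreal (f i y) else 1) * (if i \<in> K then indicator (F i) y else 1)" for i y
    have g[measurable]: "i \<in> J \<union> K \<Longrightarrow> g i \<in> borel_measurable (M i)" for i
      unfolding g_def using F' by (cases "i \<in> J"; cases "i \<in> K") auto
    have emb: "prod_emb I M' K (Pi\<^sub>E K F) = prod_emb I M K (Pi\<^sub>E K F)"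
      using sp by (auto simp: prod_emb_def)
    have ind: "indicator (prod_emb I M K (Pi\<^sub>E K F)) x = (\<Prod>i\<in>K. indicator (F i) (x i) :: ennreal)"
      if x: "x \<in> space (PiM I M)" for x
    proof (cases "\<forall>i\<in>K. x i \<in> F i")
      case True
      then have "x \<in> prod_emb I M K (Pi\<^sub>E K F)"
        using K x by (auto simp: prod_emb_def space_PiM)
      then show ?thesis using True by simp
    next
      case False
      then obtain i where "i \<in> K" "x i \<notin> F i" by auto
      moreover from this have "x \<notin> prod_emb I M K (Pi\<^sub>E K F)"
        using x K by (auto simp: prod_emb_def space_PiM PiE_iff)
      ultimately show ?thesis using K(1) by (auto intro!: prod_zero[symmetric] bexI[of _ i])
    qed
    have "emeasure (density (PiM I M) (\<lambda>x. \<Prod>i\<in>J. f i (x i))) (prod_emb I M K (Pi\<^sub>E K F))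
        = (\<integral>\<^sup>+x. ennreal (\<Prod>i\<in>J. f i (x i)) * indicator (prod_emb I M K (Pi\<^sub>E K F)) x \<partial>PiM I M)"
      using F' K by (intro emeasure_density) (auto intro!: sets_PiM_I)
    also have "\<dots> = (\<integral>\<^sup>+x. (\<Prod>i\<in>J \<union> K. g i (x i)) \<partial>PiM I M)"
    proof (intro nn_integral_cong)
      fix x assume x: "x \<in> space (PiM I M)"
      have "(\<Prod>i\<in>J. ennreal (f i (x i))) = (\<Prod>i\<in>J\<union>K. (if i \<in> J then ennreal (f i (x i)) else 1))"
        using fin by (intro prod.mono_neutral_cong_left) auto
      moreover have "(\<Prod>i\<in>K. indicator (F i) (x i) :: ennreal) = (\<Prod>i\<in>J\<union>K. (if i \<in> K then indicator (F i) (x i) else 1))"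
        using fin by (intro prod.mono_neutral_cong_left) auto
      ultimately show "ennreal (\<Prod>i\<in>J. f i (x i)) * indicator (prod_emb I M K (Pi\<^sub>E K F)) x = (\<Prod>i\<in>J \<union> K. g i (x i))"
        using x f0 by (simp add: ind g_def prod.distrib prod_ennreal)
    qed
    also have "\<dots> = (\<Prod>i\<in>J \<union> K. \<integral>\<^sup>+x. g i (x i) \<partial>PiM I M)"
    proof (rule M.P.indep_vars_nn_integral[OF fin])
      have "M.P.indep_vars M (\<lambda>i x. x i) (J \<union> K)"
        using M.indep_vars_coordinates assms(4) K by (auto intro: M.P.indep_vars_subset)
      from M.P.indep_vars_compose2[OF this g]
      show "M.P.indep_vars (\<lambda>_. borel) (\<lambda>i x. g i (x i)) (J \<union> K)" .
    qed auto
    also have "\<dots> = (\<Prod>i\<in>J \<union> K. if i \<in> K then emeasure (M' i) (F i) else 1)"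
    proof (intro prod.cong refl)
      fix i assume i: "i \<in> J \<union> K"
      then have iI: "i \<in> I" using assms(4) K by auto
      have "(\<integral>\<^sup>+x. g i (x i) \<partial>PiM I M) = (\<integral>\<^sup>+y. g i y \<partial>distr (PiM I M) (M i) (\<lambda>x. x i))"
        using iI i g by (subst nn_integral_distr) auto
      also have "\<dots> = (\<integral>\<^sup>+y. g i y \<partial>M i)" using iI by (simp add: M.PiM_component)
      also have "\<dots> = (if i \<in> K then emeasure (M' i) (F i) else 1)"
      proof (cases "i \<in> J")
        case True
        show ?thesis
        proof (cases "i \<in> K")
          case True
          with \<open>i \<in> J\<close> F' show ?thesis by (simp add: M' g_def emeasure_density)
        next
          case False
          have "emeasure (M' i) (space (M' i)) = 1" using assms(2) by (rule prob_space.emeasure_space_1)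
          with False \<open>i \<in> J\<close> show ?thesis
            using sp[OF iI] by (simp add: M' g_def emeasure_density cong: nn_integral_cong_simp)
        qed
      next
        case False
        with i iI F' show ?thesis by (simp add: M' g_def)
      qed
      finally show "(\<integral>\<^sup>+x. g i (x i) \<partial>PiM I M) = (if i \<in> K then emeasure (M' i) (F i) else 1)" .
    qed
    also have "\<dots> = (\<Prod>i\<in>K. emeasure (M' i) (F i))"
      using fin by (intro prod.mono_neutral_cong_right) auto
    finally show "emeasure (density (PiM I M) (\<lambda>x. \<Prod>i\<in>J. f i (x i))) (prod_emb I M' K (Pi\<^sub>E K F))
       = (\<Prod>i\<in>K. emeasure (M' i) (F i))" using emb by simp
  qed
qed

lemma (in prob_space) Chebyshev_sum:
  fixes X :: "'i \<Rightarrow> 'a \<Rightarrow> real"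
  assumes "finite F" "indep_vars (\<lambda>_. borel) X F"
    and int2: "\<And>i. i \<in> F \<Longrightarrow> integrable M (\<lambda>x. (X i x)\<^sup>2)"
    and K: "\<And>i. i \<in> F \<Longrightarrow> expectation (\<lambda>x. (X i x)\<^sup>2) \<le> K i" and "c > 0"
  shows "prob {x\<in>space M. \<bar>(\<Sum>i\<in>F. X i x) - (\<Sum>i\<in>F. expectation (X i))\<bar> \<ge> c} \<le> (\<Sum>i\<in>F. K i) / c\<^sup>2"
proof -
  have meas[measurable]: "i \<in> F \<Longrightarrow> X i \<in> borel_measurable M" for i
    using assms(2) by (auto simp: indep_vars_def)
  have int1: "integrable M (X i)" if "i \<in> F" for i
    by (rule square_integrable_imp_integrable) (use that int2 in auto)
  define Y where "Y i x = X i x - expectation (X i)" for i x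
  have intY: "integrable M (Y i)" if "i \<in> F" for i
    unfolding Y_def using int1[OF that] by simp
  have EY: "expectation (Y i) = 0" if "i \<in> F" for i
    unfolding Y_def using int1[OF that] by (simp add: prob_space)
  have intYY: "integrable M (\<lambda>x. Y i x * Y j x) \<and>
      expectation (\<lambda>x. Y i x * Y j x) = (if i = j then variance (X i) else 0)" if "i \<in> F" "j \<in> F" for i j
  proof (cases "i = j")
    case True
    have "integrable M (\<lambda>x. (Y i x)\<^sup>2)"
      unfolding Y_def power2_diff using that int1 int2 by auto
    then show ?thesis using True by (simp add: power2_eq_square Y_def)
  next
    case False
    have "indep_vars (\<lambda>_. borel) Y F"
      using indep_vars_compose2[OF assms(2), of "\<lambda>i y. y - expectation (X i)" "\<lambda>_. borel"]
      unfolding Y_def[abs_def] by auto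
    then have ind: "indep_vars (\<lambda>_. borel) Y {i, j}"
      using that by (auto intro: indep_vars_subset)
    have "k \<in> {i, j} \<Longrightarrow> integrable M (Y k)" for k using that intY by auto
    from indep_vars_lebesgue_integral[OF _ ind this] indep_vars_integrable[OF _ ind this]
    show ?thesis using EY that False by simp
  qed
  let ?S = "\<lambda>x. \<Sum>i\<in>F. X i x"
  have ES: "expectation ?S = (\<Sum>i\<in>F. expectation (X i))"
    using int1 by (simp add: Bochner_Integration.integral_sum)
  have sq: "(?S x - (\<Sum>i\<in>F. expectation (X i)))\<^sup>2 = (\<Sum>i\<in>F. \<Sum>j\<in>F. Y i x * Y j x)" for x
    by (simp add: Y_def sum_subtractf[symmetric] power2_eq_square sum_product)
  have "variance ?S = (\<Sum>i\<in>F. \<Sum>j\<in>F. expectation (\<lambda>x. Y i x * Y j x))"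
    unfolding ES sq using intYY by (simp add: Bochner_Integration.integral_sum)
  also have "\<dots> = (\<Sum>i\<in>F. variance (X i))"
    using intYY assms(1) by simp
  also have "\<dots> \<le> (\<Sum>i\<in>F. K i)"
  proof (intro sum_mono)
    fix i assume i: "i \<in> F"
    have "variance (X i) \<le> expectation (\<lambda>x. (X i x)\<^sup>2)"
      using int1[OF i] int2[OF i] by (simp add: variance_eq)
    then show "variance (X i) \<le> K i" using K[OF i] by simp
  qed
  finally have v: "variance ?S \<le> (\<Sum>i\<in>F. K i)" .
  have "integrable M (\<lambda>x. (?S x)\<^sup>2)"
  proof -
    have "integrable M (\<lambda>x. (?S x - (\<Sum>i\<in>F. expectation (X i)))\<^sup>2)"
      unfolding sq using intYY by (intro Bochner_Integration.integrable_sum) auto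
    moreover have "integrable M (\<lambda>x. 2 * (\<Sum>i\<in>F. expectation (X i)) * ?S x - (\<Sum>i\<in>F. expectation (X i))\<^sup>2)"
      using int1 by (intro Bochner_Integration.integrable_diff integrable_mult_right Bochner_Integration.integrable_sum) auto
    ultimately have "integrable M (\<lambda>x. (?S x - (\<Sum>i\<in>F. expectation (X i)))\<^sup>2
       + (2 * (\<Sum>i\<in>F. expectation (X i)) * ?S x - (\<Sum>i\<in>F. expectation (X i))\<^sup>2))"
      by (rule Bochner_Integration.integrable_add)
    then show ?thesis by (simp add: power2_diff algebra_simps)
  qed
  from Chebyshev_inequality[OF _ this \<open>c > 0\<close>]
  have "prob {x\<in>space M. \<bar>?S x - expectation ?S\<bar> \<ge> c} \<le> variance ?S / c\<^sup>2" by simp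
  also have "\<dots> \<le> (\<Sum>i\<in>F. K i) / c\<^sup>2" using v by (intro divide_right_mono) auto
  finally show ?thesis by (simp only: ES)
qed

section \<open>Elementary inequalities\<close>

lemma nonneg_of_deriv_nonneg:
  fixes f f' :: "real \<Rightarrow> real"
  assumes "\<And>x. x \<ge> 0 \<Longrightarrow> (f has_real_derivative f' x) (at x)"
    and "\<And>x. x \<ge> 0 \<Longrightarrow> f' x \<ge> 0" and "f 0 \<ge> 0" and "x \<ge> 0"
  shows "f x \<ge> 0"
proof -
  have "f 0 \<le> f x"
    using assms by (intro DERIV_nonneg_imp_nondecreasing[of 0 x f]) auto
  then show ?thesis using assms(3) by simp
qed

text \<open>Since tanh' = 1 - tanh^2, a bound on tanh turns by integration into the next Taylor
  bound in the opposite direction: this linear upper bound yields the cubic lower bound, which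
  yields the quintic upper bound.\<close>

lemma tanh_le_self:
  assumes "x \<ge> 0" shows "tanh x \<le> (x::real)"
proof -
  have "0 \<le> x - tanh x"
    by (rule nonneg_of_deriv_nonneg[where f' = "\<lambda>x. (tanh x)\<^sup>2"])
       (use assms in \<open>auto intro!: derivative_eq_intros\<close>)
  then show ?thesis by simp
qed

lemma tanh_ge_cubic:
  assumes "x \<ge> 0" shows "x - x^3 / 3 \<le> tanh (x::real)"
proof -
  have "(tanh y)\<^sup>2 \<le> y\<^sup>2" if "y \<ge> 0" for y :: real
    using that tanh_le_self by (intro power_mono) auto
  then have nn: "0 \<le> y\<^sup>2 - (tanh y)\<^sup>2" if "y \<ge> 0" for y :: real
    using that by simp
  have d: "((\<lambda>x. tanh x - (x - x^3/3)) has_real_derivative (y\<^sup>2 - (tanh y)\<^sup>2)) (at y)" for y :: real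
    by (auto intro!: derivative_eq_intros)
  have "0 \<le> tanh x - (x - x^3/3)"
    by (rule nonneg_of_deriv_nonneg[OF d nn _ assms]) auto
  then show ?thesis by simp
qed

lemma tanh_le_quintic:
  assumes "x \<ge> 0" shows "tanh (x::real) \<le> x - x^3 / 3 + 2 * x^5 / 15"
proof -
  have "y\<^sup>2 - 2 * y^4 / 3 \<le> (tanh y)\<^sup>2" if "y \<ge> 0" for y :: real
  proof (cases "y\<^sup>2 \<le> 3")
    case True
    have "0 \<le> y - y^3/3"
      using True that mult_nonneg_nonneg[of y "1 - y\<^sup>2/3"] by (simp add: algebra_simps power2_eq_square power3_eq_cube)
    then have "(y - y^3/3)\<^sup>2 \<le> (tanh y)\<^sup>2"
      using tanh_ge_cubic[OF that] by (intro power_mono) auto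
    moreover have "(y - y^3/3)\<^sup>2 = y\<^sup>2 - 2 * y^4 / 3 + (y^3/3)\<^sup>2"
      by (simp add: power2_eq_square power3_eq_cube eval_nat_numeral algebra_simps)
    ultimately show ?thesis by (smt (verit) zero_le_power2)
  next
    \<comment> \<open>Here the cubic lower bound is negative and cannot be squared, but the quartic
      polynomial is nonpositive anyway.\<close>
    case False
    then have "0 \<le> y\<^sup>2 * (2 * y\<^sup>2 / 3 - 1)" by (intro mult_nonneg_nonneg) auto
    then have "y\<^sup>2 - 2 * y^4/3 \<le> 0" by (simp add: algebra_simps power2_eq_square eval_nat_numeral)
    then show ?thesis by (smt (verit) zero_le_power2)
  qed
  then have nn: "0 \<le> (tanh y)\<^sup>2 - (y\<^sup>2 - 2 * y^4 / 3)" if "y \<ge> 0" for y :: real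
    using that by (simp only: diff_ge_0_iff_ge)
  have d: "((\<lambda>x. x - x^3/3 + 2 * x^5/15 - tanh x) has_real_derivative
      ((tanh y)\<^sup>2 - (y\<^sup>2 - 2 * y^4 / 3))) (at y)" for y :: real
    by (auto intro!: derivative_eq_intros)
  have "0 \<le> x - x^3/3 + 2 * x^5/15 - tanh x"
    by (rule nonneg_of_deriv_nonneg[OF d nn _ assms]) auto
  then show ?thesis by simp
qed

lemma ln_cosh_has_derivative: "((\<lambda>x. ln (cosh x)) has_real_derivative tanh x) (at x)" for x :: real
  by (auto intro!: derivative_eq_intros simp: tanh_def)

text \<open>Integrated tanh bounds for \<open>z \<ge> 0\<close>, evenness for the rest. The quartic
  term is kept because its mean under the inflated variance has the same order h^4 as that of the
  centred quadratic term; only the sextic term is an error.\<close>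

lemma ln_cosh_bounds:
  fixes z :: real
  shows "z\<^sup>2/2 - z^4/12 \<le> ln (cosh z)" and "ln (cosh z) \<le> z\<^sup>2/2 - z^4/12 + z^6/45"
proof -
  have *: "z\<^sup>2/2 - z^4/12 \<le> ln (cosh z) \<and> ln (cosh z) \<le> z\<^sup>2/2 - z^4/12 + z^6/45" if "z \<ge> 0" for z :: real
  proof -
    have d1: "((\<lambda>z. ln (cosh z) - (z\<^sup>2/2 - z^4/12)) has_real_derivative (tanh y - (y - y^3/3))) (at y)" for y
      by (rule DERIV_diff[OF ln_cosh_has_derivative]) (auto intro!: derivative_eq_intros)
    have "0 \<le> ln (cosh z) - (z\<^sup>2/2 - z^4/12)"
      by (rule nonneg_of_deriv_nonneg[OF d1 _ _ that]) (simp_all add: tanh_ge_cubic)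
    moreover have d2: "((\<lambda>z. z\<^sup>2/2 - z^4/12 + z^6/45 - ln (cosh z)) has_real_derivative
        (y - y^3/3 + 2 * y^5/15 - tanh y)) (at y)" for y
      by (rule DERIV_diff[OF _ ln_cosh_has_derivative]) (auto intro!: derivative_eq_intros)
    have "0 \<le> z\<^sup>2/2 - z^4/12 + z^6/45 - ln (cosh z)"
      by (rule nonneg_of_deriv_nonneg[OF d2 _ _ that]) (simp_all add: tanh_le_quintic)
    ultimately show ?thesis by simp
  qed
  have "z\<^sup>2/2 - z^4/12 \<le> ln (cosh z) \<and> ln (cosh z) \<le> z\<^sup>2/2 - z^4/12 + z^6/45"
    using *[of z] *[of "-z"] by (cases "z \<ge> 0") auto
  then show "z\<^sup>2/2 - z^4/12 \<le> ln (cosh z)" "ln (cosh z) \<le> z\<^sup>2/2 - z^4/12 + z^6/45" by auto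
qed

lemma ln_add_one_ge:
  assumes "u \<ge> 0" shows "u - u\<^sup>2 / 2 \<le> ln (1 + u :: real)"
proof -
  have nn: "1 / (1 + y) - (1 - y) \<ge> 0" if "y \<ge> 0" for y :: real
    using that by (simp add: field_simps)
  have d: "((\<lambda>u. ln (1 + u) - (u - u\<^sup>2/2)) has_real_derivative (1 / (1 + y) - (1 - y))) (at y)"
    if "y \<ge> 0" for y :: real
    using that by (auto intro!: derivative_eq_intros)
  have "0 \<le> ln (1 + u) - (u - u\<^sup>2/2)"
    by (rule nonneg_of_deriv_nonneg[OF d nn _ assms]) auto
  then show ?thesis by simp
qed

text \<open>A product over a \<open>p\<close>-subset is maximal when the subset collects the \<open>p\<close> largest factors:
  otherwise exchanging two elements would increase it.\<close>
lemma top_subset_maximises: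
  fixes L :: "'u \<Rightarrow> real"
  assumes U: "finite U" and "\<And>u. u \<in> U \<Longrightarrow> L u > 0" and A: "A \<subseteq> U" "card A = p"
  obtains S where "S \<subseteq> U" "card S = p" "prod L A \<le> prod L S"
    "(\<forall>u\<in>S. L u \<ge> \<tau>) \<or> (\<forall>u\<in>U-S. L u < \<tau>)"
proof -
  define \<S> where "\<S> = {S. S \<subseteq> U \<and> card S = p}"
  have fin: "finite \<S>" "A \<in> \<S>" using assms by (auto simp: \<S>_def)
  obtain S where S: "S \<in> \<S>" "\<And>S'. S' \<in> \<S> \<Longrightarrow> prod L S' \<le> prod L S"
  proof -
    obtain S where "is_arg_min (\<lambda>S. - prod L S) (\<lambda>S. S \<in> \<S>) S"
      using ex_is_arg_min_if_finite[of \<S> "\<lambda>S. - prod L S"] fin by auto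
    then show ?thesis by (intro that[of S]) (auto simp: is_arg_min_linorder)
  qed
  have "L a \<ge> L b" if ab: "a \<in> S" "b \<in> U - S" for a b
  proof (rule ccontr)
    assume "\<not> L b \<le> L a"
    let ?R = "S - {a}"
    have fS: "finite S" using S U by (auto simp: \<S>_def intro: finite_subset)
    have "card (insert b ?R) = Suc (card ?R)"
      using ab fS by (intro card_insert_disjoint) auto
    also have "\<dots> = card S" by (rule card.remove[OF fS ab(1), symmetric])
    finally have "insert b ?R \<in> \<S>" using S(1) ab by (auto simp: \<S>_def)
    then have "prod L (insert b ?R) \<le> prod L S" by (rule S(2))
    also have "prod L S = L a * prod L ?R" using ab fS by (simp add: prod.remove)
    also have "prod L (insert b ?R) = L b * prod L ?R" using ab fS by simp
    finally have "L b * prod L ?R \<le> L a * prod L ?R" .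
    moreover have "prod L ?R > 0" using S(1) assms(2) by (intro prod_pos) (auto simp: \<S>_def)
    ultimately show False using \<open>\<not> L b \<le> L a\<close> by simp
  qed
  then have "(\<forall>u\<in>S. L u \<ge> \<tau>) \<or> (\<forall>u\<in>U-S. L u < \<tau>)" by force
  moreover have "S \<subseteq> U" "card S = p" using S(1) by (auto simp: \<S>_def)
  ultimately show ?thesis using S(2)[OF fin(2)] by (intro that)
qed

section \<open>Large deviations of the likelihood ratio\<close>

definition gauss :: "real \<Rightarrow> real \<Rightarrow> real measure" where
  "gauss \<mu> \<tau> = density lborel (normal_density \<mu> \<tau>)"

lemma sets_gauss[simp, measurable_cong]: "sets (gauss \<mu> \<tau>) = sets borel"
  and space_gauss[simp]: "space (gauss \<mu> \<tau>) = UNIV"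
  by (auto simp: gauss_def)

lemma prob_space_gauss: "\<tau> > 0 \<Longrightarrow> prob_space (gauss \<mu> \<tau>)"
  unfolding gauss_def by (rule prob_space_normal_density)

lemma product_prob_space_gauss:
  "(\<And>i. \<tau> i > 0) \<Longrightarrow> product_prob_space (\<lambda>i. gauss (\<mu> i) (\<tau> i))"
  by (simp add: product_prob_space_def product_sigma_finite_def
      product_prob_space_axioms_def prob_space_gauss prob_space_imp_sigma_finite)

lemma gauss_even_moment:
  assumes "\<tau> > 0"
  shows "has_bochner_integral (gauss 0 \<tau>) (\<lambda>x. x ^ (2 * n)) (\<tau> ^ (2 * n) * fact (2 * n) / (2 ^ n * fact n))"
proof -
  have "has_bochner_integral lborel (\<lambda>x. normal_density 0 \<tau> x *\<^sub>R x ^ (2 * n)) (fact (2 * n) / ((2 / \<tau>\<^sup>2)^n * fact n))"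
    using normal_moment_even[OF assms, of 0 n] by simp
  also have "fact (2 * n) / ((2 / \<tau>\<^sup>2)^n * fact n) = \<tau> ^ (2 * n) * fact (2 * n) / (2 ^ n * fact n)"
    by (simp add: power_divide power_mult)
  finally show ?thesis
    unfolding gauss_def by (intro has_bochner_integral_density) auto
qed

lemma gauss_tilt_scale:
  assumes "e > 0" "u \<ge> 0"
  shows "gauss 0 (e * sqrt (1 + u)) = density (gauss 0 e)
    (\<lambda>x. exp (((x / e)\<^sup>2 * (u / (1 + u)) - ln (1 + u)) / 2))"
proof -
  have eq: "normal_density 0 (e * sqrt (1 + u)) x
      = normal_density 0 e x * exp (((x / e)\<^sup>2 * (u / (1 + u)) - ln (1 + u)) / 2)" for x
  proof -
    have "exp (- ln (1 + u) / 2) = 1 / sqrt (1 + u)"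
      using assms by (simp add: ln_sqrt[symmetric] exp_minus inverse_eq_divide)
    moreover have "- (x\<^sup>2 / (2 * (e\<^sup>2 * (1 + u)))) = - (x\<^sup>2 / (2 * e\<^sup>2)) + (x / e)\<^sup>2 * (u / (1 + u)) / 2"
    proof -
      have "1 + u \<noteq> 0" using assms by simp
      then show ?thesis using assms by (simp add: divide_simps power2_eq_square) (simp add: algebra_simps)
    qed
    moreover have "exp (((x / e)\<^sup>2 * (u / (1 + u)) - ln (1 + u)) / 2)
       = exp ((x / e)\<^sup>2 * (u / (1 + u)) / 2) * exp (- ln (1 + u) / 2)"
      by (simp add: exp_add[symmetric] diff_divide_distrib)
    ultimately show ?thesis using assms
      by (simp add: normal_density_def power_mult_distrib exp_add exp_diff exp_minus inverse_eq_divide real_sqrt_mult ac_simps)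
  qed
  show ?thesis unfolding gauss_def
    by (subst density_density_eq) (auto simp: eq ennreal_mult intro!: density_cong)
qed

lemma gauss_tilt_shift:
  assumes "e > 0"
  shows "gauss (\<theta>) e = density (gauss 0 e) (\<lambda>x. exp (\<theta> / e * (x / e) - (\<theta> / e)\<^sup>2 / 2))"
proof -
  have eq: "normal_density \<theta> e x = normal_density 0 e x * exp (\<theta> / e * (x / e) - (\<theta> / e)\<^sup>2 / 2)" for x
  proof -
    have "- (x - \<theta>)\<^sup>2 / (2 * e\<^sup>2) = - x\<^sup>2 / (2 * e\<^sup>2) + (\<theta> / e * (x / e) - (\<theta> / e)\<^sup>2 / 2)"
      using assms by (simp add: field_simps power2_eq_square)
    then show ?thesis by (simp add: normal_density_def exp_add[symmetric])
  qed
  show ?thesis unfolding gauss_def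
    by (subst density_density_eq) (auto simp: eq ennreal_mult intro!: density_cong)
qed

text \<open>Change of measure: as \<open>q\<close> is at most \<open>c * g\<close> on
  \<open>G\<close>, the integral of \<open>g\<close> over \<open>G\<close> is at least 1/c of the
  tilted mass of \<open>G\<close>. Used with \<open>g = 1\<close> for noise and with
  \<open>g\<close> the likelihood ratio for the signal.\<close>

lemma emeasure_density_lower_bound:
  assumes [measurable]: "q \<in> borel_measurable M" "G \<in> sets M"
    and "\<And>x. x \<in> G \<Longrightarrow> ennreal (q x) \<le> ennreal c * g x" "c > 0"
    and [measurable]: "g \<in> borel_measurable M"
  shows "ennreal (1 / c) * emeasure (density M (\<lambda>x. ennreal (q x))) G \<le> (\<integral>\<^sup>+x. g x * indicator G x \<partial>M)"
proof -
  have "emeasure (density M (\<lambda>x. ennreal (q x))) G = (\<integral>\<^sup>+x. ennreal (q x) * indicator G x \<partial>M)"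
    by (intro emeasure_density) auto
  also have "\<dots> \<le> (\<integral>\<^sup>+x. ennreal c * (g x * indicator G x) \<partial>M)"
    using assms(3) by (intro nn_integral_mono) (auto simp: indicator_def)
  also have "\<dots> = ennreal c * (\<integral>\<^sup>+x. g x * indicator G x \<partial>M)"
    by (intro nn_integral_cmult) auto
  finally have "ennreal (1 / c) * emeasure (density M (\<lambda>x. ennreal (q x))) G
      \<le> ennreal (1 / c) * (ennreal c * (\<integral>\<^sup>+x. g x * indicator G x \<partial>M))"
    by (intro mult_left_mono) auto
  also have "\<dots> = (\<integral>\<^sup>+x. g x * indicator G x \<partial>M)"
    using \<open>c > 0\<close> by (simp add: mult.assoc[symmetric] ennreal_mult[symmetric])
  finally show ?thesis .
qed

lemma borel_measurable_cosh[measurable (raw)]: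
  fixes f :: "'a \<Rightarrow> real"
  assumes "f \<in> borel_measurable M"
  shows "(\<lambda>x. cosh (f x)) \<in> borel_measurable M"
  using assms by (rule measurable_compose) (intro borel_measurable_continuous_onI continuous_intros)

text \<open>Under \<open>P\<close> the normalised coordinates \<open>x l / e\<close> are standard normal; under \<open>Q\<close> those in \<open>F\<close> have
  variance \<open>1 + s * (h l)\<^sup>2\<close>. \<open>LL\<close> is the log-likelihood ratio of the random-sign alternative
  with amplitudes \<open>h\<close>, and \<open>P\<close>-probabilities of its large deviations are bounded below
  by passing to \<open>Q\<close>, where these deviations are typical.\<close>
locale tilted_signals =
  fixes I F :: "'i set" and h :: "'i \<Rightarrow> real" and e s d :: real
  assumes e: "e > 0" and F: "finite F" "F \<subseteq> I" and s: "s \<ge> 0" and d: "d \<le> 1" "s * d \<le> 1"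
    and h0: "\<And>l. l \<in> F \<Longrightarrow> h l \<ge> 0" and hd: "\<And>l. l \<in> F \<Longrightarrow> (h l)\<^sup>2 \<le> d"
begin

definition "u l = (if l \<in> F then s * (h l)\<^sup>2 else 0)"

definition "P = PiM I (\<lambda>_. gauss 0 e)"

definition "Q = PiM I (\<lambda>l. gauss 0 (e * sqrt (1 + u l)))"

text \<open>Half of this is the variance of the quadratic part of \<open>LL\<close> under
  \<open>P\<close>, since h^2 (y^2 - 1) / 2 has variance h^4 / 2 for standard normal y.\<close>

definition "V = (\<Sum>l\<in>F. (h l)^4)"

definition "LL x = (\<Sum>l\<in>F. ln (cosh (h l * (x l / e))) - (h l)\<^sup>2 / 2)"

text \<open>\<open>A\<close> and \<open>A + C\<close> are the polynomial bounds for the summands of \<open>LL\<close>, and \<open>B\<close> is the logarithm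
  of the density of \<open>Q\<close> with respect to \<open>P\<close>, coordinatewise.\<close>
definition "A l y = (h l)\<^sup>2 * ((y / e)\<^sup>2 - 1) / 2 - (h l)^4 * (y / e)^4 / 12"

definition "B l y = ((y / e)\<^sup>2 * (u l / (1 + u l)) - ln (1 + u l)) / 2"

definition "C l y = (h l)^6 * (y / e)^6 / 45"

lemma u: "0 \<le> u l" "u l \<le> 1"
proof -
  show "0 \<le> u l" using s by (simp add: u_def)
  have "s * (h l)\<^sup>2 \<le> s * d" if "l \<in> F" using s hd[OF that] by (rule mult_left_mono[rotated])
  then show "u l \<le> 1" using d by (auto simp: u_def)
qed

sublocale PP: product_prob_space "\<lambda>_. gauss 0 e" I
  using e by (rule product_prob_space_gauss)

sublocale QQ: product_prob_space "\<lambda>l. gauss 0 (e * sqrt (1 + u l))" I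
  using e u by (intro product_prob_space_gauss) (auto intro!: mult_pos_pos add_pos_nonneg)

lemma Q_density: "Q = density P (\<lambda>x. exp (\<Sum>l\<in>F. B l (x l)))"
  unfolding Q_def P_def exp_sum[OF F(1)]
proof (rule PiM_density)
  show "prob_space (gauss 0 e)" "prob_space (gauss 0 (e * sqrt (1 + u i)))" for i
    using PP.prob_space QQ.prob_space by auto
  show "gauss 0 (e * sqrt (1 + u i)) = density (gauss 0 e) (\<lambda>x. ennreal (exp (B i x)))" for i
    unfolding B_def using e u(1) by (rule gauss_tilt_scale)
  show "gauss 0 (e * sqrt (1 + u i)) = gauss 0 e" if "i \<in> I - F" for i
    using that by (simp add: u_def)
qed (auto simp: F B_def)

lemma Q_moment:
  assumes "l \<in> F"
  shows "has_bochner_integral Q (\<lambda>x. (x l / e) ^ (2 * n)) ((1 + u l) ^ n * (fact (2 * n) / (2 ^ n * fact n)))"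
proof -
  let ?\<tau> = "e * sqrt (1 + u l)"
  have "?\<tau> > 0" using e u by (intro mult_pos_pos) (auto intro: add_pos_nonneg)
  from gauss_even_moment[OF this, of n]
  have "has_bochner_integral (distr Q (gauss 0 ?\<tau>) (\<lambda>x. x l)) (\<lambda>y. y ^ (2 * n)) (?\<tau> ^ (2 * n) * fact (2 * n) / (2 ^ n * fact n))"
    unfolding Q_def using assms F by (subst QQ.PiM_component) auto
  then have "has_bochner_integral Q (\<lambda>x. x l ^ (2 * n)) (?\<tau> ^ (2 * n) * fact (2 * n) / (2 ^ n * fact n))"
    using assms F by (auto simp: Q_def has_bochner_integral_iff integrable_distr_eq integral_distr)
  from has_bochner_integral_divide_zero[OF this, of "e ^ (2 * n)"]
  show ?thesis using e u
    by (simp add: power_divide power_mult_distrib power_mult)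
qed

lemma Q_moments:
  assumes "l \<in> F"
  shows "has_bochner_integral Q (\<lambda>x. (x l / e)\<^sup>2) (1 + u l)"
    "has_bochner_integral Q (\<lambda>x. (x l / e)^4) (3 * (1 + u l)\<^sup>2)"
    "has_bochner_integral Q (\<lambda>x. (x l / e)^6) (15 * (1 + u l)^3)"
    "has_bochner_integral Q (\<lambda>x. (x l / e)^8) (105 * (1 + u l)^4)"
  using Q_moment[OF assms, of 1] Q_moment[OF assms, of 2] Q_moment[OF assms, of 3] Q_moment[OF assms, of 4]
  by (simp_all add: fact_numeral mult.commute)

lemma ABC_measurable[measurable]:
  "A l \<in> borel_measurable borel" "B l \<in> borel_measurable borel" "C l \<in> borel_measurable borel"
  unfolding A_def B_def C_def by measurable

lemma Q_square_bound:
  fixes f g :: "('i \<Rightarrow> real) \<Rightarrow> real"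
  assumes [measurable]: "f \<in> borel_measurable Q" and "\<And>x. (f x)\<^sup>2 \<le> g x" "has_bochner_integral Q g v"
  shows "integrable Q (\<lambda>x. (f x)\<^sup>2)" "(\<integral>x. (f x)\<^sup>2 \<partial>Q) \<le> v"
proof -
  have g: "integrable Q g" "integral\<^sup>L Q g = v" using assms(3) by (auto simp: has_bochner_integral_iff)
  show *: "integrable Q (\<lambda>x. (f x)\<^sup>2)"
    using assms(2) by (intro Bochner_Integration.integrable_bound[OF g(1)])
      (auto intro!: AE_I2 order_trans[OF assms(2)])
  show "(\<integral>x. (f x)\<^sup>2 \<partial>Q) \<le> v"
    using assms(2) unfolding g(2)[symmetric] by (intro integral_mono * g)
qed

lemma meas_coord[measurable]: "l \<in> F \<Longrightarrow> (\<lambda>x. x l) \<in> borel_measurable Q"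
  "l \<in> F \<Longrightarrow> (\<lambda>x. x l) \<in> borel_measurable P"
  using F by (auto simp: Q_def P_def)

lemma Q_indep:
  assumes "\<And>l. l \<in> F \<Longrightarrow> f l \<in> borel_measurable borel"
  shows "QQ.P.indep_vars (\<lambda>_. borel) (\<lambda>l x. f l (x l)) F"
  by (rule QQ.P.indep_vars_compose2[OF QQ.P.indep_vars_subset[OF QQ.indep_vars_coordinates F(2)]])
     (use assms in \<open>auto simp: measurable_cong_sets[OF sets_gauss refl]\<close>)

text \<open>Under \<open>Q\<close> the quadratic term contributes s h^4 / 2 and the quartic term, to
  leading order, -3 h^4 / 12; this is where the centre \<open>(s - 1/2) * V / 2\<close> comes from.
  The inflation of the fourth moment is the only error, and it is small because
  \<open>u l \<le> s * d\<close>.\<close>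

lemma A_expectation:
  assumes "l \<in> F"
  shows "\<bar>(\<integral>x. A l (x l) \<partial>Q) - (h l)^4 * (s/2 - 1/4)\<bar> \<le> (h l)^4 * (3 * s * d / 4)"
proof -
  have "has_bochner_integral Q (\<lambda>x. A l (x l))
     ((h l)\<^sup>2 * ((1 + u l) - 1) / 2 - (h l)^4 * (3 * (1 + u l)\<^sup>2) / 12)"
    unfolding A_def using Q_moments[OF assms]
    by (intro has_bochner_integral_diff has_bochner_integral_divide_zero has_bochner_integral_mult_right)
       (auto simp: has_bochner_integral_iff Q_def QQ.P.prob_space)
  then have "(\<integral>x. A l (x l) \<partial>Q) = (h l)\<^sup>2 * ((1 + u l) - 1) / 2 - (h l)^4 * (3 * (1 + u l)\<^sup>2) / 12"
    by (rule has_bochner_integral_integral_eq)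
  also have "\<dots> = (h l)^4 * (s/2 - 1/4) - (h l)^4 * (2 * u l + (u l)\<^sup>2) / 4"
    using assms by (simp add: u_def power2_eq_square eval_nat_numeral algebra_simps)
  finally have eq: "(\<integral>x. A l (x l) \<partial>Q) - (h l)^4 * (s/2 - 1/4) = - ((h l)^4 * ((2 * u l + (u l)\<^sup>2) / 4))"
    by simp
  have "(u l)\<^sup>2 \<le> u l" using u[of l] by (simp add: power2_eq_square mult_left_le)
  moreover have "u l \<le> s * d" using assms hd s by (simp add: u_def mult_left_mono)
  ultimately have "(2 * u l + (u l)\<^sup>2) / 4 \<le> 3 * s * d / 4" by simp
  then have "(h l)^4 * ((2 * u l + (u l)\<^sup>2) / 4) \<le> (h l)^4 * (3 * s * d / 4)"
    by (intro mult_left_mono) auto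
  moreover have "0 \<le> (h l)^4 * ((2 * u l + (u l)\<^sup>2) / 4)" using u[of l] by auto
  ultimately show ?thesis unfolding eq by linarith
qed

lemma power_le_2: "(1 + u l) ^ n \<le> 2 ^ n"
  using u[of l] by (intro power_mono) auto

lemma A_square:
  assumes "l \<in> F"
  shows "integrable Q (\<lambda>x. (A l (x l))\<^sup>2)" "(\<integral>x. (A l (x l))\<^sup>2 \<partial>Q) \<le> 1270 * (h l)^4"
proof -
  have b: "(A l (x l))\<^sup>2 \<le> (h l)^4 * (3/4 * (1 + (x l / e)^4 + (x l / e)^8))" for x
  proof -
    define t w where "t = (h l)\<^sup>2" and "w = (x l / e)\<^sup>2"
    have t: "0 \<le> t" "t \<le> 1" "0 \<le> w" using hd[OF assms] d by (auto simp: t_def w_def)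
    have "t\<^sup>2 \<le> t" using t by (simp add: power2_eq_square mult_left_le)
    then have "t\<^sup>2 * w\<^sup>2 \<le> t * w\<^sup>2" by (intro mult_right_mono) auto
    moreover have "A l (x l) = t * w / 2 - t / 2 - t\<^sup>2 * w\<^sup>2 / 12"
      by (simp add: A_def t_def w_def power_mult[symmetric] right_diff_distrib diff_divide_distrib)
    moreover have "0 \<le> t * w" "0 \<le> t\<^sup>2 * w\<^sup>2" using t by auto
    moreover have "t / 2 * (1 + w + w\<^sup>2) = t / 2 + t * w / 2 + t * w\<^sup>2 / 2" by (simp add: algebra_simps)
    ultimately have "\<bar>A l (x l)\<bar> \<le> t / 2 * (1 + w + w\<^sup>2)"
      using t(1) by linarith
    then have "(A l (x l))\<^sup>2 \<le> (t / 2 * (1 + w + w\<^sup>2))\<^sup>2" by (rule abs_le_square_iff[THEN iffD1, OF order_trans]) simp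
    also have "\<dots> \<le> t\<^sup>2 * (3/4 * (1 + w\<^sup>2 + w^4))"
    proof -
      have "(1 + w + w\<^sup>2)\<^sup>2 \<le> 3 * (1 + w\<^sup>2 + w^4)"
        using zero_le_power2[of "w - 1"] zero_le_power2[of "w\<^sup>2 - w"] zero_le_power2[of "w\<^sup>2 - 1"]
        by (simp add: power2_eq_square eval_nat_numeral algebra_simps)
      then have "t\<^sup>2 / 4 * (1 + w + w\<^sup>2)\<^sup>2 \<le> t\<^sup>2 / 4 * (3 * (1 + w\<^sup>2 + w^4))" by (intro mult_left_mono) auto
      then show ?thesis by (simp add: power_mult_distrib power_divide)
    qed
    finally show ?thesis by (simp add: t_def w_def power_mult[symmetric])
  qed
  have hb: "has_bochner_integral Q (\<lambda>x. (h l)^4 * (3/4 * (1 + (x l / e)^4 + (x l / e)^8)))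
      ((h l)^4 * (3/4 * (1 + 3 * (1 + u l)\<^sup>2 + 105 * (1 + u l)^4)))"
    using Q_moments[OF assms]
    by (intro has_bochner_integral_mult_right has_bochner_integral_add)
       (auto simp: has_bochner_integral_iff Q_def QQ.P.prob_space)
  have m: "(\<lambda>x. A l (x l)) \<in> borel_measurable Q" unfolding A_def using assms by measurable
  show "integrable Q (\<lambda>x. (A l (x l))\<^sup>2)" by (rule Q_square_bound(1)[OF m _ hb]) (rule b)
  have *: "(\<integral>x. (A l (x l))\<^sup>2 \<partial>Q) \<le> (h l)^4 * (3/4 * (1 + 3 * (1 + u l)\<^sup>2 + 105 * (1 + u l)^4))"
    by (rule Q_square_bound(2)[OF m _ hb]) (rule b)
  \<comment> \<open>With \<open>1 + u l \<le> 2\<close> the second factor is at most 3/4 (1 + 12 +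
    1680) = 1269.75, the source of 1270.\<close>
  have "(h l)^4 * (3/4 * (1 + 3 * (1 + u l)\<^sup>2 + 105 * (1 + u l)^4)) \<le> (h l)^4 * 1270"
    using power_le_2[of l 2] power_le_2[of l 4] by (intro mult_left_mono) auto
  with * show "(\<integral>x. (A l (x l))\<^sup>2 \<partial>Q) \<le> 1270 * (h l)^4" by simp
qed

text \<open>The mean of \<open>B\<close> is the relative entropy of a coordinate of \<open>Q\<close>
  with respect to \<open>P\<close>; summed over \<open>F\<close> it is at most
  \<open>s\<^sup>2 / 4 * V\<close>, the price of the change of measure. The constant 7 rounds up (1
  + 12) / 2.\<close>

lemma B_square:
  assumes "l \<in> F"
  shows "integrable Q (\<lambda>x. (B l (x l))\<^sup>2)" "(\<integral>x. (B l (x l))\<^sup>2 \<partial>Q) \<le> 7 * s\<^sup>2 * (h l)^4"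
    "(\<integral>x. B l (x l) \<partial>Q) \<le> s\<^sup>2 / 4 * (h l)^4"
proof -
  have u2: "(u l)\<^sup>2 = s\<^sup>2 * (h l)^4" using assms by (simp add: u_def power_mult_distrib power_mult[symmetric])
  have ln: "ln (1 + u l) \<le> u l" "0 \<le> ln (1 + u l)" using u[of l] by (auto simp: ln_add_one_self_le_self)
  have c: "0 \<le> u l / (1 + u l)" "u l / (1 + u l) \<le> u l" using u[of l] by (auto simp: field_simps)
  have b: "(B l (x l))\<^sup>2 \<le> (u l)\<^sup>2 * (1/2 * (1 + (x l / e)^4))" for x
  proof -
    define w where "w = (x l / e)\<^sup>2"
    have w: "0 \<le> w" by (simp add: w_def)
    define c where "c = u l / (1 + u l)"
    have "0 \<le> w * c" "w * c \<le> w * u l"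
      using mult_nonneg_nonneg[OF w c(1)] mult_left_mono[OF c(2) w] by (auto simp: c_def)
    moreover have "B l (x l) = w * c / 2 - ln (1 + u l) / 2"
      by (simp add: B_def w_def c_def diff_divide_distrib)
    moreover have "u l / 2 * (1 + w) = u l / 2 + w * u l / 2" by (simp add: algebra_simps)
    ultimately have "\<bar>B l (x l)\<bar> \<le> u l / 2 * (1 + w)"
      using ln by linarith
    then have "(B l (x l))\<^sup>2 \<le> (u l / 2 * (1 + w))\<^sup>2" by (rule abs_le_square_iff[THEN iffD1, OF order_trans]) simp
    also have "\<dots> \<le> (u l)\<^sup>2 * (1/2 * (1 + w\<^sup>2))"
    proof -
      have "(1 + w)\<^sup>2 \<le> 2 * (1 + w\<^sup>2)"
        using zero_le_power2[of "w - 1"] by (simp add: power2_eq_square algebra_simps)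
      then have "(u l)\<^sup>2 / 4 * (1 + w)\<^sup>2 \<le> (u l)\<^sup>2 / 4 * (2 * (1 + w\<^sup>2))" by (intro mult_left_mono) auto
      moreover have "(u l / 2 * (1 + w))\<^sup>2 = (u l)\<^sup>2 / 4 * (1 + w)\<^sup>2"
        by (simp add: power_mult_distrib power_divide)
      moreover have "(u l)\<^sup>2 / 4 * (2 * (1 + w\<^sup>2)) = (u l)\<^sup>2 * (1/2 * (1 + w\<^sup>2))" by simp
      ultimately show ?thesis by (simp only:)
    qed
    finally show ?thesis by (simp add: w_def power_mult[symmetric])
  qed
  have hb: "has_bochner_integral Q (\<lambda>x. (u l)\<^sup>2 * (1/2 * (1 + (x l / e)^4)))
      ((u l)\<^sup>2 * (1/2 * (1 + 3 * (1 + u l)\<^sup>2)))"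
    using Q_moments[OF assms]
    by (intro has_bochner_integral_mult_right has_bochner_integral_add)
       (auto simp: has_bochner_integral_iff Q_def QQ.P.prob_space)
  have m: "(\<lambda>x. B l (x l)) \<in> borel_measurable Q" unfolding B_def using assms by measurable
  show "integrable Q (\<lambda>x. (B l (x l))\<^sup>2)" by (rule Q_square_bound(1)[OF m _ hb]) (rule b)
  have *: "(\<integral>x. (B l (x l))\<^sup>2 \<partial>Q) \<le> (u l)\<^sup>2 * (1/2 * (1 + 3 * (1 + u l)\<^sup>2))"
    by (rule Q_square_bound(2)[OF m _ hb]) (rule b)
  have "(u l)\<^sup>2 * (1/2 * (1 + 3 * (1 + u l)\<^sup>2)) \<le> (u l)\<^sup>2 * 7"
    using power_le_2[of l 2] by (intro mult_left_mono) auto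
  with * show "(\<integral>x. (B l (x l))\<^sup>2 \<partial>Q) \<le> 7 * s\<^sup>2 * (h l)^4" by (simp add: u2)
  have "has_bochner_integral Q (\<lambda>x. B l (x l)) (((1 + u l) * (u l / (1 + u l)) - ln (1 + u l)) / 2)"
    unfolding B_def using Q_moments[OF assms]
    by (intro has_bochner_integral_diff has_bochner_integral_divide_zero has_bochner_integral_mult_left)
       (auto simp: has_bochner_integral_iff Q_def QQ.P.prob_space)
  then have "(\<integral>x. B l (x l) \<partial>Q) = (u l - ln (1 + u l)) / 2"
    using u[of l] by (simp add: has_bochner_integral_iff)
  also have "\<dots> \<le> (u l)\<^sup>2 / 4" using ln_add_one_ge[OF u(1)[of l]] by simp
  finally show "(\<integral>x. B l (x l) \<partial>Q) \<le> s\<^sup>2 / 4 * (h l)^4" by (simp add: u2)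
qed

text \<open>The sextic remainder is of order h^2 h^4, hence smaller than \<open>V\<close> by the
  factor \<open>d\<close>: this is why the amplitudes must be uniformly small.\<close>

lemma C_expectation:
  assumes "l \<in> F"
  shows "integrable Q (\<lambda>x. C l (x l))" "(\<integral>x. C l (x l) \<partial>Q) \<le> 3 * d * (h l)^4"
proof -
  have hb: "has_bochner_integral Q (\<lambda>x. C l (x l)) ((h l)^6 * (15 * (1 + u l)^3) / 45)"
    unfolding C_def using Q_moments[OF assms]
    by (intro has_bochner_integral_divide_zero has_bochner_integral_mult_right)
  then show "integrable Q (\<lambda>x. C l (x l))" by (simp add: has_bochner_integral_iff)
  have "(\<integral>x. C l (x l) \<partial>Q) = (h l)^6 * (15 * (1 + u l)^3) / 45"
    using hb by (rule has_bochner_integral_integral_eq)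
  also have "\<dots> = (h l)^6 * ((1 + u l)^3 / 3)" by simp
  also have "\<dots> \<le> (h l)^6 * 3" using power_le_2[of l 3] by (intro mult_left_mono) auto
  also have "\<dots> = 3 * ((h l)\<^sup>2 * (h l)^4)" by (simp add: power_add[symmetric])
  also have "\<dots> \<le> 3 * (d * (h l)^4)" using hd[OF assms] by (intro mult_left_mono mult_right_mono) auto
  finally show "(\<integral>x. C l (x l) \<partial>Q) \<le> 3 * d * (h l)^4" by simp
qed

text \<open>\<open>LL\<close> is confined from both sides so that one event serves both tail bounds,
  while the log-density of \<open>Q\<close> needs only an upper bound.\<close>

definition "good \<eta> = {x \<in> space P. \<bar>LL x - (s - 1/2) * V / 2\<bar> \<le> \<eta> * V \<and> (\<Sum>l\<in>F. B l (x l)) \<le> (s\<^sup>2 / 4 + \<eta>) * V}"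

lemma LL_measurable[measurable]: "LL \<in> borel_measurable P"
  unfolding LL_def by measurable

lemma good_sets[measurable]: "good \<eta> \<in> sets P"
  unfolding good_def B_def by measurable

lemma space_PQ: "space P = space Q" "sets P = sets Q"
  by (auto simp: P_def Q_def space_PiM intro!: sets_PiM_cong)

lemma LL_bounds: "(\<Sum>l\<in>F. A l (x l)) \<le> LL x" "LL x \<le> (\<Sum>l\<in>F. A l (x l)) + (\<Sum>l\<in>F. C l (x l))"
proof -
  have *: "A l y \<le> ln (cosh (h l * (y / e))) - (h l)\<^sup>2 / 2 \<and> ln (cosh (h l * (y / e))) - (h l)\<^sup>2 / 2 \<le> A l y + C l y" for l y
    using ln_cosh_bounds[of "h l * (y / e)"] unfolding A_def C_def power_mult_distrib
    by (simp add: right_diff_distrib diff_divide_distrib)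
  show "(\<Sum>l\<in>F. A l (x l)) \<le> LL x" unfolding LL_def using * by (intro sum_mono) auto
  show "LL x \<le> (\<Sum>l\<in>F. A l (x l)) + (\<Sum>l\<in>F. C l (x l))"
    unfolding LL_def sum.distrib[symmetric] using * by (intro sum_mono) auto
qed

text \<open>Three exceptional events have \<open>Q\<close>-probability at most 1/8 each: 40640 = 8 *
  4 * 1270 and 56 = 8 * 7 are the resulting Chebyshev constants, 96 = 8 * 12 the Markov
  constant.\<close>

lemma Q_good:
  assumes eta: "\<eta> > 0" "3 * s * d \<le> \<eta>" "96 * d \<le> \<eta>"
    and V: "V > 0" "40640 \<le> \<eta>\<^sup>2 * V" "56 * s\<^sup>2 \<le> \<eta>\<^sup>2 * V"
  shows "1/2 \<le> QQ.P.prob (good \<eta>)"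
proof -
  let ?A = "\<lambda>x. \<Sum>l\<in>F. A l (x l)" and ?B = "\<lambda>x. \<Sum>l\<in>F. B l (x l)" and ?C = "\<lambda>x. \<Sum>l\<in>F. C l (x l)"
  let ?EA = "\<Sum>l\<in>F. \<integral>x. A l (x l) \<partial>Q" and ?EB = "\<Sum>l\<in>F. \<integral>x. B l (x l) \<partial>Q"
  \<comment> \<open>The allowance \<open>\<eta> * V\<close> for \<open>LL\<close> is split: half for
    the fluctuation of the \<open>A\<close> terms, a quarter for the bias of their mean, a quarter
    for the remainder \<open>C\<close>.\<close>
  define a where "a = {x\<in>space Q. \<bar>?A x - ?EA\<bar> \<ge> \<eta> * V / 2}"
  define b where "b = {x\<in>space Q. \<bar>?B x - ?EB\<bar> \<ge> \<eta> * V}"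
  define c where "c = {x\<in>space Q. ?C x \<ge> \<eta> * V / 4}"
  note [simp] = Q_def[symmetric]
  have "measure Q a \<le> (\<Sum>l\<in>F. 1270 * (h l)^4) / (\<eta> * V / 2)\<^sup>2"
    unfolding a_def
    using QQ.P.Chebyshev_sum[OF F(1) Q_indep[of A], of "\<lambda>l. 1270 * (h l)^4" "\<eta> * V / 2"] A_square eta V
    by simp
  also have "\<dots> = 5080 / (\<eta>\<^sup>2 * V)"
    using V eta unfolding V_def[symmetric] sum_distrib_left[symmetric]
    by (simp add: divide_simps power2_eq_square)
  also have "\<dots> \<le> 1/8" using V eta by (simp add: divide_le_eq)
  finally have pa: "measure Q a \<le> 1/8" .
  have "measure Q b \<le> (\<Sum>l\<in>F. 7 * s\<^sup>2 * (h l)^4) / (\<eta> * V)\<^sup>2"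
    unfolding b_def
    using QQ.P.Chebyshev_sum[OF F(1) Q_indep[of B], of "\<lambda>l. 7 * s\<^sup>2 * (h l)^4" "\<eta> * V"] B_square eta V
    by simp
  also have "\<dots> = 7 * s\<^sup>2 / (\<eta>\<^sup>2 * V)"
    using V eta unfolding V_def[symmetric] sum_distrib_left[symmetric]
    by (simp add: divide_simps power2_eq_square)
  also have "\<dots> \<le> 1/8" using V eta by (simp add: divide_le_eq)
  finally have pb: "measure Q b \<le> 1/8" .
  have C0: "0 \<le> ?C x" for x by (intro sum_nonneg) (auto simp: C_def h0)
  have EC: "(\<integral>x. ?C x \<partial>Q) \<le> 3 * d * V"
    unfolding V_def sum_distrib_left
    by (subst Bochner_Integration.integral_sum) (auto intro!: sum_mono C_expectation)
  \<comment> \<open>The remainder is nonnegative and only has to be small, so Markov's inequality on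
    its first moment suffices.\<close>
  have "measure Q c \<le> (\<integral>x. ?C x \<partial>Q) / (\<eta> * V / 4)"
    unfolding c_def using eta V C0
    by (intro integral_Markov_inequality_measure[where A = "{}"]) (auto intro!: C_expectation)
  also have "\<dots> \<le> 3 * d * V / (\<eta> * V / 4)"
    using EC eta V by (intro divide_right_mono) auto
  also have "\<dots> = 12 * d / \<eta>" using eta V by (simp add: field_simps)
  also have "\<dots> \<le> 1/8" using eta by (simp add: divide_le_eq)
  finally have pc: "measure Q c \<le> 1/8" .
  have [measurable]: "a \<in> sets Q" "b \<in> sets Q" "c \<in> sets Q"
    unfolding a_def b_def c_def A_def B_def C_def by measurable
  have EB: "?EB \<le> s\<^sup>2 / 4 * V" unfolding V_def sum_distrib_left by (intro sum_mono B_square)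
  have EA: "\<bar>?EA - (s - 1/2) * V / 2\<bar> \<le> \<eta> * V / 4"
  proof -
    have "?EA - (s - 1/2) * V / 2 = (\<Sum>l\<in>F. (\<integral>x. A l (x l) \<partial>Q) - (h l)^4 * (s/2 - 1/4))"
      unfolding sum_subtractf V_def sum_distrib_right[symmetric] by (simp add: field_simps)
    also have "\<bar>\<dots>\<bar> \<le> (\<Sum>l\<in>F. (h l)^4 * (3 * s * d / 4))"
      by (rule order_trans[OF sum_abs]) (intro sum_mono A_expectation)
    also have "\<dots> = (3 * s * d) * V / 4" by (simp add: V_def sum_distrib_left sum_distrib_right mult_ac sum_divide_distrib)
    also have "\<dots> \<le> \<eta> * V / 4" using eta V by (intro divide_right_mono mult_right_mono) auto
    finally show ?thesis .
  qed
  have "space Q - (a \<union> b \<union> c) \<subseteq> good \<eta>"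
  proof
    fix x assume x: "x \<in> space Q - (a \<union> b \<union> c)"
    then have "\<bar>?A x - ?EA\<bar> < \<eta> * V / 2" "\<bar>?B x - ?EB\<bar> < \<eta> * V" "?C x < \<eta> * V / 4"
      by (auto simp: a_def b_def c_def)
    moreover have "?B x \<le> (s\<^sup>2/4 + \<eta>) * V" if "\<bar>?B x - ?EB\<bar> < \<eta> * V"
      using that EB by (simp add: distrib_right)
    moreover define m where "m = (s - 1/2) * V / 2"
    have "\<bar>?EA - m\<bar> \<le> \<eta> * V / 4" using EA by (simp add: m_def)
    ultimately have "\<bar>LL x - m\<bar> \<le> \<eta> * V" "?B x \<le> (s\<^sup>2/4 + \<eta>) * V"
      using LL_bounds[of x] mult_pos_pos[OF eta(1) V(1)] by linarith+
    with x show "x \<in> good \<eta>" unfolding good_def space_PQ m_def by blast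
  qed
  then have "measure Q (space Q - (a \<union> b \<union> c)) \<le> measure Q (good \<eta>)"
    using good_sets[of \<eta>] by (intro QQ.P.finite_measure_mono[simplified]) (auto simp: space_PQ)
  moreover have "measure Q (space Q - (a \<union> b \<union> c)) = 1 - measure Q (a \<union> b \<union> c)"
    using QQ.P.prob_compl[of "a \<union> b \<union> c"] by simp
  moreover have "measure Q (a \<union> b \<union> c) \<le> measure Q a + measure Q b + measure Q c"
    using measure_subadditive[of a Q b] measure_subadditive[of "a \<union> b" Q c] QQ.P.emeasure_finite
    by (force simp: less_top)
  ultimately show ?thesis using pa pb pc by simp
qed

text \<open>Both bounds transfer \<open>good\<close>, of \<open>Q\<close>-probability at least 1/2,
  by a change of measure. Against noise the cost is the log-density alone. Against the signal
  mixture, whose density is \<open>exp (LL x)\<close>, the cost drops by the value of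
  \<open>LL\<close> on \<open>good\<close>, and s^2 / 4 - (s - 1/2) / 2 = (1 - s)^2 / 4; the second
  \<eta> pays for the deviation of \<open>LL\<close>.\<close>

theorem tail_bounds:
  assumes eta: "\<eta> > 0" "3 * s * d \<le> \<eta>" "96 * d \<le> \<eta>"
    and V: "V > 0" "40640 \<le> \<eta>\<^sup>2 * V" "56 * s\<^sup>2 \<le> \<eta>\<^sup>2 * V"
  shows "ennreal (exp (- ((s\<^sup>2 / 4 + \<eta>) * V)) / 2) \<le> emeasure P {x\<in>space P. (s - 1/2) * V / 2 - \<eta> * V \<le> LL x}"
    and "ennreal (exp (- (((1 - s)\<^sup>2 / 4 + 2 * \<eta>) * V)) / 2)
      \<le> (\<integral>\<^sup>+x. ennreal (exp (LL x)) * indicator {x\<in>space P. LL x \<le> (s - 1/2) * V / 2 + \<eta> * V} x \<partial>P)"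
proof -
  let ?K = "exp ((s\<^sup>2 / 4 + \<eta>) * V)" and ?q = "\<lambda>x. exp (\<Sum>l\<in>F. B l (x l))"
  have Bm[measurable]: "?q \<in> borel_measurable P" by measurable
  have G: "ennreal (1/2) \<le> emeasure (density P (\<lambda>x. ennreal (?q x))) (good \<eta>)"
    unfolding Q_density[symmetric] QQ.P.emeasure_eq_measure[folded Q_def]
    using Q_good[OF assms] by (intro ennreal_leI) (simp add: Q_def)
  have "ennreal (exp (- ((s\<^sup>2 / 4 + \<eta>) * V)) / 2) = ennreal (1 / ?K) * ennreal (1/2)"
    by (subst ennreal_mult[symmetric]) (simp_all add: exp_minus inverse_eq_divide)
  also have "\<dots> \<le> ennreal (1 / ?K) * emeasure (density P (\<lambda>x. ennreal (?q x))) (good \<eta>)"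
    by (intro mult_left_mono G) auto
  also have "\<dots> \<le> (\<integral>\<^sup>+x. 1 * indicator (good \<eta>) x \<partial>P)"
    by (rule emeasure_density_lower_bound) (auto simp: good_def ennreal_leI)
  also have "\<dots> = emeasure P (good \<eta>)" by simp
  also have "\<dots> \<le> emeasure P {x\<in>space P. (s - 1/2) * V / 2 - \<eta> * V \<le> LL x}"
    by (intro emeasure_mono) (auto simp: good_def)
  finally show "ennreal (exp (- ((s\<^sup>2 / 4 + \<eta>) * V)) / 2) \<le> emeasure P {x\<in>space P. (s - 1/2) * V / 2 - \<eta> * V \<le> LL x}" .
  let ?K' = "exp ((s\<^sup>2 / 4 + \<eta>) * V - ((s - 1/2) * V / 2 - \<eta> * V))"
  have "ennreal (exp (- (((1 - s)\<^sup>2 / 4 + 2 * \<eta>) * V)) / 2) = ennreal (1 / ?K') * ennreal (1/2)"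
  proof -
    have "- (((1 - s)\<^sup>2 / 4 + 2 * \<eta>) * V) = - ((s\<^sup>2 / 4 + \<eta>) * V - ((s - 1/2) * V / 2 - \<eta> * V))"
      by (simp add: field_simps power2_eq_square)
    then show ?thesis
      by (subst ennreal_mult[symmetric]) (simp_all only: exp_minus inverse_eq_divide, simp_all)
  qed
  also have "\<dots> \<le> ennreal (1 / ?K') * emeasure (density P (\<lambda>x. ennreal (?q x))) (good \<eta>)"
    by (intro mult_left_mono G) auto
  also have "\<dots> \<le> (\<integral>\<^sup>+x. ennreal (exp (LL x)) * indicator (good \<eta>) x \<partial>P)"
  proof (rule emeasure_density_lower_bound)
    fix x assume "x \<in> good \<eta>"
    then have "(\<Sum>l\<in>F. B l (x l)) \<le> (s\<^sup>2 / 4 + \<eta>) * V" "(s - 1/2) * V / 2 - \<eta> * V \<le> LL x"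
      by (auto simp: good_def)
    then show "ennreal (?q x) \<le> ennreal ?K' * ennreal (exp (LL x))"
      by (subst ennreal_mult[symmetric]) (auto simp: exp_add[symmetric] intro!: ennreal_leI)
  qed auto
  also have "\<dots> \<le> (\<integral>\<^sup>+x. ennreal (exp (LL x)) * indicator {x\<in>space P. LL x \<le> (s - 1/2) * V / 2 + \<eta> * V} x \<partial>P)"
    by (intro nn_integral_mono mult_left_mono) (auto simp: good_def indicator_def)
  finally show "ennreal (exp (- (((1 - s)\<^sup>2 / 4 + 2 * \<eta>) * V)) / 2)
      \<le> (\<integral>\<^sup>+x. ennreal (exp (LL x)) * indicator {x\<in>space P. LL x \<le> (s - 1/2) * V / 2 + \<eta> * V} x \<partial>P)" .
qed

end

section \<open>Reduction to testing single groups\<close>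

lemma ennreal_compl_le:
  assumes "a + b = (1::ennreal)" "ennreal p \<le> b" "0 \<le> p"
  shows "a \<le> ennreal (1 - p)"
  using assms
  by (cases a; cases b) (auto simp: ennreal_plus[symmetric] ennreal_1[symmetric] simp del: ennreal_plus ennreal_1 intro!: ennreal_leI)

text \<open>Divided by the number of \<open>p\<close>-subsets, the left-hand side is the probability
  that \<open>T\<close> recovers a uniformly drawn active set. At each point only
  \<open>S = T x\<close> contributes, and its weight is at most that of the maximising subset, which
  \<tau> separates in one of two ways; each way gives a product of independent factors.\<close>

lemma (in prob_space) top_selection_bound:
  fixes L :: "'u \<Rightarrow> 'a \<Rightarrow> real" and T :: "'a \<Rightarrow> 'u set"
  assumes U: "finite U" and ind: "indep_vars (\<lambda>_. borel) L U"
    and pos: "\<And>u x. u \<in> U \<Longrightarrow> L u x > 0" and L1: "\<And>u. u \<in> U \<Longrightarrow> (\<integral>\<^sup>+x. L u x \<partial>M) = 1"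
    and p0: "\<And>u. u \<in> U \<Longrightarrow> ennreal p0 \<le> emeasure M {x\<in>space M. \<tau> \<le> L u x}" "0 \<le> p0" "p0 \<le> 1"
    and p1: "\<And>u. u \<in> U \<Longrightarrow> ennreal p1 \<le> (\<integral>\<^sup>+x. ennreal (L u x) * indicator {x\<in>space M. L u x < \<tau>} x \<partial>M)" "0 \<le> p1" "p1 \<le> 1"
    and T: "\<And>S. S \<subseteq> U \<Longrightarrow> {x\<in>space M. T x = S} \<in> sets M"
  shows "(\<Sum>S | S \<subseteq> U \<and> card S = p. \<integral>\<^sup>+x. ennreal (\<Prod>u\<in>S. L u x) * indicator {x\<in>space M. T x = S} x \<partial>M)
    \<le> of_nat (card {S. S \<subseteq> U \<and> card S = p}) * ennreal ((1 - p1) ^ p + (1 - p0) ^ (card U - p))"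
proof -
  define H where "H = {S. S \<subseteq> U \<and> card S = p}"
  have H: "finite H" using U by (simp add: H_def)
  have Lm[measurable]: "L u \<in> borel_measurable M" if "u \<in> U" for u
    using ind that by (auto simp: indep_vars_def)
  \<comment> \<open>\<open>hi\<close> records that all active statistics reach \<tau> and leaves the
    inactive ones free; \<open>lo\<close> records that all inactive ones stay below \<tau> and
    leaves the active ones free.\<close>
  define hi where "hi S u x = (if u \<in> S then ennreal (L u x) * indicator {y. \<tau> \<le> y} (L u x) else 1)" for S u x
  define lo where "lo S u x = (if u \<in> S then ennreal (L u x) else indicator {y. y < \<tau>} (L u x))" for S u x
  have bound: "(\<Sum>S\<in>H. ennreal (\<Prod>u\<in>S. L u x) * indicator {x\<in>space M. T x = S} x)
      \<le> (\<Sum>S\<in>H. (\<Prod>u\<in>U. hi S u x) + (\<Prod>u\<in>U. lo S u x))" if x: "x \<in> space M" for x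
  proof (cases "T x \<in> H")
    case False
    then have "(\<Sum>S\<in>H. ennreal (\<Prod>u\<in>S. L u x) * indicator {x\<in>space M. T x = S} x) = 0"
      using H by (intro sum.neutral) (auto simp: indicator_def)
    then show ?thesis by simp
  next
    case True
    obtain S where S: "S \<subseteq> U" "card S = p" "(\<Prod>u\<in>T x. L u x) \<le> (\<Prod>u\<in>S. L u x)"
        "(\<forall>u\<in>S. L u x \<ge> \<tau>) \<or> (\<forall>u\<in>U-S. L u x < \<tau>)"
      using top_subset_maximises[of U "\<lambda>u. L u x" "T x" p \<tau>] U pos True by (auto simp: H_def)
    have SH: "S \<in> H" using S by (simp add: H_def)
    have SU: "U \<inter> S = S" using S by auto
    have "(\<Sum>S\<in>H. ennreal (\<Prod>u\<in>S. L u x) * indicator {x\<in>space M. T x = S} x) = (\<Sum>S\<in>{T x}. ennreal (\<Prod>u\<in>S. L u x))"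
      using x True H by (intro sum.mono_neutral_cong_right) (auto simp: indicator_def)
    also have "\<dots> \<le> ennreal (\<Prod>u\<in>S. L u x)" using S(3) by (auto intro: ennreal_leI)
    also have "\<dots> = (\<Prod>u\<in>S. ennreal (L u x))"
      using S pos by (intro prod_ennreal[symmetric]) (auto simp: subset_eq less_imp_le)
    also have "\<dots> = (\<Prod>u\<in>U. if u \<in> S then ennreal (L u x) else 1)"
      using U SU by (simp add: prod.inter_restrict[symmetric])
    also have "\<dots> \<le> (\<Prod>u\<in>U. hi S u x) + (\<Prod>u\<in>U. lo S u x)"
      using S(4)
    proof
      assume "\<forall>u\<in>S. L u x \<ge> \<tau>"
      then have "(\<Prod>u\<in>U. if u \<in> S then ennreal (L u x) else 1) = (\<Prod>u\<in>U. hi S u x)"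
        by (intro prod.cong) (auto simp: hi_def)
      then show ?thesis by simp
    next
      assume "\<forall>u\<in>U-S. L u x < \<tau>"
      then have "(\<Prod>u\<in>U. if u \<in> S then ennreal (L u x) else 1) = (\<Prod>u\<in>U. lo S u x)"
        by (intro prod.cong) (auto simp: lo_def)
      then show ?thesis by simp
    qed
    \<comment> \<open>The maximiser depends on \<open>x\<close>; summing over all of
      \<open>H\<close> removes this dependence, at the price of a factor \<open>card H\<close> that
      the uniform prior cancels.\<close>
    also have "\<dots> \<le> (\<Sum>S\<in>H. (\<Prod>u\<in>U. hi S u x) + (\<Prod>u\<in>U. lo S u x))"
      using H SH by (intro member_le_sum) auto
    finally show ?thesis .
  qed
  have him[measurable]: "u \<in> U \<Longrightarrow> hi S u \<in> borel_measurable M"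
   and lom[measurable]: "u \<in> U \<Longrightarrow> lo S u \<in> borel_measurable M" for S u
    unfolding hi_def lo_def by (cases "u \<in> S"; measurable)+
  have hi_int: "(\<integral>\<^sup>+x. (\<Prod>u\<in>U. hi S u x) \<partial>M) \<le> ennreal ((1 - p1) ^ p)" if S: "S \<in> H" for S
  proof -
    have "indep_vars (\<lambda>_. borel) (hi S) U"
      unfolding hi_def[abs_def]
      using indep_vars_compose2[OF ind, of "\<lambda>u y. if u \<in> S then ennreal y * indicator {y. \<tau> \<le> y} y else 1" "\<lambda>_. borel"]
      by simp
    then have "(\<integral>\<^sup>+x. (\<Prod>u\<in>U. hi S u x) \<partial>M) = (\<Prod>u\<in>U. \<integral>\<^sup>+x. hi S u x \<partial>M)"
      using U by (intro indep_vars_nn_integral) auto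
    also have "\<dots> \<le> (\<Prod>u\<in>U. if u \<in> S then ennreal (1 - p1) else 1)"
    proof (rule prod_mono_ennreal)
      fix u assume u: "u \<in> U"
      show "(\<integral>\<^sup>+x. hi S u x \<partial>M) \<le> (if u \<in> S then ennreal (1 - p1) else 1)"
      proof (cases "u \<in> S")
        case True
        have "(\<integral>\<^sup>+x. hi S u x \<partial>M) + (\<integral>\<^sup>+x. ennreal (L u x) * indicator {x\<in>space M. L u x < \<tau>} x \<partial>M) = (\<integral>\<^sup>+x. L u x \<partial>M)"
          using u by (subst nn_integral_add[symmetric])
            (auto intro!: nn_integral_cong simp: hi_def True indicator_def)
        with L1[OF u] have "(\<integral>\<^sup>+x. hi S u x \<partial>M) \<le> ennreal (1 - p1)"
          by (intro ennreal_compl_le[OF _ p1(1)[OF u] p1(2)]) simp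
        with True show ?thesis by simp
      qed (simp add: hi_def emeasure_space_1)
    qed
    also have "\<dots> = ennreal (1 - p1) ^ card S"
      using U S by (simp add: H_def prod.If_cases Int_absorb1)
    also have "\<dots> = ennreal ((1 - p1) ^ p)" using S p1 by (simp add: H_def ennreal_power)
    finally show ?thesis .
  qed
  have lo_int: "(\<integral>\<^sup>+x. (\<Prod>u\<in>U. lo S u x) \<partial>M) \<le> ennreal ((1 - p0) ^ (card U - p))" if S: "S \<in> H" for S
  proof -
    have "indep_vars (\<lambda>_. borel) (lo S) U"
      unfolding lo_def[abs_def]
      using indep_vars_compose2[OF ind, of "\<lambda>u y. if u \<in> S then ennreal y else indicator {y. y < \<tau>} y" "\<lambda>_. borel"]
      by simp
    then have "(\<integral>\<^sup>+x. (\<Prod>u\<in>U. lo S u x) \<partial>M) = (\<Prod>u\<in>U. \<integral>\<^sup>+x. lo S u x \<partial>M)"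
      using U by (intro indep_vars_nn_integral) auto
    also have "\<dots> \<le> (\<Prod>u\<in>U. if u \<in> S then 1 else ennreal (1 - p0))"
    proof (rule prod_mono_ennreal)
      fix u assume u: "u \<in> U"
      show "(\<integral>\<^sup>+x. lo S u x \<partial>M) \<le> (if u \<in> S then 1 else ennreal (1 - p0))"
      proof (cases "u \<in> S")
        case False
        have "(\<integral>\<^sup>+x. lo S u x \<partial>M) + emeasure M {x\<in>space M. \<tau> \<le> L u x}
            = (\<integral>\<^sup>+x. lo S u x \<partial>M) + (\<integral>\<^sup>+x. indicator {x\<in>space M. \<tau> \<le> L u x} x \<partial>M)"
          using u by simp
        also have "\<dots> = (\<integral>\<^sup>+x. lo S u x + indicator {x\<in>space M. \<tau> \<le> L u x} x \<partial>M)"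
          using u by (intro nn_integral_add[symmetric]) auto
        also have "\<dots> = (\<integral>\<^sup>+x. 1 \<partial>M)"
          by (intro nn_integral_cong) (auto simp: lo_def False indicator_def)
        finally have "(\<integral>\<^sup>+x. lo S u x \<partial>M) \<le> ennreal (1 - p0)"
          by (intro ennreal_compl_le[OF _ p0(1)[OF u] p0(2)]) (simp add: emeasure_space_1)
        with False show ?thesis by simp
      qed (simp add: lo_def L1[OF u])
    qed
    also have "\<dots> = ennreal (1 - p0) ^ card (U - S)"
      using U S by (simp add: H_def prod.If_cases Diff_eq)
    also have "\<dots> = ennreal ((1 - p0) ^ (card U - p))"
    proof -
      have "finite S" "S \<subseteq> U" "card S = p" using S U by (auto simp: H_def intro: finite_subset)
      then have "card (U - S) = card U - p" by (simp add: card_Diff_subset)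
      then show ?thesis using p0 by (simp add: ennreal_power)
    qed
    finally show ?thesis .
  qed
  have "(\<Sum>S\<in>H. \<integral>\<^sup>+x. ennreal (\<Prod>u\<in>S. L u x) * indicator {x\<in>space M. T x = S} x \<partial>M)
     = (\<integral>\<^sup>+x. (\<Sum>S\<in>H. ennreal (\<Prod>u\<in>S. L u x) * indicator {x\<in>space M. T x = S} x) \<partial>M)"
  proof (intro nn_integral_sum[symmetric])
    fix S assume S: "S \<in> H"
    then have [measurable]: "{x\<in>space M. T x = S} \<in> sets M" using T by (simp add: H_def)
    have [measurable]: "u \<in> S \<Longrightarrow> L u \<in> borel_measurable M" for u using Lm S by (auto simp: H_def)
    show "(\<lambda>x. ennreal (\<Prod>u\<in>S. L u x) * indicator {x\<in>space M. T x = S} x) \<in> borel_measurable M" by measurable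
  qed
  also have "\<dots> \<le> (\<integral>\<^sup>+x. (\<Sum>S\<in>H. (\<Prod>u\<in>U. hi S u x) + (\<Prod>u\<in>U. lo S u x)) \<partial>M)"
    by (intro nn_integral_mono bound)
  also have "\<dots> = (\<Sum>S\<in>H. (\<integral>\<^sup>+x. (\<Prod>u\<in>U. hi S u x) \<partial>M) + (\<integral>\<^sup>+x. (\<Prod>u\<in>U. lo S u x) \<partial>M))"
    by (subst nn_integral_sum) (auto intro!: sum.cong nn_integral_add)
  also have "\<dots> \<le> (\<Sum>S\<in>H. ennreal ((1 - p1) ^ p + (1 - p0) ^ (card U - p)))"
    using hi_int lo_int p0 p1 by (intro sum_mono) (auto simp: ennreal_plus intro!: add_mono)
  also have "\<dots> = of_nat (card H) * ennreal ((1 - p1) ^ p + (1 - p0) ^ (card U - p))" by simp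
  finally show ?thesis unfolding H_def .
qed

lemma obs_gauss: "obs k d \<epsilon> \<eta> \<theta> = (\<Pi>\<^sub>M l\<in>Idx k d. gauss (\<eta> (supp l) * \<theta> l) \<epsilon>)"
  by (simp add: obs_def gauss_def)

lemma finite_Ukd: "finite (Ukd k d)" and card_Ukd: "card (Ukd k d) = d choose k"
  unfolding Ukd_def by (auto simp: n_subsets intro: finite_subset[of _ "Pow {0..<d}"])

lemma selector_cases: "sel \<in> selectors k d \<Longrightarrow> u \<in> Ukd k d \<Longrightarrow> sel x u = 0 \<or> sel x u = 1"
  by (auto simp: selectors_def)

text \<open>Coordinates with zero amplitude or in an inactive group keep the noise law, so finitely
  many factors suffice on the infinite index set.\<close>

lemma obs_density:
  assumes \<epsilon>: "\<epsilon> > 0" and S: "S \<subseteq> Ukd k d" and J: "finite J" "J \<subseteq> Idx k d"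
    and \<theta>: "\<And>l. l \<notin> J \<Longrightarrow> \<theta> l = 0"
  shows "obs k d \<epsilon> (indicator S) \<theta> = density (PiM (Idx k d) (\<lambda>_. gauss 0 \<epsilon>))
    (\<lambda>x. \<Prod>l\<in>J. if supp l \<in> S then exp (\<theta> l / \<epsilon> * (x l / \<epsilon>) - (\<theta> l / \<epsilon>)\<^sup>2 / 2) else 1)"
  unfolding obs_gauss
proof (rule PiM_density[OF _ _ J])
  fix l
  show "gauss (indicator S (supp l) * \<theta> l) \<epsilon> = density (gauss 0 \<epsilon>)
      (\<lambda>x. ennreal (if supp l \<in> S then exp (\<theta> l / \<epsilon> * (x / \<epsilon>) - (\<theta> l / \<epsilon>)\<^sup>2 / 2) else 1))"
    using gauss_tilt_shift[OF \<epsilon>, of "\<theta> l"] by (cases "supp l \<in> S") (simp_all add: density_1)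
qed (use \<epsilon> \<theta> in \<open>auto simp: prob_space_gauss\<close>)

text \<open>The Hamming loss is at least 1 unless recovery is exact, so the risk dominates the
  probability of inexact recovery.\<close>

lemma risk_ge:
  assumes \<epsilon>: "\<epsilon> > 0" and sel: "sel \<in> selectors k d" and S: "S \<subseteq> Ukd k d"
  shows "1 - risk k d \<epsilon> sel (indicator S) \<theta>
    \<le> measure (obs k d \<epsilon> (indicator S) \<theta>) {x \<in> space (PiM (Idx k d) (\<lambda>_. gauss 0 \<epsilon>)). {u\<in>Ukd k d. sel x u = 1} = S}"
proof -
  let ?M = "obs k d \<epsilon> (indicator S) \<theta>"
  interpret prob_space ?M
    unfolding obs_gauss by (intro prob_space_PiM prob_space_gauss \<epsilon>)
  have sets: "sets ?M = sets (PiM (Idx k d) (\<lambda>_. borel))" "space ?M = space (PiM (Idx k d) (\<lambda>_. gauss 0 \<epsilon>))"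
    by (auto simp: obs_gauss space_PiM intro!: sets_PiM_cong)
  have [measurable]: "(\<lambda>x. sel x u) \<in> borel_measurable ?M" if "u \<in> Ukd k d" for u
    using sel that by (auto simp: selectors_def measurable_cong_sets[OF sets(1) refl])
  let ?E = "{x \<in> space ?M. {u\<in>Ukd k d. sel x u = 1} = S}"
  have Eq: "?E = {x \<in> space ?M. \<forall>u\<in>Ukd k d. sel x u = 1 \<longleftrightarrow> u \<in> S}" using S by auto
  have E[measurable]: "?E \<in> sets ?M" unfolding Eq using finite_Ukd by measurable
  have "1 - measure ?M ?E = measure ?M (space ?M - ?E)" by (rule prob_compl[symmetric, OF E])
  also have "\<dots> = (\<integral>x. indicator (space ?M - ?E) x \<partial>?M)" by simp
  also have "\<dots> \<le> (\<integral>x. (\<Sum>u\<in>Ukd k d. \<bar>indicator S u - sel x u\<bar>) \<partial>?M)"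
  proof (rule integral_mono)
    show "integrable ?M (indicator (space ?M - ?E) :: _ \<Rightarrow> real)"
      by (intro integrable_real_indicator) (auto simp: emeasure_eq_measure)
    show "integrable ?M (\<lambda>x. \<Sum>u\<in>Ukd k d. \<bar>indicator S u - sel x u\<bar>)"
    proof (intro Bochner_Integration.integrable_sum)
      fix u assume u[measurable]: "u \<in> Ukd k d"
      have "norm \<bar>indicator S u - sel x u\<bar> \<le> 1" for x
        using selector_cases[OF sel u, of x] by (auto simp: indicator_def)
      then show "integrable ?M (\<lambda>x. \<bar>indicator S u - sel x u\<bar>)"
        by (intro integrable_const_bound[where B = 1] AE_I2) auto
    qed
    fix x assume x: "x \<in> space ?M"
    show "indicator (space ?M - ?E) x \<le> (\<Sum>u\<in>Ukd k d. \<bar>indicator S u - sel x u\<bar>)"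
    proof (cases "x \<in> ?E")
      case False
      then obtain u where u: "u \<in> Ukd k d" "(sel x u = 1) \<noteq> (u \<in> S)" using x unfolding Eq by auto
      have "1 \<le> \<bar>indicator S u - sel x u\<bar>"
        using u selector_cases[OF sel u(1), of x] by (auto simp: indicator_def)
      also have "\<dots> \<le> (\<Sum>u\<in>Ukd k d. \<bar>indicator S u - sel x u\<bar>)"
        using u finite_Ukd by (intro member_le_sum) auto
      finally show ?thesis by (simp add: indicator_def)
    qed (simp add: sum_nonneg)
  qed
  finally show ?thesis by (simp add: risk_def sets)
qed

text \<open>A worst-case risk below 1/2 would recover every active set under every sign pattern with
  probability above 1/2. Averaging over both turns the likelihoods into products of the statistics
  \<open>L u\<close> and contradicts \<open>small\<close>. Plain sums over the finite sets of
  subsets and signs take the place of a prior measure.\<close>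

lemma minimax_risk_ge_half:
  fixes h :: "(nat \<Rightarrow> int) \<Rightarrow> real"
  defines "P \<equiv> \<lambda>k d \<epsilon>. PiM (Idx k d) (\<lambda>_. gauss 0 \<epsilon>)"
    and "LL \<equiv> \<lambda>F \<epsilon> u x. \<Sum>l\<in>F u. ln (cosh (h l * (x l / \<epsilon>))) - (h l)\<^sup>2 / 2"
  assumes \<epsilon>: "\<epsilon> > 0" and p: "p \<le> card (Ukd k d)"
    and F: "\<And>u. u \<in> Ukd k d \<Longrightarrow> finite (F u)" "\<And>u. u \<in> Ukd k d \<Longrightarrow> F u \<subseteq> Zu u"
    and J: "J = (\<Union>u\<in>Ukd k d. F u)"
    and \<theta>: "\<And>\<xi>. \<xi> \<in> PiE J (\<lambda>_. {1, -1}) \<Longrightarrow> (\<lambda>l. if l \<in> J then \<xi> l * (\<epsilon> * h l) else 0) \<in> Theta_d \<sigma> k d r"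
    and p0: "\<And>u. u \<in> Ukd k d \<Longrightarrow> ennreal p0 \<le> emeasure (P k d \<epsilon>) {x\<in>space (P k d \<epsilon>). t \<le> LL F \<epsilon> u x}" "0 \<le> p0" "p0 \<le> 1"
    and p1: "\<And>u. u \<in> Ukd k d \<Longrightarrow> ennreal p1 \<le> (\<integral>\<^sup>+x. ennreal (exp (LL F \<epsilon> u x)) * indicator {x\<in>space (P k d \<epsilon>). LL F \<epsilon> u x < t} x \<partial>P k d \<epsilon>)" "0 \<le> p1" "p1 \<le> 1"
    and small: "(1 - p1) ^ p + (1 - p0) ^ (card (Ukd k d) - p) \<le> 1/2"
  shows "minimax_risk \<sigma> k d p \<epsilon> r \<ge> ereal (1/2)"
proof (rule ccontr)
  let ?U = "Ukd k d" and ?P = "P k d \<epsilon>"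
  define L where "L u x = exp (LL F \<epsilon> u x)" for u x
  define \<Xi> where "\<Xi> = PiE J (\<lambda>_. {1, -1 :: real})"
  define \<Theta> where "\<Theta> \<xi> l = (if l \<in> J then \<xi> l * (\<epsilon> * h l) else 0)" for \<xi> :: "(nat \<Rightarrow> int) \<Rightarrow> real" and l
  define f where "f S \<xi> x = (\<Prod>l\<in>J. if supp l \<in> S then exp (\<Theta> \<xi> l / \<epsilon> * (x l / \<epsilon>) - (\<Theta> \<xi> l / \<epsilon>)\<^sup>2 / 2) else 1)"
    for S \<xi> and x :: "(nat \<Rightarrow> int) \<Rightarrow> real"
  interpret P: product_prob_space "\<lambda>_. gauss 0 \<epsilon>" "Idx k d"
    using \<epsilon> by (rule product_prob_space_gauss)
  have P_eq: "?P = PiM (Idx k d) (\<lambda>_. gauss 0 \<epsilon>)" by (simp add: P_def)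
  have finJ: "finite J" using F finite_Ukd by (simp add: J)
  have FI: "F u \<subseteq> Idx k d" if "u \<in> ?U" for u using F(2)[OF that] that by (auto simp: Idx_def)
  have J_Idx: "J \<subseteq> Idx k d" using FI by (auto simp: J)
  have supp: "supp l = u" if "u \<in> ?U" "l \<in> F u" for l u using F(2) that by (auto simp: Zu_def)
  have disj: "disjoint_family_on F ?U" using supp by (auto simp: disjoint_family_on_def)
  have Xi: "finite \<Xi>" "card \<Xi> > 0"
  proof -
    show "finite \<Xi>" using finJ by (simp add: \<Xi>_def finite_PiE)
    have "card \<Xi> = 2 ^ card J" using finJ by (simp add: \<Xi>_def card_PiE numeral_2_eq_2)
    then show "card \<Xi> > 0" by simp
  qed
  \<comment> \<open>The squared amplitudes do not see the sign, so the sum over all sign patterns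
    factorises by coordinates, each factor being twice a \<open>cosh\<close> term, or 2 in an
    inactive group.\<close>
  have mix: "(\<Sum>\<xi>\<in>\<Xi>. f S \<xi> x) = card \<Xi> * (\<Prod>u\<in>S. L u x)" if S: "S \<subseteq> ?U" for S x
  proof -
    define g where "g l s = (if supp l \<in> S then exp (s * h l * (x l / \<epsilon>) - (h l)\<^sup>2 / 2) else 1)" for l s
    have "f S \<xi> x = (\<Prod>l\<in>J. g l (\<xi> l))" if "\<xi> \<in> \<Xi>" for \<xi>
      unfolding f_def
    proof (rule prod.cong[OF refl])
      fix l assume l: "l \<in> J"
      then have "\<Theta> \<xi> l / \<epsilon> = \<xi> l * h l" using \<epsilon> by (simp add: \<Theta>_def)
      moreover have "\<xi> l = 1 \<or> \<xi> l = -1" using that l by (auto simp: \<Xi>_def PiE_def Pi_def)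
      then have "(\<xi> l * h l)\<^sup>2 = (h l)\<^sup>2" by auto
      ultimately show "(if supp l \<in> S then exp (\<Theta> \<xi> l / \<epsilon> * (x l / \<epsilon>) - (\<Theta> \<xi> l / \<epsilon>)\<^sup>2 / 2) else 1) = g l (\<xi> l)"
        by (simp add: g_def)
    qed
    then have "(\<Sum>\<xi>\<in>\<Xi>. f S \<xi> x) = (\<Sum>\<xi>\<in>\<Xi>. \<Prod>l\<in>J. g l (\<xi> l))" by (rule sum.cong[OF refl])
    also have "\<dots> = (\<Prod>l\<in>J. \<Sum>s\<in>{1, -1}. g l s)"
      unfolding \<Xi>_def using finJ by (subst prod_sum_PiE) auto
    also have "\<dots> = (\<Prod>l\<in>J. 2 * (if supp l \<in> S then exp (ln (cosh (h l * (x l / \<epsilon>))) - (h l)\<^sup>2 / 2) else 1))"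
    proof (intro prod.cong refl)
      fix l
      have cosh_mix: "exp (a - b) + exp (- a - b) = 2 * exp (ln (cosh a) - b)" for a b :: real
        by (simp add: exp_diff, simp add: cosh_def add_divide_distrib)
      show "(\<Sum>s\<in>{1, -1}. g l s) = 2 * (if supp l \<in> S then exp (ln (cosh (h l * (x l / \<epsilon>))) - (h l)\<^sup>2 / 2) else 1)"
        using cosh_mix[of "h l * (x l / \<epsilon>)" "(h l)\<^sup>2 / 2"] by (simp add: g_def)
    qed
    also have "\<dots> = 2 ^ card J * (\<Prod>l\<in>J. if supp l \<in> S then exp (ln (cosh (h l * (x l / \<epsilon>))) - (h l)\<^sup>2 / 2) else 1)"
      by (simp add: prod.distrib)
    also have "2 ^ card J = real (card \<Xi>)" using finJ by (simp add: \<Xi>_def card_PiE numeral_2_eq_2)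
    also have "(\<Prod>l\<in>J. if supp l \<in> S then exp (ln (cosh (h l * (x l / \<epsilon>))) - (h l)\<^sup>2 / 2) else 1)
        = (\<Prod>u\<in>?U. \<Prod>l\<in>F u. if supp l \<in> S then exp (ln (cosh (h l * (x l / \<epsilon>))) - (h l)\<^sup>2 / 2) else 1)"
      unfolding J using finite_Ukd F disj
      by (intro prod.UNION_disjoint) (auto simp: disjoint_family_on_def)
    also have "\<dots> = (\<Prod>u\<in>?U. if u \<in> S then L u x else 1)"
      using F supp by (intro prod.cong refl) (auto simp: L_def LL_def exp_sum)
    also have "\<dots> = (\<Prod>u\<in>S. L u x)"
      using finite_Ukd S by (simp add: prod.inter_restrict[symmetric] Int_absorb1)
    finally show ?thesis .
  qed
  have fm[measurable]: "f S \<xi> \<in> borel_measurable ?P" for S \<xi>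
  proof -
    have [measurable]: "(\<lambda>x. x l) \<in> borel_measurable ?P" if "l \<in> J" for l
      using that J_Idx unfolding P_eq by auto
    show ?thesis unfolding f_def by measurable
  qed
  have f0: "f S \<xi> x \<ge> 0" for S \<xi> x unfolding f_def by (intro prod_nonneg) auto
  have obs: "obs k d \<epsilon> (indicator S) (\<Theta> \<xi>) = density ?P (f S \<xi>)" if "S \<subseteq> ?U" for S \<xi>
    unfolding f_def P_eq using \<epsilon> that finJ J_Idx by (intro obs_density) (auto simp: \<Theta>_def)
  have mixE: "(\<Sum>\<xi>\<in>\<Xi>. emeasure (obs k d \<epsilon> (indicator S) (\<Theta> \<xi>)) E)
      = of_nat (card \<Xi>) * (\<integral>\<^sup>+x. ennreal (\<Prod>u\<in>S. L u x) * indicator E x \<partial>?P)"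
    if S: "S \<subseteq> ?U" and E[measurable]: "E \<in> sets ?P" for S E
  proof -
    have "(\<Sum>\<xi>\<in>\<Xi>. emeasure (obs k d \<epsilon> (indicator S) (\<Theta> \<xi>)) E) = (\<Sum>\<xi>\<in>\<Xi>. \<integral>\<^sup>+x. ennreal (f S \<xi> x) * indicator E x \<partial>?P)"
      using S E by (simp add: obs emeasure_density)
    also have "\<dots> = (\<integral>\<^sup>+x. (\<Sum>\<xi>\<in>\<Xi>. ennreal (f S \<xi> x) * indicator E x) \<partial>?P)"
      by (intro nn_integral_sum[symmetric]) measurable
    also have "\<dots> = (\<integral>\<^sup>+x. of_nat (card \<Xi>) * (ennreal (\<Prod>u\<in>S. L u x) * indicator E x) \<partial>?P)"
    proof (intro nn_integral_cong)
      fix x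
      have "(\<Sum>\<xi>\<in>\<Xi>. ennreal (f S \<xi> x)) = of_nat (card \<Xi>) * ennreal (\<Prod>u\<in>S. L u x)"
        using f0 by (simp add: mix[OF S] ennreal_mult L_def prod_nonneg ennreal_of_nat_eq_real_of_nat)
      then show "(\<Sum>\<xi>\<in>\<Xi>. ennreal (f S \<xi> x) * indicator E x) = of_nat (card \<Xi>) * (ennreal (\<Prod>u\<in>S. L u x) * indicator E x)"
        by (simp add: sum_distrib_right[symmetric] mult.assoc)
    qed
    also have "\<dots> = of_nat (card \<Xi>) * (\<integral>\<^sup>+x. ennreal (\<Prod>u\<in>S. L u x) * indicator E x \<partial>?P)"
    proof (intro nn_integral_cmult)
      have "(\<lambda>x. \<Prod>u\<in>S. L u x) = (\<lambda>x. (\<Sum>\<xi>\<in>\<Xi>. f S \<xi> x) / card \<Xi>)"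
        using Xi(2) by (auto simp: mix[OF S] fun_eq_iff card_gt_0_iff)
      then have [measurable]: "(\<lambda>x. \<Prod>u\<in>S. L u x) \<in> borel_measurable ?P" by simp
      show "(\<lambda>x. ennreal (\<Prod>u\<in>S. L u x) * indicator E x) \<in> borel_measurable ?P" by measurable
    qed
    finally show ?thesis .
  qed
  \<comment> \<open>No Gaussian integral is needed: for \<open>S = {u}\<close> and the whole space
    as event, \<open>mixE\<close> compares \<open>card \<Xi>\<close> probability measures with the
    integral of \<open>L u\<close>.\<close>
  have L1: "(\<integral>\<^sup>+x. L u x \<partial>?P) = 1" if u: "u \<in> ?U" for u
  proof -
    have 1: "emeasure (obs k d \<epsilon> (indicator {u}) (\<Theta> \<xi>)) (space ?P) = 1" for \<xi>
    proof -
      interpret O: prob_space "obs k d \<epsilon> (indicator {u}) (\<Theta> \<xi>)"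
        unfolding obs_gauss by (intro prob_space_PiM prob_space_gauss \<epsilon>)
      have "space (obs k d \<epsilon> (indicator {u}) (\<Theta> \<xi>)) = space ?P" by (simp add: obs_gauss P_eq space_PiM)
      then show ?thesis using O.emeasure_space_1 by simp
    qed
    have "of_nat (card \<Xi>) * (1::ennreal) = of_nat (card \<Xi>) * (\<integral>\<^sup>+x. ennreal (\<Prod>u\<in>{u}. L u x) * indicator (space ?P) x \<partial>?P)"
      using u by (subst mixE[symmetric]) (auto simp: 1)
    also have "(\<integral>\<^sup>+x. ennreal (\<Prod>u\<in>{u}. L u x) * indicator (space ?P) x \<partial>?P) = (\<integral>\<^sup>+x. L u x \<partial>?P)"
      by (intro nn_integral_cong) auto
    finally show ?thesis
      using Xi by (subst (asm) ennreal_mult_cancel_left) auto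
  qed
  have ind: "P.P.indep_vars (\<lambda>_. borel) L ?U"
  proof -
    have *: "L u (restrict x (F u)) = L u x" for u x
      unfolding L_def LL_def by (intro arg_cong[where f = exp] sum.cong) auto
    have "L u \<in> borel_measurable (PiM (F u) (\<lambda>_. gauss 0 \<epsilon>))" if "u \<in> ?U" for u
      unfolding L_def LL_def by measurable
    from P.indep_vars_blocks[OF FI disj this] show ?thesis unfolding * by (simp add: eta_contract_eq)
  qed
  define H where "H = {S. S \<subseteq> ?U \<and> card S = p}"
  have H: "finite H" "card H > 0"
  proof -
    have "card H = card ?U choose p" unfolding H_def by (intro n_subsets finite_Ukd)
    then show "card H > 0" using p by simp
    then show "finite H" by (rule card_ge_0_finite)
  qed
  assume "\<not> ereal (1/2) \<le> minimax_risk \<sigma> k d p \<epsilon> r"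
  then obtain sel where sel: "sel \<in> selectors k d"
      "(SUP \<eta>\<in>Hset k d p. SUP \<theta>\<in>Theta_d \<sigma> k d r. ereal (risk k d \<epsilon> sel \<eta> \<theta>)) < ereal (1/2)"
    unfolding minimax_risk_def by (auto simp: not_le INF_less_iff)
  define T where "T x = {u\<in>?U. sel x u = 1}" for x
  have T: "{x\<in>space ?P. T x = S} \<in> sets ?P" if "S \<subseteq> ?U" for S
  proof -
    have sets: "sets ?P = sets (PiM (Idx k d) (\<lambda>_. borel))"
      by (auto simp: P_eq intro!: sets_PiM_cong)
    have [measurable]: "(\<lambda>x. sel x u) \<in> borel_measurable ?P" if "u \<in> ?U" for u
      using sel that by (auto simp: selectors_def measurable_cong_sets[OF sets refl])
    have "{x\<in>space ?P. T x = S} = {x \<in> space ?P. \<forall>u\<in>?U. sel x u = 1 \<longleftrightarrow> u \<in> S}"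
      using that by (auto simp: T_def)
    also have "\<dots> \<in> sets ?P" using finite_Ukd by measurable
    finally show ?thesis .
  qed
  define m where "m S \<xi> = measure (obs k d \<epsilon> (indicator S) (\<Theta> \<xi>)) {x\<in>space ?P. T x = S}" for S \<xi>
  have gt: "1/2 < m S \<xi>" "emeasure (obs k d \<epsilon> (indicator S) (\<Theta> \<xi>)) {x\<in>space ?P. T x = S} = ennreal (m S \<xi>)"
    if "S \<in> H" "\<xi> \<in> \<Xi>" for S \<xi>
  proof -
    have S: "S \<subseteq> ?U" using that by (simp add: H_def)
    have "{u \<in> ?U. indicator S u = (1::real)} = S" using S by (auto simp: indicator_def)
    then have "indicator S \<in> Hset k d p" using that by (auto simp: Hset_def H_def indicator_def)
    moreover have "\<Theta> \<xi> \<in> Theta_d \<sigma> k d r"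
      using \<theta>[of \<xi>] that unfolding \<Xi>_def \<Theta>_def[abs_def] by simp
    ultimately have "ereal (risk k d \<epsilon> sel (indicator S) (\<Theta> \<xi>))
        \<le> (SUP \<eta>\<in>Hset k d p. SUP \<theta>\<in>Theta_d \<sigma> k d r. ereal (risk k d \<epsilon> sel \<eta> \<theta>))"
      by (intro SUP_upper2[of "indicator S"] SUP_upper2[of "\<Theta> \<xi>"]) auto
    with sel(2) have "risk k d \<epsilon> sel (indicator S) (\<Theta> \<xi>) < 1/2" by (meson ereal_less_eq(3) not_le order_trans)
    with risk_ge[OF \<epsilon> sel(1) S, of "\<Theta> \<xi>"]
    show "1/2 < m S \<xi>"
      by (simp add: P_eq T_def m_def)
    interpret O: prob_space "obs k d \<epsilon> (indicator S) (\<Theta> \<xi>)"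
      unfolding obs_gauss by (intro prob_space_PiM prob_space_gauss \<epsilon>)
    show "emeasure (obs k d \<epsilon> (indicator S) (\<Theta> \<xi>)) {x\<in>space ?P. T x = S} = ennreal (m S \<xi>)"
      unfolding O.emeasure_eq_measure m_def ..
  qed
  have "of_nat (card H) * (of_nat (card \<Xi>) * ennreal (1/2))
     < (\<Sum>S\<in>H. \<Sum>\<xi>\<in>\<Xi>. emeasure (obs k d \<epsilon> (indicator S) (\<Theta> \<xi>)) {x\<in>space ?P. T x = S})"
  proof -
    have ne: "H \<noteq> {}" "\<Xi> \<noteq> {}" using H Xi by auto
    \<comment> \<open>The strict inequality is summed over the reals and only then moved to
      \<open>ennreal\<close>.\<close>
    have "(\<Sum>S\<in>H. \<Sum>\<xi>\<in>\<Xi>. 1/2) < (\<Sum>S\<in>H. \<Sum>\<xi>\<in>\<Xi>. m S \<xi>)"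
      using H(1) Xi(1) ne gt(1) by (intro sum_strict_mono) auto
    then have "ennreal (\<Sum>S\<in>H. \<Sum>\<xi>\<in>\<Xi>. 1/2) < ennreal (\<Sum>S\<in>H. \<Sum>\<xi>\<in>\<Xi>. m S \<xi>)"
      by (subst ennreal_less_iff) (auto intro!: sum_nonneg)
    also have "(\<Sum>S\<in>H. \<Sum>\<xi>\<in>\<Xi>. 1/2) = real (card H) * (real (card \<Xi>) * (1/2))" by simp
    also have "ennreal \<dots> = of_nat (card H) * (of_nat (card \<Xi>) * ennreal (1/2))"
      by (subst ennreal_mult, simp, simp, subst ennreal_mult, simp, simp, simp only: ennreal_of_nat_eq_real_of_nat)
    also have "ennreal (\<Sum>S\<in>H. \<Sum>\<xi>\<in>\<Xi>. m S \<xi>) = (\<Sum>S\<in>H. ennreal (\<Sum>\<xi>\<in>\<Xi>. m S \<xi>))"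
      by (intro sum_ennreal[symmetric] sum_nonneg) (simp add: m_def)
    also have "\<dots> = (\<Sum>S\<in>H. \<Sum>\<xi>\<in>\<Xi>. ennreal (m S \<xi>))"
      by (intro sum.cong refl sum_ennreal[symmetric]) (simp add: m_def)
    also have "\<dots> = (\<Sum>S\<in>H. \<Sum>\<xi>\<in>\<Xi>. emeasure (obs k d \<epsilon> (indicator S) (\<Theta> \<xi>)) {x\<in>space ?P. T x = S})"
      using gt(2) by simp
    finally show ?thesis .
  qed
  also have "\<dots> = (\<Sum>S\<in>H. of_nat (card \<Xi>) * (\<integral>\<^sup>+x. ennreal (\<Prod>u\<in>S. L u x) * indicator {x\<in>space ?P. T x = S} x \<partial>?P))"
    using T by (intro sum.cong refl mixE) (auto simp: H_def)
  also have "\<dots> = of_nat (card \<Xi>) * (\<Sum>S\<in>H. \<integral>\<^sup>+x. ennreal (\<Prod>u\<in>S. L u x) * indicator {x\<in>space ?P. T x = S} x \<partial>?P)"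
    by (rule sum_distrib_left[symmetric])
  also have "\<dots> \<le> of_nat (card \<Xi>) * (of_nat (card H) * ennreal ((1 - p1) ^ p + (1 - p0) ^ (card ?U - p)))"
    unfolding H_def P_eq
  proof (intro mult_left_mono P.P.top_selection_bound[OF finite_Ukd ind, where \<tau> = "exp t"])
    show "(\<integral>\<^sup>+x. L u x \<partial>PiM (Idx k d) (\<lambda>_. gauss 0 \<epsilon>)) = 1" if "u \<in> ?U" for u
      using L1[OF that] by (simp add: P_eq)
  qed (use p0 p1 T in \<open>auto simp: L_def P_eq\<close>)
  also have "\<dots> \<le> of_nat (card \<Xi>) * (of_nat (card H) * ennreal (1/2))"
    using small by (intro mult_left_mono ennreal_leI) auto
  finally show False by (simp add: mult_ac)
qed

section \<open>The extremal problem\<close>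

text \<open>The problem is to minimise \<open>\<Sum> v\<^sup>2\<close> over \<open>v \<ge> 0\<close> with \<open>\<Sum> v \<ge> r\<^sup>2\<close> and \<open>\<Sum> v * c \<le> 1\<close>.
  Its solutions are \<open>v = w T / Wc T\<close>, of value \<open>\<rho> T\<close>; parametrising by \<open>T\<close> (or by the value)
  instead of by \<open>r\<close> avoids solving for the multipliers.\<close>
locale extremal_problem =
  fixes Z :: "'i set" and c :: "'i \<Rightarrow> real"
  assumes c_ge: "\<And>l. l \<in> Z \<Longrightarrow> 1 \<le> c l" and fin: "\<And>T. finite {l\<in>Z. c l \<le> T}" and inf: "infinite Z"
begin

definition "lev T = {l\<in>Z. c l \<le> T}"

text \<open>Stationarity for the quadratic objective with multipliers for both constraints makes
  \<open>v\<close> proportional to 1 - c / T on its support; the cutoff \<open>T\<close> is the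
  ratio of the multipliers.\<close>

definition "w T l = max 0 (1 - c l / T)"

definition "W2 T = (\<Sum>l\<in>lev T. (w T l)\<^sup>2)"

definition "Wc T = (\<Sum>l\<in>lev T. w T l * c l)"

definition "\<rho> T = W2 T / (Wc T)\<^sup>2"

lemma finite_lev[simp, intro]: "finite (lev T)" unfolding lev_def by (rule fin)

lemma w_nonneg: "0 \<le> w T l" by (simp add: w_def)

lemma w_le_1: "l \<in> Z \<Longrightarrow> T > 0 \<Longrightarrow> w T l \<le> 1"
  using c_ge[of l] by (simp add: w_def)

lemma w_outside: "l \<in> Z - lev T \<Longrightarrow> T > 0 \<Longrightarrow> w T l = 0"
  by (auto simp: w_def lev_def)

lemma w_lev: "l \<in> lev T \<Longrightarrow> T > 0 \<Longrightarrow> w T l = 1 - c l / T"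
  by (auto simp: w_def lev_def)

lemma W2_le_Wc: assumes "T > 0" shows "W2 T \<le> Wc T"
  unfolding W2_def Wc_def
proof (rule sum_mono)
  fix l assume "l \<in> lev T"
  then have "w T l \<le> c l" using w_le_1[of l T] c_ge[of l] assms by (auto simp: lev_def)
  then have "w T l * w T l \<le> w T l * c l" by (rule mult_left_mono[OF _ w_nonneg])
  then show "(w T l)\<^sup>2 \<le> w T l * c l" by (simp add: power2_eq_square)
qed

text \<open>Up to half the cutoff the weight is at least 1/2; this is how \<open>W2\<close> is made
  large.\<close>

lemma W2_ge_card:
  assumes "B \<subseteq> {l\<in>Z. c l \<le> T / 2}" "T > 0"
  shows "real (card B) / 4 \<le> W2 T"
proof -
  have B: "B \<subseteq> lev T" using assms by (auto simp: lev_def)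
  have "1/4 \<le> (w T l)\<^sup>2" if "l \<in> B" for l
  proof -
    have "1/2 \<le> w T l" using that assms by (auto simp: w_def field_simps)
    then have "(1/2)\<^sup>2 \<le> (w T l)\<^sup>2" by (intro power_mono) auto
    then show ?thesis by (simp add: power2_eq_square)
  qed
  then have "(\<Sum>l\<in>B. 1/4) \<le> (\<Sum>l\<in>B. (w T l)\<^sup>2)" by (rule sum_mono)
  also have "\<dots> \<le> W2 T" unfolding W2_def using B by (intro sum_mono2) auto
  finally show ?thesis by simp
qed

lemma rho_le:
  assumes "T > 0" "W2 T > 0" shows "\<rho> T \<le> 1 / W2 T"
proof -
  have "(W2 T)\<^sup>2 \<le> (Wc T)\<^sup>2" using W2_le_Wc[OF assms(1)] assms(2) by (intro power_mono) auto
  then have "\<rho> T \<le> W2 T / (W2 T)\<^sup>2"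
    unfolding \<rho>_def using assms W2_le_Wc[OF assms(1)] by (intro divide_left_mono) auto
  then show ?thesis using assms(2) by (simp add: power2_eq_square)
qed

text \<open>As \<open>c\<close> is at most \<open>T\<close> on \<open>lev T\<close>,
  \<open>Wc T\<close> is at most \<open>T\<close> times the sum of the weights, which Cauchy-Schwarz
  compares with \<open>W2 T\<close>. So the value is only polynomially small in the cutoff and in
  the number of indices below it.\<close>

lemma rho_ge:
  assumes T: "T > 0" and W: "W2 T > 0" and n: "real (card (lev T)) \<le> n"
  shows "1 / (n * T\<^sup>2) \<le> \<rho> T"
proof -
  have "card (lev T) > 0" using W by (auto simp: W2_def card_gt_0_iff)
  then have n0: "n > 0" using n by linarith
  let ?S = "\<Sum>l\<in>lev T. w T l"
  have "?S\<^sup>2 \<le> real (card (lev T)) * W2 T"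
    using Cauchy_Schwarz_ineq_sum[of "\<lambda>_. 1" "w T" "lev T"] by (simp add: W2_def)
  also have "\<dots> \<le> n * W2 T" using n W by (intro mult_right_mono) auto
  finally have S: "?S\<^sup>2 \<le> n * W2 T" .
  have "Wc T \<le> (\<Sum>l\<in>lev T. w T l * T)"
    unfolding Wc_def by (intro sum_mono mult_left_mono w_nonneg) (auto simp: lev_def)
  then have "Wc T \<le> T * ?S" by (simp add: sum_distrib_left mult.commute)
  moreover have Wc: "Wc T > 0" using W2_le_Wc[OF T] W by simp
  ultimately have "(Wc T)\<^sup>2 \<le> (T * ?S)\<^sup>2" by (intro power_mono) auto
  also have "\<dots> \<le> T\<^sup>2 * (n * W2 T)" unfolding power_mult_distrib using S by (intro mult_left_mono) auto
  finally have "(Wc T)\<^sup>2 \<le> W2 T * (n * T\<^sup>2)" by (simp add: mult_ac)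
  then show ?thesis unfolding \<rho>_def using n0 T Wc by (simp add: divide_simps mult_ac)
qed

lemma W2_mono:
  assumes "W2 T0 > 0" "0 < T0" "T0 \<le> T" shows "W2 T0 \<le> W2 T"
proof -
  have "W2 T0 \<le> (\<Sum>l\<in>lev T0. (w T l)\<^sup>2)"
    unfolding W2_def
  proof (intro sum_mono power_mono w_nonneg)
    fix l assume "l \<in> lev T0"
    then have "c l / T \<le> c l / T0" using assms c_ge[of l] by (intro divide_left_mono) (auto simp: lev_def)
    then show "w T0 l \<le> w T l" by (simp add: w_def)
  qed
  also have "\<dots> \<le> W2 T" unfolding W2_def using assms by (intro sum_mono2) (auto simp: lev_def fin)
  finally show ?thesis .
qed

text \<open>The value is continuous in \<open>T\<close> beyond \<open>T0\<close> and, as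
  \<open>Z\<close> is infinite, becomes arbitrarily small, so the intermediate value theorem
  applies.\<close>

lemma ex_radius:
  assumes T0: "T0 > 0" "W2 T0 > 0" and y: "0 < y" "y \<le> \<rho> T0"
  obtains T where "T \<ge> T0" "\<rho> T = y"
proof -
  obtain B where B: "B \<subseteq> Z" "finite B" "card B = Suc (nat \<lceil>4 / y\<rceil>)"
    using infinite_arbitrarily_large[OF inf] by blast
  define T1 where "T1 = max T0 (2 * Max (c ` B))"
  have T1: "T1 \<ge> T0" "T1 > 0" using T0 by (auto simp: T1_def)
  have "c l \<le> T1 / 2" if "l \<in> B" for l
  proof -
    have "c l \<le> Max (c ` B)" using B that by (intro Max_ge) auto
    then show ?thesis by (simp add: T1_def)
  qed
  then have "real (card B) / 4 \<le> W2 T1" using B T1 by (intro W2_ge_card) auto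
  moreover have "4 / y < real (card B)" unfolding B(3) by linarith
  ultimately have "1 / y < W2 T1" by simp
  moreover have "0 < 1 / y" using y by simp
  ultimately have W1: "W2 T1 > 0" by linarith
  with \<open>1 / y < W2 T1\<close> have W2: "1 / W2 T1 \<le> y" using y by (simp add: field_simps)
  \<comment> \<open>\<open>lev T\<close> jumps with \<open>T\<close>, but the weights vanish outside
    it; over the fixed finite set \<open>lev T1\<close> both sums are visibly continuous.\<close>
  have *: "\<rho> T = (\<Sum>l\<in>lev T1. (w T l)\<^sup>2) / (\<Sum>l\<in>lev T1. w T l * c l)\<^sup>2" "(\<Sum>l\<in>lev T1. w T l * c l) \<noteq> 0"
    if "T0 \<le> T" "T \<le> T1" for T
  proof -
    have "lev T \<subseteq> lev T1" "\<And>l. l \<in> lev T1 - lev T \<Longrightarrow> w T l = 0"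
      using that T0 w_outside[of _ T] by (auto simp: lev_def)
    then have eq: "W2 T = (\<Sum>l\<in>lev T1. (w T l)\<^sup>2)" "Wc T = (\<Sum>l\<in>lev T1. w T l * c l)"
      unfolding W2_def Wc_def by (auto intro!: sum.mono_neutral_left)
    then show "\<rho> T = (\<Sum>l\<in>lev T1. (w T l)\<^sup>2) / (\<Sum>l\<in>lev T1. w T l * c l)\<^sup>2" by (simp add: \<rho>_def)
    show "(\<Sum>l\<in>lev T1. w T l * c l) \<noteq> 0"
      using W2_le_Wc[of T] W2_mono[OF T0(2,1) that(1)] T0 that unfolding eq(2)[symmetric] by auto
  qed
  have "continuous_on {T0..T1} (\<lambda>T. (\<Sum>l\<in>lev T1. (w T l)\<^sup>2) / (\<Sum>l\<in>lev T1. w T l * c l)\<^sup>2)"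
    using *(2) T0 unfolding w_def by (intro continuous_intros) auto
  then have "continuous_on {T0..T1} \<rho>"
    using *(1) by (subst continuous_on_cong[OF refl]) auto
  moreover have "\<rho> T1 \<le> y" using rho_le[OF T1(2) W1] W2 by simp
  ultimately obtain T where "T0 \<le> T" "T \<le> T1" "\<rho> T = y"
    using IVT2'[of \<rho> T1 y T0] y T1 by auto
  then show ?thesis by (intro that)
qed

text \<open>Pairing a feasible sequence with the extremal weight \<open>w T\<close> bounds its mass from above, by the
  Cauchy-Schwarz inequality; the extremal sequence attains this bound.\<close>
lemma extremal_mass:
  fixes v :: "'i \<Rightarrow> real"
  assumes T: "T > 0" "W2 T > 0" and v: "\<And>l. v l \<ge> 0" "v summable_on Z" "(\<lambda>l. v l * c l) summable_on Z"
      "(\<Sum>\<^sub>\<infinity>l\<in>Z. v l * c l) \<le> 1"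
    and v2: "(\<Sum>\<^sub>\<infinity>l\<in>Z. (v l)\<^sup>2) \<le> \<rho> T"
  shows "(\<Sum>\<^sub>\<infinity>l\<in>Z. v l) \<le> (\<Sum>l\<in>lev T. w T l / Wc T)"
proof -
  have Wc: "Wc T > 0" using W2_le_Wc[OF T(1)] T by simp
  have sm: "(\<lambda>l. (- 1 / T) * (v l * c l)) summable_on Z" "(\<lambda>l. v l + (- 1 / T) * (v l * c l)) summable_on Z"
    using v by (intro summable_on_add summable_on_cmult_right; simp)+
  \<comment> \<open>The smoothness constraint enters with multiplier 1 / T; the resulting weight 1 -
    c / T equals \<open>w T\<close> on \<open>lev T\<close> and is negative on the rest of
    \<open>Z\<close>.\<close>
  have "(\<Sum>\<^sub>\<infinity>l\<in>Z. v l) - 1 / T \<le> (\<Sum>\<^sub>\<infinity>l\<in>Z. v l) + (- 1 / T) * (\<Sum>\<^sub>\<infinity>l\<in>Z. v l * c l)"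
    using v(4) T by (simp add: divide_right_mono)
  also have "\<dots> = (\<Sum>\<^sub>\<infinity>l\<in>Z. v l + (- 1 / T) * (v l * c l))"
    unfolding infsum_add[OF v(2) sm(1)] infsum_cmult_right' ..
  also have "\<dots> \<le> (\<Sum>\<^sub>\<infinity>l\<in>lev T. v l * w T l)"
  proof (rule infsum_mono_neutral[OF sm(2)])
    show "v l + (- 1 / T) * (v l * c l) \<le> v l * w T l" if "l \<in> Z \<inter> lev T" for l
      using that T by (simp add: w_lev algebra_simps)
    show "v l + (- 1 / T) * (v l * c l) \<le> 0" if "l \<in> Z - lev T" for l
    proof -
      have "1 \<le> c l / T" using that T by (auto simp: lev_def)
      then have "v l * 1 \<le> v l * (c l / T)" using v(1) by (rule mult_left_mono)
      then show ?thesis by simp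
    qed
  qed (auto simp: lev_def fin)
  also have "\<dots> = (\<Sum>l\<in>lev T. v l * w T l)" by simp
  also have "\<dots> \<le> sqrt ((\<Sum>l\<in>lev T. (v l)\<^sup>2) * W2 T)"
    unfolding W2_def by (intro real_le_rsqrt Cauchy_Schwarz_ineq_sum)
  also have "\<dots> \<le> sqrt (\<rho> T * W2 T)"
  proof -
    \<comment> \<open>Without square summability the sum in \<open>v2\<close> would have the default
      value 0 and bound nothing. It holds because each \<open>v l\<close> is at most the total
      mass.\<close>
    have "(\<lambda>l. (v l)\<^sup>2) summable_on Z"
    proof -
      have "(\<lambda>l. (\<Sum>\<^sub>\<infinity>l\<in>Z. v l) * v l) summable_on Z" using v by (intro summable_on_cmult_right)
      then show ?thesis
      proof (rule summable_on_comparison_test)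
        fix l assume l: "l \<in> Z"
        have "v l = (\<Sum>\<^sub>\<infinity>l\<in>{l}. v l)" by simp
        also have "\<dots> \<le> (\<Sum>\<^sub>\<infinity>l\<in>Z. v l)"
          using l v by (intro infsum_mono_neutral) auto
        finally show "(v l)\<^sup>2 \<le> (\<Sum>\<^sub>\<infinity>l\<in>Z. v l) * v l"
          using v(1) by (simp add: power2_eq_square mult_right_mono)
      qed auto
    qed
    then have "(\<Sum>\<^sub>\<infinity>l\<in>lev T. (v l)\<^sup>2) \<le> (\<Sum>\<^sub>\<infinity>l\<in>Z. (v l)\<^sup>2)"
      by (intro infsum_mono_neutral) (auto simp: lev_def fin)
    then show ?thesis using v2 T by (intro real_sqrt_le_mono mult_right_mono) auto
  qed
  also have "\<dots> = W2 T / Wc T"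
    using T Wc by (intro real_sqrt_unique) (auto simp: \<rho>_def power2_eq_square)
  also have "\<dots> = (\<Sum>l\<in>lev T. w T l / Wc T) - 1 / T"
  proof -
    \<comment> \<open>The extremal sequence meets the smoothness constraint with equality, so the
      same pairing computes its mass exactly.\<close>
    have "W2 T = (\<Sum>l\<in>lev T. w T l - w T l * c l / T)"
      unfolding W2_def
    proof (intro sum.cong refl)
      fix l assume "l \<in> lev T"
      then have "(w T l)\<^sup>2 = w T l * (1 - c l / T)" using T by (simp add: w_lev power2_eq_square)
      then show "(w T l)\<^sup>2 = w T l - w T l * c l / T" by (simp add: right_diff_distrib)
    qed
    also have "\<dots> = (\<Sum>l\<in>lev T. w T l) - Wc T / T"
      by (simp add: sum_subtractf Wc_def sum_divide_distrib)
    finally show ?thesis using Wc by (simp add: sum_divide_distrib[symmetric] diff_divide_distrib)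
  qed
  finally show ?thesis by simp
qed

end

section \<open>Counting lattice indices below a smoothness level, and transport between
  groups\<close>

lemma Zu_supp: "l \<in> Zu u \<Longrightarrow> supp l = u"
  by (simp add: Zu_def)

lemma sum_squares_ge:
  assumes "l \<in> Zu u" "finite u" "j \<in> u"
  shows "(2 * pi * real_of_int (l j))\<^sup>2 \<le> (\<Sum>j\<in>supp l. (2 * pi * real_of_int (l j))\<^sup>2)"
    "(2 * pi)\<^sup>2 \<le> (2 * pi * real_of_int (l j))\<^sup>2"
proof -
  show "(2 * pi * real_of_int (l j))\<^sup>2 \<le> (\<Sum>j\<in>supp l. (2 * pi * real_of_int (l j))\<^sup>2)"
    using assms Zu_supp[OF assms(1)] by (intro member_le_sum) auto
  have "l j \<noteq> 0" using assms by (auto simp: Zu_def supp_def)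
  then have "1 \<le> \<bar>real_of_int (l j)\<bar>" by linarith
  then have "1\<^sup>2 \<le> \<bar>real_of_int (l j)\<bar>\<^sup>2" by (intro power_mono) auto
  then show "(2 * pi)\<^sup>2 \<le> (2 * pi * real_of_int (l j))\<^sup>2"
    by (simp add: power_mult_distrib)
qed

lemma csq_ge_1:
  assumes "l \<in> Zu u" "finite u" "u \<noteq> {}" "\<sigma> > 0"
  shows "1 \<le> csq \<sigma> l"
proof -
  obtain j where j: "j \<in> u" using assms by auto
  have "1 \<le> (2 * pi)\<^sup>2" using pi_gt3 by (intro one_le_power) simp
  also note sum_squares_ge(2)[OF assms(1,2) j]
  also note sum_squares_ge(1)[OF assms(1,2) j]
  finally show ?thesis unfolding csq_def using assms(4) by (intro ge_one_powr_ge_zero) auto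
qed

lemma csq_le_imp:
  assumes "l \<in> Zu u" "finite u" "\<sigma> > 0" "csq \<sigma> l \<le> (2 * pi * b)\<^sup>2 powr \<sigma>" "b \<ge> 0"
  shows "\<bar>real_of_int (l j)\<bar> \<le> b"
proof (cases "j \<in> u")
  case True
  have "(\<Sum>j\<in>supp l. (2 * pi * real_of_int (l j))\<^sup>2) \<le> (2 * pi * b)\<^sup>2"
  proof (rule ccontr)
    assume "\<not> ?thesis"
    then have "(2 * pi * b)\<^sup>2 powr \<sigma> < csq \<sigma> l"
      unfolding csq_def using assms(3) by (intro powr_less_mono2) auto
    with assms(4) show False by simp
  qed
  with sum_squares_ge(1)[OF assms(1,2) True] have "(2 * pi * real_of_int (l j))\<^sup>2 \<le> (2 * pi * b)\<^sup>2" by linarith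
  then have "(real_of_int (l j))\<^sup>2 \<le> b\<^sup>2" by (simp add: power_mult_distrib)
  then show ?thesis using assms(5) by (simp add: abs_le_square_iff[symmetric])
next
  case False
  then have "l j = 0" using assms(1) by (auto simp: Zu_def supp_def)
  then show ?thesis using assms(5) by simp
qed

text \<open>A bound on the smoothness weight bounds every coordinate, so the sublevel set lies in a
  cube with \<open>2 * b + 1\<close> points per axis.\<close>

lemma card_sublevel:
  assumes "\<sigma> > 0" "T \<le> (2 * pi * real b)\<^sup>2 powr \<sigma>"
  shows "finite {l \<in> Zu {0..<k}. csq \<sigma> l \<le> T}" "card {l \<in> Zu {0..<k}. csq \<sigma> l \<le> T} \<le> (2 * b + 1) ^ k"
proof -
  let ?A = "PiE_dflt {0..<k} (0::int) (\<lambda>_. {- int b .. int b})"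
  have sub: "{l \<in> Zu {0..<k}. csq \<sigma> l \<le> T} \<subseteq> ?A"
  proof
    fix l assume "l \<in> {l \<in> Zu {0..<k}. csq \<sigma> l \<le> T}"
    then have l: "l \<in> Zu {0..<k}" "csq \<sigma> l \<le> (2 * pi * real b)\<^sup>2 powr \<sigma>" using assms(2) by auto
    have "\<bar>real_of_int (l j)\<bar> \<le> real b" for j using csq_le_imp[OF l(1) _ assms(1) l(2)] by simp
    then have "\<bar>l j\<bar> \<le> int b" for j by (metis of_int_abs of_int_le_iff of_int_of_nat_eq)
    moreover have "l j = 0" if "j \<notin> {0..<k}" for j using l(1) that by (auto simp: Zu_def supp_def)
    ultimately show "l \<in> ?A" by (auto simp: PiE_dflt_def abs_le_iff minus_le_iff)
  qed
  have "finite ?A" by (intro finite_PiE_dflt) auto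
  with sub show "finite {l \<in> Zu {0..<k}. csq \<sigma> l \<le> T}" by (rule finite_subset)
  have "card {l \<in> Zu {0..<k}. csq \<sigma> l \<le> T} \<le> card ?A" using sub \<open>finite ?A\<close> by (rule card_mono[rotated])
  also have "card ?A = (2 * b + 1) ^ k" by (subst card_PiE_dflt) (auto simp: nat_add_distrib nat_mult_distrib)
  finally show "card {l \<in> Zu {0..<k}. csq \<sigma> l \<le> T} \<le> (2 * b + 1) ^ k" .
qed

text \<open>It suffices to let the first coordinate run through \<open>{1..m}\<close> and to fix the
  others at 1.\<close>

lemma many_small_indices:
  assumes "k \<ge> 1" "\<sigma> > 0"
  obtains B where "B \<subseteq> {l \<in> Zu {0..<k}. csq \<sigma> l \<le> ((2 * pi * real m)\<^sup>2 * real k) powr \<sigma>}" "card B = m"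
proof -
  define f where "f i j = (if j = 0 then int i else if j < k then 1 else 0)" for i j :: nat
  have f: "f i \<in> Zu {0..<k}" "csq \<sigma> (f i) \<le> ((2 * pi * real m)\<^sup>2 * real k) powr \<sigma>" if i: "i \<in> {1..m}" for i
  proof -
    show Z: "f i \<in> Zu {0..<k}" using i assms by (auto simp: f_def Zu_def supp_def split: if_splits)
    have "(\<Sum>j\<in>supp (f i). (2 * pi * real_of_int (f i j))\<^sup>2) \<le> (\<Sum>j\<in>supp (f i). (2 * pi * real m)\<^sup>2)"
    proof (intro sum_mono power_mono mult_left_mono)
      show "real_of_int (f i j) \<le> real m" for j using i by (auto simp: f_def)
    qed (auto simp: f_def)
    also have "\<dots> = (2 * pi * real m)\<^sup>2 * real k" by (simp add: Zu_supp[OF Z])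
    finally show "csq \<sigma> (f i) \<le> ((2 * pi * real m)\<^sup>2 * real k) powr \<sigma>"
      unfolding csq_def using assms by (intro powr_mono2 sum_nonneg) auto
  qed
  have "inj_on f {1..m}"
  proof (rule inj_onI)
    fix i i' assume "f i = f i'"
    then have "f i 0 = f i' 0" by simp
    then show "i = i'" by (simp add: f_def)
  qed
  then have "card (f ` {1..m}) = m" by (simp add: card_image)
  with f show ?thesis by (intro that[of "f ` {1..m}"]) auto
qed

text \<open>Renaming the coordinates of \<open>u\<close> leaves the sum of squares unchanged; hence
  all groups can share one amplitude profile that depends on \<open>csq\<close> alone.\<close>

lemma Zu_reindex:
  assumes "u \<in> Ukd k d"
  obtains \<phi> where "bij_betw \<phi> (Zu {0..<k}) (Zu u)" "\<And>l. l \<in> Zu {0..<k} \<Longrightarrow> csq \<sigma> (\<phi> l) = csq \<sigma> l"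
proof -
  have u: "finite u" "card u = k" using assms by (auto simp: Ukd_def intro: finite_subset)
  obtain g where g: "bij_betw g u {0..<k}"
    using u ex_bij_betw_finite_nat[of u] by auto
  define \<phi> where "\<phi> l j = (if j \<in> u then l (g j) else 0)" for l :: "nat \<Rightarrow> int" and j
  define \<psi> where "\<psi> l j = (if j < k then l (inv_into u g j) else 0)" for l :: "nat \<Rightarrow> int" and j
  have gin: "g j < k" if "j \<in> u" for j using g that by (auto simp: bij_betw_def)
  have gl: "inv_into u g (g j) = j" if "j \<in> u" for j using g that by (simp add: bij_betw_inv_into_left)
  have gr: "g (inv_into u g j) = j" "inv_into u g j \<in> u" if "j < k" for j
    using g that by (auto simp: bij_betw_inv_into_right bij_betw_def intro!: inv_into_into)
  have Z: "l \<in> Zu u \<longleftrightarrow> (\<forall>j. l j \<noteq> 0 \<longleftrightarrow> j \<in> u)" for l u by (auto simp: Zu_def supp_def)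
  have "bij_betw \<phi> (Zu {0..<k}) (Zu u)"
  proof (rule bij_betw_byWitness[where f' = \<psi>])
    show "\<forall>l\<in>Zu {0..<k}. \<psi> (\<phi> l) = l" using gr by (auto simp: fun_eq_iff \<phi>_def \<psi>_def Z)
    show "\<forall>l\<in>Zu u. \<phi> (\<psi> l) = l" using gl gin by (auto simp: fun_eq_iff \<phi>_def \<psi>_def Z)
    show "\<phi> ` Zu {0..<k} \<subseteq> Zu u" using gin by (auto simp: \<phi>_def Z)
    show "\<psi> ` Zu u \<subseteq> Zu {0..<k}" using gr by (auto simp: \<psi>_def Z)
  qed
  moreover have "csq \<sigma> (\<phi> l) = csq \<sigma> l" if l: "l \<in> Zu {0..<k}" for l
  proof -
    have "\<phi> l \<in> Zu u" using l gin by (auto simp: \<phi>_def Z)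
    then have "(\<Sum>j\<in>supp (\<phi> l). (2 * pi * real_of_int (\<phi> l j))\<^sup>2) = (\<Sum>j\<in>u. (2 * pi * real_of_int (l (g j)))\<^sup>2)"
      by (simp add: Zu_supp \<phi>_def)
    also have "\<dots> = (\<Sum>j\<in>{0..<k}. (2 * pi * real_of_int (l j))\<^sup>2)"
      by (rule sum.reindex_bij_betw[OF g])
    finally show ?thesis by (simp add: csq_def Zu_supp[OF l])
  qed
  ultimately show ?thesis by (rule that)
qed

lemma sum_sublevel_Zu:
  assumes "u \<in> Ukd k d"
  shows "(\<Sum>l | l \<in> Zu u \<and> csq \<sigma> l \<le> T. G (csq \<sigma> l)) = (\<Sum>l | l \<in> Zu {0..<k} \<and> csq \<sigma> l \<le> T. G (csq \<sigma> l))"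
    and "finite {l \<in> Zu {0..<k}. csq \<sigma> l \<le> T} \<Longrightarrow> finite {l \<in> Zu u. csq \<sigma> l \<le> T}"
proof -
  obtain \<phi> where \<phi>: "bij_betw \<phi> (Zu {0..<k}) (Zu u)" "\<And>l. l \<in> Zu {0..<k} \<Longrightarrow> csq \<sigma> (\<phi> l) = csq \<sigma> l"
    by (rule Zu_reindex[OF assms, where \<sigma> = \<sigma>]) blast
  have bij: "bij_betw \<phi> {l \<in> Zu {0..<k}. csq \<sigma> l \<le> T} {l \<in> Zu u. csq \<sigma> l \<le> T}"
    using \<phi> unfolding bij_betw_def by (fastforce intro: inj_on_subset)
  show "(\<Sum>l | l \<in> Zu u \<and> csq \<sigma> l \<le> T. G (csq \<sigma> l)) = (\<Sum>l | l \<in> Zu {0..<k} \<and> csq \<sigma> l \<le> T. G (csq \<sigma> l))"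
    by (subst sum.reindex_bij_betw[OF bij, symmetric]) (simp add: \<phi>(2))
  show "finite {l \<in> Zu u. csq \<sigma> l \<le> T}" if "finite {l \<in> Zu {0..<k}. csq \<sigma> l \<le> T}"
    using bij that by (simp add: bij_betw_finite)
qed

lemma extremal_problem_Zu:
  assumes "k \<ge> 1" "\<sigma> > 0"
  shows "extremal_problem (Zu {0..<k}) (csq \<sigma>)"
proof
  show "1 \<le> csq \<sigma> l" if "l \<in> Zu {0..<k}" for l
    using assms by (intro csq_ge_1[OF that]) auto
  show fin: "finite {l \<in> Zu {0..<k}. csq \<sigma> l \<le> T}" for T
  proof -
    \<comment> \<open>The \<open>+ 1\<close> ensures \<open>1 \<le> b\<close>, which allows passing
      from \<open>b\<close> to \<open>(2 * pi * b)\<^sup>2\<close> as an upper bound.\<close>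
    define b where "b = nat \<lceil>\<bar>T\<bar> powr (1 / \<sigma>)\<rceil> + 1"
    have b: "\<bar>T\<bar> powr (1/\<sigma>) \<le> real b" "1 \<le> real b" unfolding b_def by linarith+
    have "1 \<le> 2 * pi" using pi_gt3 by simp
    then have "real b * 1 \<le> (2 * pi * real b) * (2 * pi * real b)"
      using b(2) mult_mono[of "1::real" "2 * pi" 1 "real b"] by (intro mult_mono) auto
    with b(1) have "\<bar>T\<bar> powr (1/\<sigma>) \<le> (2 * pi * real b)\<^sup>2" by (simp add: power2_eq_square)
    then have "(\<bar>T\<bar> powr (1/\<sigma>)) powr \<sigma> \<le> (2 * pi * real b)\<^sup>2 powr \<sigma>" using assms by (intro powr_mono2) auto
    then have "T \<le> (2 * pi * real b)\<^sup>2 powr \<sigma>" using assms by (simp add: powr_powr split: if_splits)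
    then show ?thesis by (rule card_sublevel(1)[OF assms(2)])
  qed
  show "infinite (Zu {0..<k})"
  proof
    assume f: "finite (Zu {0..<k})"
    obtain B where B: "B \<subseteq> {l \<in> Zu {0..<k}. csq \<sigma> l \<le> ((2 * pi * real (Suc (card (Zu {0..<k}))))\<^sup>2 * real k) powr \<sigma>}"
        "card B = Suc (card (Zu {0..<k}))"
      by (rule many_small_indices[OF assms])
    then have "card B \<le> card (Zu {0..<k})" by (intro card_mono[OF f]) auto
    with B(2) show False by simp
  qed
qed

section \<open>The lower bound\<close>

lemma Theta_ringI_finite:
  assumes F: "finite F" "F \<subseteq> Z" and \<theta>: "\<And>l. l \<in> Z - F \<Longrightarrow> \<theta> l = 0"
    and le: "(\<Sum>l\<in>F. (\<theta> l)\<^sup>2 * csq \<sigma> l) \<le> 1" and ge: "r\<^sup>2 \<le> (\<Sum>l\<in>F. (\<theta> l)\<^sup>2)"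
  shows "\<theta> \<in> Theta_ring \<sigma> Z r"
proof -
  have *: "g summable_on Z \<and> infsum g Z = sum g F" if "\<And>l. l \<in> Z - F \<Longrightarrow> g l = 0" for g :: "(nat \<Rightarrow> int) \<Rightarrow> real"
  proof
    show "g summable_on Z"
      using that F by (subst summable_on_cong_neutral[of F Z g g]) auto
    have "infsum g Z = infsum g F"
      using that F by (intro infsum_cong_neutral) auto
    then show "infsum g Z = sum g F" using F by simp
  qed
  show ?thesis
    using *[of "\<lambda>l. (\<theta> l)\<^sup>2 * csq \<sigma> l"] *[of "\<lambda>l. (\<theta> l)\<^sup>2"] \<theta> le ge by (simp add: Theta_ring_def)
qed

text \<open>The tilts \<open>s2 < s1\<close> leave a gap of more than \<open>4 * \<eta>\<close> for
  the threshold, \<delta> bounds the squared amplitudes, \<kappa> is the slack in both exponents and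
  \<open>b\<close> stands for 1 - beta. \<open>\<theta>0\<close> only certifies that radius
  \<open>r\<close> is admissible at the prescribed value; \<open>T0\<close> is a cutoff already
  large enough, beyond which that value is attained.\<close>

lemma risk_bound_nonasymptotic:
  fixes k d p :: nat and \<sigma> \<epsilon> r x s1 s2 \<eta> \<delta> \<kappa> b :: real
  defines "\<l> \<equiv> ln (real (d choose k))"
  assumes k: "k \<ge> 1" and \<sigma>: "\<sigma> > 0" and \<epsilon>: "\<epsilon> > 0" and x: "x > 0" and l: "\<l> > 0"
    and T0: "T0 > 0" "extremal_problem.W2 (Zu {0..<k}) (csq \<sigma>) T0 > 0"
      "2 * \<epsilon>^4 * x\<^sup>2 * \<l> \<le> extremal_problem.\<rho> (Zu {0..<k}) (csq \<sigma>) T0"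
      "2 * x\<^sup>2 * \<l> \<le> \<delta>\<^sup>2 * extremal_problem.W2 (Zu {0..<k}) (csq \<sigma>) T0"
    and \<theta>0: "\<theta>0 \<in> Theta_ring \<sigma> (Zu {0..<k}) r" "(\<Sum>\<^sub>\<infinity>l\<in>Zu {0..<k}. (\<theta>0 l)^4) \<le> 2 * \<epsilon>^4 * x\<^sup>2 * \<l>"
    and s: "0 \<le> s2" "s2 < s1" and \<eta>: "0 < \<eta>" "4 * \<eta> < s1 - s2"
    and \<delta>: "0 < \<delta>" "\<delta> \<le> 1" "s1 * \<delta> \<le> 1" "3 * s1 * \<delta> \<le> \<eta>" "96 * \<delta> \<le> \<eta>"
    and V: "40640 \<le> \<eta>\<^sup>2 * (2 * x\<^sup>2 * \<l>)" "56 * s1\<^sup>2 \<le> \<eta>\<^sup>2 * (2 * x\<^sup>2 * \<l>)"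
    and \<kappa>: "(s1\<^sup>2 / 4 + \<eta>) * (2 * x\<^sup>2) \<le> 1 - \<kappa>" "((1 - s2)\<^sup>2 / 4 + 2 * \<eta>) * (2 * x\<^sup>2) \<le> b - \<kappa>"
    and p: "p \<le> real (d choose k) / 2" "exp (b * \<l>) / 2 \<le> p"
    and big: "8 \<le> exp (\<kappa> * \<l>)"
  shows "minimax_risk \<sigma> k d p \<epsilon> r \<ge> ereal (1/2)"
proof -
  interpret E: extremal_problem "Zu {0..<k}" "csq \<sigma>" using k \<sigma> by (rule extremal_problem_Zu)
  let ?N = "d choose k" and ?V = "2 * x\<^sup>2 * \<l>"
  have N: "real ?N = exp \<l>"
  proof -
    have "real ?N \<noteq> 0"
    proof
      assume "real ?N = 0"
      then have "\<l> = 0" unfolding \<l>_def by (simp only: ln_0)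
      with l show False by simp
    qed
    then have "0 < real ?N" by linarith
    then show ?thesis unfolding \<l>_def by (rule exp_ln[symmetric])
  qed
  have V0: "?V > 0" using x l by simp
  have y0: "2 * \<epsilon>^4 * x\<^sup>2 * \<l> > 0" using x l \<epsilon> by simp
  obtain T where T: "T \<ge> T0" "E.\<rho> T = 2 * \<epsilon>^4 * x\<^sup>2 * \<l>"
    by (rule E.ex_radius[OF T0(1,2) y0 T0(3)])
  have T_pos: "T > 0" using T T0 by simp
  have W2: "E.W2 T0 \<le> E.W2 T" by (rule E.W2_mono[OF T0(2,1) T(1)])
  have W2_pos: "E.W2 T > 0" using W2 T0 by simp
  have Wc: "E.Wc T > 0" using E.W2_le_Wc[OF T_pos] W2_pos by simp
  have ring: "(\<lambda>l. (\<theta>0 l)\<^sup>2 * csq \<sigma> l) summable_on Zu {0..<k}" "(\<Sum>\<^sub>\<infinity>l\<in>Zu {0..<k}. (\<theta>0 l)\<^sup>2 * csq \<sigma> l) \<le> 1"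
      "(\<lambda>l. (\<theta>0 l)\<^sup>2) summable_on Zu {0..<k}" "r\<^sup>2 \<le> (\<Sum>\<^sub>\<infinity>l\<in>Zu {0..<k}. (\<theta>0 l)\<^sup>2)"
    using \<theta>0(1) by (auto simp: Theta_ring_def)
  \<comment> \<open>The square of \<open>\<theta>0\<close> is feasible with at most the prescribed
    value, so the extremal sequence of that value has at least its mass.\<close>
  have mass: "r\<^sup>2 \<le> (\<Sum>l\<in>E.lev T. E.w T l / E.Wc T)"
    by (rule order_trans[OF ring(4) E.extremal_mass[OF T_pos W2_pos _ ring(3,1,2)]])
       (use \<theta>0(2) T(2) in \<open>simp_all add: power_mult[symmetric]\<close>)
  define G where "G c = max 0 (1 - c / T) / E.Wc T" for c
  have Gw: "G (csq \<sigma> l) = E.w T l / E.Wc T" for l by (simp add: G_def E.w_def)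
  have G0: "G c \<ge> 0" for c using Wc by (simp add: G_def)
  define h where "h l = sqrt (G (csq \<sigma> l)) / \<epsilon>" for l
  have eh2: "(\<epsilon> * h l)\<^sup>2 = G (csq \<sigma> l)" for l using \<epsilon> G0 by (simp add: h_def)
  define F where "F u = {l \<in> Zu u. csq \<sigma> l \<le> T}" for u
  have F0: "F {0..<k} = E.lev T" by (simp add: F_def E.lev_def)
  have F: "finite (F u)" "F u \<subseteq> Zu u" if "u \<in> Ukd k d" for u
    using sum_sublevel_Zu(2)[OF that E.fin] by (auto simp: F_def)
  have sumF: "(\<Sum>l\<in>F u. g (csq \<sigma> l)) = (\<Sum>l\<in>E.lev T. g (csq \<sigma> l))" if "u \<in> Ukd k d" for u and g :: "real \<Rightarrow> real"
    unfolding F0[symmetric] F_def by (rule sum_sublevel_Zu(1)[OF that])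
  define J where "J = (\<Union>u\<in>Ukd k d. F u)"
  have Theta: "(\<lambda>l. if l \<in> J then \<xi> l * (\<epsilon> * h l) else 0) \<in> Theta_d \<sigma> k d r" (is "?\<theta> \<in> _")
    if \<xi>: "\<xi> \<in> PiE J (\<lambda>_. {1, -1})" for \<xi>
    unfolding Theta_d_def
  proof (intro CollectI ballI)
    fix u assume u: "u \<in> Ukd k d"
    have sq: "(?\<theta> l)\<^sup>2 = G (csq \<sigma> l)" if "l \<in> F u" for l
    proof -
      have l: "l \<in> J" using that u by (auto simp: J_def)
      then have "\<xi> l = 1 \<or> \<xi> l = -1" using \<xi> by (auto simp: PiE_def Pi_def)
      then show ?thesis using l eh2[of l] by auto
    qed
    show "?\<theta> \<in> Theta_ring \<sigma> (Zu u) r"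
    proof (rule Theta_ringI_finite[OF F[OF u]])
      show "?\<theta> l = 0" if "l \<in> Zu u - F u" for l
        using that by (auto simp: J_def F_def)
      have "(\<Sum>l\<in>F u. (?\<theta> l)\<^sup>2 * csq \<sigma> l) = (\<Sum>l\<in>F u. G (csq \<sigma> l) * csq \<sigma> l)"
        using sq by (intro sum.cong) auto
      also have "\<dots> = (\<Sum>l\<in>E.lev T. G (csq \<sigma> l) * csq \<sigma> l)" using sumF[OF u, of "\<lambda>c. G c * c"] .
      also have "\<dots> = 1" using Wc by (simp add: Gw sum_divide_distrib[symmetric] E.Wc_def)
      finally show "(\<Sum>l\<in>F u. (?\<theta> l)\<^sup>2 * csq \<sigma> l) \<le> 1" by simp
      have "(\<Sum>l\<in>F u. (?\<theta> l)\<^sup>2) = (\<Sum>l\<in>F u. G (csq \<sigma> l))" using sq by (intro sum.cong) auto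
      also have "\<dots> = (\<Sum>l\<in>E.lev T. E.w T l / E.Wc T)" using sumF[OF u, of G] by (simp add: Gw)
      finally show "r\<^sup>2 \<le> (\<Sum>l\<in>F u. (?\<theta> l)\<^sup>2)" using mass by simp
    qed
  qed
  have h4: "(h l)^4 = (G (csq \<sigma> l))\<^sup>2 / \<epsilon>^4" for l
  proof -
    have "(h l)^4 = ((h l)\<^sup>2)\<^sup>2" by (simp flip: power_mult)
    also have "(h l)\<^sup>2 = G (csq \<sigma> l) / \<epsilon>\<^sup>2" using \<epsilon> eh2[of l] by (simp add: power_mult_distrib field_simps)
    finally show ?thesis by (simp add: power_divide flip: power_mult)
  qed
  have Vsum: "(\<Sum>l\<in>F u. (h l)^4) = ?V" if u: "u \<in> Ukd k d" for u
  proof -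
    have "(\<Sum>l\<in>F u. (h l)^4) = (\<Sum>l\<in>F u. (G (csq \<sigma> l))\<^sup>2) / \<epsilon>^4" by (simp add: h4 sum_divide_distrib)
    also have "(\<Sum>l\<in>F u. (G (csq \<sigma> l))\<^sup>2) = (\<Sum>l\<in>E.lev T. (G (csq \<sigma> l))\<^sup>2)" using sumF[OF u, of "\<lambda>c. (G c)\<^sup>2"] .
    also have "\<dots> = E.\<rho> T" by (simp add: Gw power_divide sum_divide_distrib[symmetric] E.W2_def E.\<rho>_def)
    finally show ?thesis using T(2) \<epsilon> by simp
  qed
  \<comment> \<open>Weights are at most 1, so h^4 is at most 1 / (Wc^2 eps^4) = V / W2; a large
    \<open>W2\<close> means that the mass is spread out.\<close>
  have hd: "(h l)\<^sup>2 \<le> \<delta>" for l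
  proof -
    have "G (csq \<sigma> l) \<le> 1 / E.Wc T"
    proof -
      have "0 \<le> csq \<sigma> l" by (simp add: csq_def)
      then show ?thesis unfolding G_def using T_pos Wc by (intro divide_right_mono) auto
    qed
    then have "(G (csq \<sigma> l))\<^sup>2 \<le> (1 / E.Wc T)\<^sup>2" using G0 by (intro power_mono) auto
    also have "\<dots> = E.\<rho> T / E.W2 T" using W2_pos by (simp add: E.\<rho>_def power_divide)
    finally have "(h l)^4 \<le> E.\<rho> T / E.W2 T / \<epsilon>^4" unfolding h4 using \<epsilon> by (intro divide_right_mono) auto
    also have "\<dots> = ?V / E.W2 T" using T(2) \<epsilon> by simp
    also have "\<dots> \<le> \<delta>\<^sup>2"
    proof -
      have "?V \<le> \<delta>\<^sup>2 * E.W2 T" using T0(4) W2 by (meson mult_left_mono order_trans zero_le_power2)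
      then show ?thesis using W2_pos by (simp add: divide_le_eq)
    qed
    finally have "((h l)\<^sup>2)\<^sup>2 \<le> \<delta>\<^sup>2" by (simp flip: power_mult)
    then show ?thesis by (rule power2_le_imp_le) (use \<delta> in simp)
  qed
  have h0: "h l \<ge> 0" for l using \<epsilon> G0 by (simp add: h_def)
  have FI: "F u \<subseteq> Idx k d" if "u \<in> Ukd k d" for u using F(2)[OF that] that by (auto simp: Idx_def)
  have s2: "s2 * \<delta> \<le> 1" "3 * s2 * \<delta> \<le> \<eta>" "56 * s2\<^sup>2 \<le> \<eta>\<^sup>2 * ?V"
  proof -
    have "s2 * \<delta> \<le> s1 * \<delta>" using s \<delta> by (intro mult_right_mono) auto
    then show "s2 * \<delta> \<le> 1" "3 * s2 * \<delta> \<le> \<eta>" using \<delta> by linarith+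
    have "s2\<^sup>2 \<le> s1\<^sup>2" using s by (intro power_mono) auto
    then show "56 * s2\<^sup>2 \<le> \<eta>\<^sup>2 * ?V" using V by linarith
  qed
  \<comment> \<open>The lower end of the typical range of \<open>LL\<close> under tilt
    \<open>s1\<close>; the gap between the tilts keeps the upper end of the range for
    \<open>s2\<close> strictly below it.\<close>
  define t where "t = (s1 - 1/2) * ?V / 2 - \<eta> * ?V"
  have t2: "(s2 - 1/2) * ?V / 2 + \<eta> * ?V < t"
  proof -
    have "4 * \<eta> * ?V < (s1 - s2) * ?V" using \<eta> V0 by (intro mult_strict_right_mono) auto
    moreover have "(s2 - 1/2) * W / 2 + \<eta> * W < (s1 - 1/2) * W / 2 - \<eta> * W" if "4 * \<eta> * W < (s1 - s2) * W" for W
      using that by (simp add: field_simps)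
    ultimately show ?thesis unfolding t_def by blast
  qed
  define p0 where "p0 = exp (- ((1 - \<kappa>) * \<l>)) / 2"
  define p1 where "p1 = exp (- ((b - \<kappa>) * \<l>)) / 2"
  let ?P = "PiM (Idx k d) (\<lambda>_. gauss 0 \<epsilon>)" and ?LL = "\<lambda>u x. \<Sum>l\<in>F u. ln (cosh (h l * (x l / \<epsilon>))) - (h l)\<^sup>2 / 2"
  have P0: "ennreal p0 \<le> emeasure ?P {x\<in>space ?P. t \<le> ?LL u x}" if u: "u \<in> Ukd k d" for u
  proof -
    interpret S: tilted_signals "Idx k d" "F u" h \<epsilon> s1 \<delta>
      using \<epsilon> F[OF u] FI[OF u] s \<delta> h0 hd by unfold_locales auto
    have SV: "S.V = ?V" using Vsum[OF u] by (simp add: S.V_def)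
    have "((s1\<^sup>2 / 4 + \<eta>) * (2 * x\<^sup>2)) * \<l> \<le> (1 - \<kappa>) * \<l>"
      using \<kappa> l by (intro mult_right_mono) auto
    then have "p0 \<le> exp (- ((s1\<^sup>2 / 4 + \<eta>) * S.V)) / 2" by (simp add: p0_def SV mult_ac)
    then have "ennreal p0 \<le> ennreal (exp (- ((s1\<^sup>2 / 4 + \<eta>) * S.V)) / 2)" by (rule ennreal_leI)
    also have "\<dots> \<le> emeasure ?P {x\<in>space ?P. t \<le> ?LL u x}"
      using S.tail_bounds(1)[of \<eta>] \<eta> \<delta> V V0 by (simp add: S.P_def S.LL_def SV t_def)
    finally show ?thesis .
  qed
  have P1: "ennreal p1 \<le> (\<integral>\<^sup>+x. ennreal (exp (?LL u x)) * indicator {x\<in>space ?P. ?LL u x < t} x \<partial>?P)"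
    if u: "u \<in> Ukd k d" for u
  proof -
    interpret S: tilted_signals "Idx k d" "F u" h \<epsilon> s2 \<delta>
      using \<epsilon> F[OF u] FI[OF u] s s2 \<delta> h0 hd by unfold_locales auto
    have SV: "S.V = ?V" using Vsum[OF u] by (simp add: S.V_def)
    have "(((1 - s2)\<^sup>2 / 4 + 2 * \<eta>) * (2 * x\<^sup>2)) * \<l> \<le> (b - \<kappa>) * \<l>"
      using \<kappa> l by (intro mult_right_mono) auto
    then have "p1 \<le> exp (- (((1 - s2)\<^sup>2 / 4 + 2 * \<eta>) * S.V)) / 2" by (simp add: p1_def SV mult_ac)
    then have "ennreal p1 \<le> ennreal (exp (- (((1 - s2)\<^sup>2 / 4 + 2 * \<eta>) * S.V)) / 2)" by (rule ennreal_leI)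
    also have "\<dots> \<le> (\<integral>\<^sup>+x. ennreal (exp (S.LL x)) * indicator {x\<in>space S.P. S.LL x \<le> (s2 - 1/2) * S.V / 2 + \<eta> * S.V} x \<partial>S.P)"
      using S.tail_bounds(2)[of \<eta>] \<eta> \<delta> V V0 s2 by (simp add: SV)
    also have "\<dots> \<le> (\<integral>\<^sup>+x. ennreal (exp (S.LL x)) * indicator {x\<in>space S.P. S.LL x < t} x \<partial>S.P)"
      using t2 by (intro nn_integral_mono mult_left_mono) (auto simp: indicator_def SV)
    finally show ?thesis by (simp add: S.P_def S.LL_def)
  qed
  have \<kappa>1: "0 \<le> 1 - \<kappa>" "0 \<le> b - \<kappa>"
  proof -
    have "0 \<le> (s1\<^sup>2 / 4 + \<eta>) * (2 * x\<^sup>2)" "0 \<le> ((1 - s2)\<^sup>2 / 4 + 2 * \<eta>) * (2 * x\<^sup>2)"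
      using \<eta> by (intro mult_nonneg_nonneg add_nonneg_nonneg; simp)+
    with \<kappa> show "0 \<le> 1 - \<kappa>" "0 \<le> b - \<kappa>" by linarith+
  qed
  have p01: "0 \<le> p0" "p0 \<le> 1" "0 \<le> p1" "p1 \<le> 1"
  proof -
    have "exp (- ((1 - \<kappa>) * \<l>)) \<le> 1" "exp (- ((b - \<kappa>) * \<l>)) \<le> 1" using \<kappa>1 l by auto
    then show "p0 \<le> 1" "p1 \<le> 1" unfolding p0_def p1_def by linarith+
    show "0 \<le> p0" "0 \<le> p1" unfolding p0_def p1_def by auto
  qed
  \<comment> \<open>An expected count of 2 suffices because exp 1 is at least 2; two such terms then
    add up to at most 1/2.\<close>
  have pow: "(1 - q) ^ n \<le> 1/4" if "0 \<le> q" "q \<le> 1" "2 \<le> q * real n" for q :: real and n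
  proof -
    have "(1 - q) ^ n \<le> exp (- q) ^ n" using that exp_ge_add_one_self[of "- q"] by (intro power_mono) auto
    also have "\<dots> = exp (- (q * real n))" by (simp add: exp_of_nat_mult[symmetric] mult.commute)
    also have "\<dots> \<le> exp (- 2)" using that by simp
    also have "\<dots> = 1 / (exp 1)\<^sup>2" by (simp add: exp_minus inverse_eq_divide exp_double[symmetric])
    also have "\<dots> \<le> 1 / 2\<^sup>2"
      using exp_ge_add_one_self[of 1] by (intro divide_left_mono power_mono mult_pos_pos) auto
    finally show ?thesis by simp
  qed
  have pN: "p \<le> ?N" using p(1) by simp
  \<comment> \<open>The factor 1/4 comes from the 1/2 in \<open>p1\<close> and the 1/2 in the lower
    bound on \<open>p\<close>; this is why \<open>big\<close> asks for 8.\<close>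
  have "2 \<le> p1 * real p"
  proof -
    have "2 \<le> exp (\<kappa> * \<l>) / 4" using big by simp
    also have "\<dots> = p1 * (exp (b * \<l>) / 2)" by (simp add: p1_def exp_add[symmetric] algebra_simps)
    also have "\<dots> \<le> p1 * real p" using p p01 by (intro mult_left_mono) auto
    finally show ?thesis .
  qed
  with p01 have pow1: "(1 - p1) ^ p \<le> 1/4" by (intro pow)
  have "2 \<le> p0 * real (?N - p)"
  proof -
    have "2 \<le> exp (\<kappa> * \<l>) / 4" using big by simp
    also have "\<dots> = p0 * (exp \<l> / 2)" by (simp add: p0_def exp_add[symmetric] algebra_simps)
    also have "\<dots> \<le> p0 * real (?N - p)" using p pN p01 N by (intro mult_left_mono) (auto simp: of_nat_diff)
    finally show ?thesis .
  qed
  with p01 have "(1 - p0) ^ (?N - p) \<le> 1/4" by (intro pow)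
  with pow1 have small: "(1 - p1) ^ p + (1 - p0) ^ (card (Ukd k d) - p) \<le> 1/2" by (simp add: card_Ukd)
  show ?thesis
    by (rule minimax_risk_ge_half[OF \<epsilon> _ F J_def Theta P0 p01(1,2) P1 p01(3,4) small]) (auto simp: card_Ukd pN)
qed

lemma polylog_negligible:
  fixes m :: real
  assumes "m > 0"
  shows "((\<lambda>\<epsilon>. \<epsilon>^4 * ln (1 / \<epsilon>) powr m) \<longlongrightarrow> 0) (at_right 0)"
  using assms by real_asymp

text \<open>The infimum lies strictly below the value set by \<open>x\<close>, so some admissible
  sequence falls below it and no minimiser has to exist. An empty class would have the value
  infinity, which the strict bound excludes.\<close>

lemma ex_near_extremal_sequence:
  assumes "a_eps \<sigma> k \<epsilon> r / ereal (sqrt \<l>) < ereal x" "\<l> > 0" "x > 0" "\<epsilon> > 0"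
  obtains \<theta> where "\<theta> \<in> Theta_ring \<sigma> (Zu {0..<k}) r" "(\<Sum>\<^sub>\<infinity>l\<in>Zu {0..<k}. (\<theta> l)^4) \<le> 2 * \<epsilon>^4 * x\<^sup>2 * \<l>"
proof -
  let ?I = "INF \<theta>\<in>Theta_ring \<sigma> (Zu {0..<k}) r. ereal (\<Sum>\<^sub>\<infinity>l\<in>Zu {0..<k}. (\<theta> l) ^ 4)"
  have I0: "0 \<le> ?I" by (intro INF_greatest) (auto intro!: infsum_nonneg)
  have a0: "0 \<le> a_sq \<sigma> k \<epsilon> r" unfolding a_sq_def using I0 assms(4) by (intro ereal_0_le_mult) auto
  have fin: "a_sq \<sigma> k \<epsilon> r \<noteq> \<infinity>"
    using assms by (auto simp: a_eps_def split: if_splits)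
  then obtain q where q: "a_sq \<sigma> k \<epsilon> r = ereal q" "0 \<le> q" using a0 by (cases "a_sq \<sigma> k \<epsilon> r") auto
  have "sqrt q / sqrt \<l> < x" using assms(1,2) fin q by (simp add: a_eps_def)
  then have "sqrt q < x * sqrt \<l>" using assms(2) by (simp add: divide_less_eq)
  then have "(sqrt q)\<^sup>2 < (x * sqrt \<l>)\<^sup>2" using q by (intro power_strict_mono) auto
  then have ql: "q < x\<^sup>2 * \<l>" using q assms(2) by (simp add: power_mult_distrib)
  have "?I < ereal (2 * \<epsilon>^4 * x\<^sup>2 * \<l>)"
  proof (rule ccontr)
    assume "\<not> ?thesis"
    then have "ereal (1 / (2 * \<epsilon>^4)) * ereal (2 * \<epsilon>^4 * x\<^sup>2 * \<l>) \<le> ereal (1 / (2 * \<epsilon>^4)) * ?I"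
      using assms(4) by (intro ereal_mult_left_mono) auto
    also have "\<dots> = ereal q" using q by (simp add: a_sq_def)
    finally show False using ql assms(4) by simp
  qed
  then show ?thesis using that by (auto simp: INF_less_iff less_imp_le)
qed

text \<open>A cutoff polynomial in ln (1 / eps) is enough. About ln (1 / eps) indices below half of
  it make \<open>W2\<close> dominate \<open>\<l> \<epsilon>\<close>, which is negligible against ln
  (1 / eps); the value at this cutoff is only polylogarithmically small, far above the required one,
  which carries eps^4.\<close>

lemma eventually_radius:
  fixes k :: nat and \<sigma> x \<delta> :: real and \<l> :: "real \<Rightarrow> real"
  assumes k: "k \<ge> 1" and \<sigma>: "\<sigma> > 0" and x: "x > 0" and \<delta>: "\<delta> > 0"
    and \<l>: "((\<lambda>\<epsilon>. \<l> \<epsilon> / ln (1 / \<epsilon>)) \<longlongrightarrow> 0) (at_right 0)"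
  shows "\<forall>\<^sub>F \<epsilon> in at_right 0. \<exists>T0>0. extremal_problem.W2 (Zu {0..<k}) (csq \<sigma>) T0 > 0 \<and>
      2 * \<epsilon>^4 * x\<^sup>2 * \<l> \<epsilon> \<le> extremal_problem.\<rho> (Zu {0..<k}) (csq \<sigma>) T0 \<and>
      2 * x\<^sup>2 * \<l> \<epsilon> \<le> \<delta>\<^sup>2 * extremal_problem.W2 (Zu {0..<k}) (csq \<sigma>) T0"
proof -
  interpret E: extremal_problem "Zu {0..<k}" "csq \<sigma>" using k \<sigma> by (rule extremal_problem_Zu)
  \<comment> \<open>\<open>B\<close> absorbs the factor \<open>2 * real k powr \<sigma>\<close>, so
    that the cutoff \<open>2 * S\<close> obeys the cube bound with side parameter
    \<open>B * M\<close>.\<close>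
  define B where "B = nat \<lceil>real k * 2 powr (1 / \<sigma>)\<rceil> + 1"
  have B: "real k * 2 powr (1 / \<sigma>) \<le> real B" "1 \<le> real B" unfolding B_def by linarith+
  have B2: "2 * real k powr \<sigma> \<le> (real B)\<^sup>2 powr \<sigma>"
  proof -
    have "real B * 1 \<le> (real B)\<^sup>2" using B(2) unfolding power2_eq_square by (intro mult_left_mono) auto
    with B(1) have "real k * 2 powr (1 / \<sigma>) \<le> (real B)\<^sup>2" by linarith
    then have "(real k * 2 powr (1 / \<sigma>)) powr \<sigma> \<le> (real B)\<^sup>2 powr \<sigma>"
      using \<sigma> by (intro powr_mono2) auto
    then show ?thesis using \<sigma> by (simp add: powr_mult powr_powr mult.commute)
  qed
  \<comment> \<open>The exponent collects \<open>k\<close> from the number of indices,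
    \<open>4 * \<sigma>\<close> from the squared cutoff and 1 from
    \<open>\<l> \<epsilon> \<le> ln (1 / \<epsilon>)\<close>.\<close>
  define m where "m = real k + 4 * \<sigma> + 1"
  define C where "C = (4 * real B + 1) ^ k * (4 * (16 * pi\<^sup>2 * real k) powr (2 * \<sigma>))"
  have "((\<lambda>\<epsilon>. 2 * x\<^sup>2 * C * (\<epsilon>^4 * ln (1 / \<epsilon>) powr m)) \<longlongrightarrow> 2 * x\<^sup>2 * C * 0) (at_right 0)"
    using \<sigma> by (intro tendsto_mult_left polylog_negligible) (simp add: m_def)
  then have e1: "\<forall>\<^sub>F \<epsilon> in at_right 0. 2 * x\<^sup>2 * C * (\<epsilon>^4 * ln (1 / \<epsilon>) powr m) < 1"
    by (intro order_tendstoD) auto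
  \<comment> \<open>The bound 1 serves the value of the cutoff; the other one, together with
    \<open>W2\<close> at least ln (1 / eps) / 4, gives the amplitude condition with
    \<delta>.\<close>
  have e2: "\<forall>\<^sub>F \<epsilon> in at_right 0. \<l> \<epsilon> / ln (1 / \<epsilon>) < min 1 (\<delta>\<^sup>2 / (8 * x\<^sup>2))"
    using \<delta> x by (intro order_tendstoD(2)[OF \<l>]) auto
  have e3: "\<forall>\<^sub>F \<epsilon> in at_right (0::real). 1 \<le> ln (1 / \<epsilon>)" by real_asymp
  have e4: "\<forall>\<^sub>F \<epsilon> in at_right (0::real). 0 < \<epsilon>" by (rule eventually_at_right_less)
  show ?thesis
    using e1 e2 e3 e4
  proof eventually_elim
    case (elim \<epsilon>)
    define L where "L = ln (1 / \<epsilon>)"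
    define M where "M = nat \<lceil>L\<rceil>"
    have L1: "1 \<le> L" using elim by (simp add: L_def)
    then have M: "L \<le> real M" "real M \<le> 2 * L" "1 \<le> real M" unfolding M_def by linarith+
    have lL: "\<l> \<epsilon> \<le> L" "\<l> \<epsilon> \<le> \<delta>\<^sup>2 / (8 * x\<^sup>2) * L"
      using elim(2) L1 unfolding L_def[symmetric] by (simp_all add: divide_less_eq)
    define S where "S = ((2 * pi * real M)\<^sup>2 * real k) powr \<sigma>"
    have S0: "S > 0" unfolding S_def using M k by simp
    let ?T = "2 * S"
    obtain R where R: "R \<subseteq> {l \<in> Zu {0..<k}. csq \<sigma> l \<le> S}" "card R = M"
      unfolding S_def by (rule many_small_indices[OF k \<sigma>])
    have W: "real M / 4 \<le> E.W2 ?T"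
      using E.W2_ge_card[of R ?T] R S0 by simp
    have W0: "E.W2 ?T > 0" using W M by linarith
    have "?T \<le> (2 * pi * real (B * M))\<^sup>2 powr \<sigma>"
    proof -
      have "?T = (2 * pi * real M)\<^sup>2 powr \<sigma> * (2 * real k powr \<sigma>)" by (simp add: S_def powr_mult)
      also have "\<dots> \<le> (2 * pi * real M)\<^sup>2 powr \<sigma> * (real B)\<^sup>2 powr \<sigma>" using B2 by (intro mult_left_mono) auto
      also have "\<dots> = (2 * pi * real (B * M))\<^sup>2 powr \<sigma>" by (simp add: powr_mult[symmetric] power_mult_distrib mult_ac)
      finally show ?thesis .
    qed
    from card_sublevel(2)[OF \<sigma> this, of k]
    have "real (card (E.lev ?T)) \<le> real ((2 * (B * M) + 1) ^ k)" unfolding E.lev_def of_nat_le_iff .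
    also have "\<dots> = (2 * (real B * real M) + 1) ^ k" by (simp add: add.commute)
    also have "\<dots> \<le> ((4 * real B + 1) * L) ^ k"
    proof (intro power_mono)
      have "real B * real M \<le> real B * (2 * L)" using M by (intro mult_left_mono) auto
      then show "2 * (real B * real M) + 1 \<le> (4 * real B + 1) * L" using L1 by (simp add: algebra_simps)
    qed auto
    finally have n: "real (card (E.lev ?T)) \<le> ((4 * real B + 1) * L) ^ k" .
    have T2: "?T\<^sup>2 \<le> 4 * (16 * pi\<^sup>2 * real k) powr (2 * \<sigma>) * L powr (4 * \<sigma>)"
    proof -
      have "(real M)\<^sup>2 \<le> (2 * L)\<^sup>2" using M by (intro power_mono) auto
      then have "(2 * pi)\<^sup>2 * real k * (real M)\<^sup>2 \<le> (2 * pi)\<^sup>2 * real k * (2 * L)\<^sup>2"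
        by (rule mult_left_mono) simp
      then have "(2 * pi * real M)\<^sup>2 * real k \<le> (16 * pi\<^sup>2 * real k) * L\<^sup>2"
        by (simp add: power_mult_distrib mult_ac)
      then have "S \<le> ((16 * pi\<^sup>2 * real k) * L\<^sup>2) powr \<sigma>" unfolding S_def using \<sigma> by (intro powr_mono2) auto
      then have "S\<^sup>2 \<le> (((16 * pi\<^sup>2 * real k) * L\<^sup>2) powr \<sigma>)\<^sup>2" using S0 by (intro power_mono) auto
      also have "\<dots> = (16 * pi\<^sup>2 * real k) powr (2 * \<sigma>) * L powr (4 * \<sigma>)"
      proof -
        have "L\<^sup>2 = L powr 2" using L1 by simp
        then show ?thesis by (simp add: powr_mult powr_powr power2_eq_square powr_add[symmetric] mult_ac)
      qed
      finally show ?thesis by (simp add: power_mult_distrib)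
    qed
    let ?n = "((4 * real B + 1) * L) ^ k"
    have n0: "?n > 0" using L1 by (intro zero_less_power mult_pos_pos) auto
    have nT: "?n * ?T\<^sup>2 \<le> C * L powr (m - 1)"
    proof -
      have "?n * ?T\<^sup>2 \<le> ?n * (4 * (16 * pi\<^sup>2 * real k) powr (2 * \<sigma>) * L powr (4 * \<sigma>))"
        using T2 n0 by (intro mult_left_mono) auto
      also have "\<dots> = C * (L ^ k * L powr (4 * \<sigma>))"
        by (simp add: C_def power_mult_distrib)
      also have "L ^ k * L powr (4 * \<sigma>) = L powr (m - 1)"
        using L1 by (simp add: m_def powr_add powr_realpow)
      finally show ?thesis .
    qed
    have "2 * \<epsilon>^4 * x\<^sup>2 * \<l> \<epsilon> * (?n * ?T\<^sup>2) \<le> 2 * \<epsilon>^4 * x\<^sup>2 * L * (?n * ?T\<^sup>2)"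
      using lL(1) less_imp_le[OF n0] by (intro mult_right_mono mult_left_mono mult_nonneg_nonneg) auto
    also have "\<dots> \<le> 2 * \<epsilon>^4 * x\<^sup>2 * L * (C * L powr (m - 1))"
      using L1 by (intro mult_left_mono nT) auto
    also have "\<dots> = 2 * x\<^sup>2 * C * (\<epsilon>^4 * L powr m)"
    proof -
      have "L powr m = L * L powr (m - 1)" using L1 by (simp add: powr_diff)
      then show ?thesis by simp
    qed
    also have "\<dots> \<le> 1" using elim(1) by (simp add: L_def)
    finally have "2 * \<epsilon>^4 * x\<^sup>2 * \<l> \<epsilon> \<le> 1 / (?n * ?T\<^sup>2)" using n0 S0 by (simp add: field_simps)
    also have "\<dots> \<le> E.\<rho> ?T" using S0 by (intro E.rho_ge W0 n) simp
    finally have 1: "2 * \<epsilon>^4 * x\<^sup>2 * \<l> \<epsilon> \<le> E.\<rho> ?T" .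
    have "2 * x\<^sup>2 * \<l> \<epsilon> \<le> 2 * x\<^sup>2 * (\<delta>\<^sup>2 / (8 * x\<^sup>2) * L)" using lL by (intro mult_left_mono) auto
    also have "\<dots> = \<delta>\<^sup>2 * (L / 4)" using x by simp
    also have "\<dots> \<le> \<delta>\<^sup>2 * E.W2 ?T" using W M by (intro mult_left_mono) auto
    finally have 2: "2 * x\<^sup>2 * \<l> \<epsilon> \<le> \<delta>\<^sup>2 * E.W2 ?T" .
    show ?case using S0 W0 1 2 by (intro exI[of _ ?T]) simp
  qed
qed

lemma binomial_tendsto_infinity:
  assumes "k \<ge> 1" "filterlim d at_top F" "\<forall>\<^sub>F \<epsilon> in F. k \<le> d \<epsilon>"
  shows "filterlim (\<lambda>\<epsilon>. real (d \<epsilon> choose k)) at_top F"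
proof (rule filterlim_at_top_mono)
  show "filterlim (\<lambda>\<epsilon>. real (d \<epsilon>) / real k) at_top F"
  proof -
    have "filterlim (\<lambda>\<epsilon>. 1 / real k * real (d \<epsilon>)) at_top F"
    proof (rule filterlim_tendsto_pos_mult_at_top[OF tendsto_const])
      show "0 < 1 / real k" using assms(1) by simp
      show "filterlim (\<lambda>\<epsilon>. real (d \<epsilon>)) at_top F"
        by (rule filterlim_compose[OF filterlim_real_sequentially assms(2)])
    qed
    then show ?thesis by simp
  qed
  show "\<forall>\<^sub>F \<epsilon> in F. real (d \<epsilon>) / real k \<le> real (d \<epsilon> choose k)"
    using assms(3)
  proof eventually_elim
    case (elim \<epsilon>)
    have "real (d \<epsilon>) / real k = (real (d \<epsilon>) / real k) ^ 1" by simp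
    also have "\<dots> \<le> (real (d \<epsilon>) / real k) ^ k"
      using elim assms(1) by (intro power_increasing) auto
    also have "\<dots> \<le> real (d \<epsilon> choose k)"
      using binomial_ge_n_over_k_pow_k[OF elim, where 'a = real] by simp
    finally show ?case .
  qed
qed

theorem theorem2:
  fixes k :: nat and \<beta> \<sigma> :: real
    and d :: "real \<Rightarrow> nat" and p :: "real \<Rightarrow> nat" and r :: "real \<Rightarrow> real"
  assumes "k \<ge> 1" and "0 < \<beta>" and "\<beta> < 1" and "\<sigma> > 0"
    and "filterlim d at_top (at_right 0)"
    and "\<forall>\<epsilon>>0. k \<le> d \<epsilon>"
    and "((\<lambda>\<epsilon>. ln (real (d \<epsilon> choose k)) / ln (1 / \<epsilon>)) \<longlongrightarrow> 0) (at_right 0)"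
    and "((\<lambda>\<epsilon>. real (p \<epsilon>) / real (d \<epsilon> choose k) powr (1 - \<beta>)) \<longlongrightarrow> 1) (at_right 0)"
    and "\<forall>\<epsilon>>0. r \<epsilon> > 0"
    and "Limsup (at_right 0)
           (\<lambda>\<epsilon>. a_eps \<sigma> k \<epsilon> (r \<epsilon>) / ereal (sqrt (ln (real (d \<epsilon> choose k)))))
         < ereal (sqrt 2 * (1 + sqrt (1 - \<beta>)))"
  shows "Liminf (at_right 0) (\<lambda>\<epsilon>. minimax_risk \<sigma> k (d \<epsilon>) (p \<epsilon>) \<epsilon> (r \<epsilon>)) > 0"
proof -
  define N where "N \<epsilon> = real (d \<epsilon> choose k)" for \<epsilon>
  define q where "q = sqrt (1 - \<beta>)"
  have q: "0 < q" "q\<^sup>2 = 1 - \<beta>" using assms(2,3) by (auto simp: q_def)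
  let ?a = "\<lambda>\<epsilon>. a_eps \<sigma> k \<epsilon> (r \<epsilon>) / ereal (sqrt (ln (N \<epsilon>)))"
  \<comment> \<open>The maximum with 0 forces the intermediate value \<open>x\<close> to be
    positive.\<close>
  have "max (Limsup (at_right 0) ?a) 0 < ereal (sqrt 2 * (1 + q))"
  proof -
    have "0 < sqrt 2 * (1 + q)" using q by (intro mult_pos_pos) auto
    then show ?thesis using assms(10) unfolding N_def q_def by simp
  qed
  then obtain x where x': "max (Limsup (at_right 0) ?a) 0 < ereal x" "ereal x < ereal (sqrt 2 * (1 + q))"
    using ereal_dense2 by blast
  then have x: "0 < x" "x < sqrt 2 * (1 + q)" "Limsup (at_right 0) ?a < ereal x" by auto

  \<comment> \<open>The window of admissible tilts: the upper end keeps noise exceedances frequent,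
    the lower end missed signals. It is nonempty since \<open>x < sqrt 2 * (1 + q)\<close>; two
    points are taken from it because the threshold needs a gap.\<close>
  have "max 0 (1 - sqrt 2 * q / x) < min 1 (sqrt 2 / x)"
  proof -
    have "1 < (sqrt 2 + sqrt 2 * q) / x" using x by (simp add: less_divide_eq algebra_simps)
    then have "1 - sqrt 2 * q / x < sqrt 2 / x" by (simp add: add_divide_distrib)
    moreover have "0 < sqrt 2 * q / x" "0 < sqrt 2 / x" using x q by simp_all
    ultimately show ?thesis by simp
  qed
  then obtain s2 where s2: "max 0 (1 - sqrt 2 * q / x) < s2" "s2 < min 1 (sqrt 2 / x)"
    using dense by blast
  then have "s2 < sqrt 2 / x" by simp
  then obtain s1 where s1: "s2 < s1" "s1 < sqrt 2 / x" using dense by blast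
  have "s1 * x < sqrt 2" "(1 - s2) * x < sqrt 2 * q" "0 < s2" "0 < s1" "s2 < 1"
    using s1 s2 x by (auto simp: field_simps)
  then have "(s1 * x)\<^sup>2 < (sqrt 2)\<^sup>2" "((1 - s2) * x)\<^sup>2 < (sqrt 2 * q)\<^sup>2"
    using x by (intro power_strict_mono; simp)+
  then have g: "0 < 1 - s1\<^sup>2 * x\<^sup>2 / 2" "0 < (1 - \<beta>) - (1 - s2)\<^sup>2 * x\<^sup>2 / 2"
    using q by (simp_all add: power_mult_distrib)
  \<comment> \<open>Half of the smaller exponent gap remains as final slack; the other half absorbs
    the errors caused by \<eta>.\<close>
  define \<kappa> where "\<kappa> = min (1 - s1\<^sup>2 * x\<^sup>2 / 2) ((1 - \<beta>) - (1 - s2)\<^sup>2 * x\<^sup>2 / 2) / 2"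
  have \<kappa>: "0 < \<kappa>" "2 * \<kappa> \<le> 1 - s1\<^sup>2 * x\<^sup>2 / 2" "2 * \<kappa> \<le> (1 - \<beta>) - (1 - s2)\<^sup>2 * x\<^sup>2 / 2"
    using g by (auto simp: \<kappa>_def)
  define \<eta> where "\<eta> = min ((s1 - s2) / 8) (\<kappa> / (4 * x\<^sup>2))"
  have \<eta>: "0 < \<eta>" "4 * \<eta> < s1 - s2" using s1 \<kappa> x by (auto simp: \<eta>_def min_def)
  have "\<eta> \<le> \<kappa> / (4 * x\<^sup>2)" by (simp add: \<eta>_def)
  then have \<eta>\<kappa>: "4 * (\<eta> * x\<^sup>2) \<le> \<kappa>" using x by (simp add: field_simps)
  have 0: "0 \<le> \<eta> * x\<^sup>2" using \<eta> by simp
  have \<kappa>': "(s1\<^sup>2 / 4 + \<eta>) * (2 * x\<^sup>2) \<le> 1 - \<kappa>" "((1 - s2)\<^sup>2 / 4 + 2 * \<eta>) * (2 * x\<^sup>2) \<le> (1 - \<beta>) - \<kappa>"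
  proof -
    have "(s1\<^sup>2 / 4 + \<eta>) * (2 * x\<^sup>2) = s1\<^sup>2 * x\<^sup>2 / 2 + 2 * (\<eta> * x\<^sup>2)" by (simp add: algebra_simps)
    then show "(s1\<^sup>2 / 4 + \<eta>) * (2 * x\<^sup>2) \<le> 1 - \<kappa>" using \<kappa> \<eta>\<kappa> 0 by linarith
    have "((1 - s2)\<^sup>2 / 4 + 2 * \<eta>) * (2 * x\<^sup>2) = (1 - s2)\<^sup>2 * x\<^sup>2 / 2 + 4 * (\<eta> * x\<^sup>2)" by (simp add: algebra_simps)
    then show "((1 - s2)\<^sup>2 / 4 + 2 * \<eta>) * (2 * x\<^sup>2) \<le> (1 - \<beta>) - \<kappa>" using \<kappa> \<eta>\<kappa> 0 by linarith
  qed
  define \<delta> where "\<delta> = min (min 1 (1 / s1)) (\<eta> / (3 * s1 + 96))"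
  have \<delta>: "0 < \<delta>" "\<delta> \<le> 1" "s1 * \<delta> \<le> 1" "3 * s1 * \<delta> \<le> \<eta>" "96 * \<delta> \<le> \<eta>"
  proof -
    show \<delta>0: "0 < \<delta>" "\<delta> \<le> 1" using \<open>0 < s1\<close> \<eta> by (auto simp: \<delta>_def)
    have "\<delta> \<le> 1 / s1" "\<delta> \<le> \<eta> / (3 * s1 + 96)" by (auto simp: \<delta>_def)
    then have "\<delta> * s1 \<le> 1" and le: "\<delta> * (3 * s1 + 96) \<le> \<eta>" using \<open>0 < s1\<close> by (auto simp: field_simps)
    then show "s1 * \<delta> \<le> 1" by (simp add: mult.commute)
    have "0 \<le> s1 * \<delta>" using \<delta>0 \<open>0 < s1\<close> by simp
    moreover have "\<delta> * (3 * s1 + 96) = 3 * s1 * \<delta> + 96 * \<delta>" by (simp add: algebra_simps)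
    ultimately show "3 * s1 * \<delta> \<le> \<eta>" "96 * \<delta> \<le> \<eta>" using le \<delta>0 by linarith+
  qed

  have pos: "\<forall>\<^sub>F \<epsilon> in at_right (0::real). 0 < \<epsilon>" by (rule eventually_at_right_less)
  have "\<forall>\<^sub>F \<epsilon> in at_right 0. k \<le> d \<epsilon>"
    using pos by eventually_elim (use assms(6) in simp)
  then have N_inf: "filterlim N at_top (at_right 0)"
    unfolding N_def using assms(1,5) by (intro binomial_tendsto_infinity)
  have l_inf: "filterlim (\<lambda>\<epsilon>. ln (N \<epsilon>)) at_top (at_right 0)"
    by (rule filterlim_compose[OF ln_at_top N_inf])
  \<comment> \<open>Sources of the entries: positivity of \<open>ln N\<close>, the two Chebyshev
    conditions, \<open>8 \<le> exp (\<kappa> * ln N)\<close>, and N^beta at least 4.\<close>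
  define c where "c = Max {1, 40640 / (\<eta>\<^sup>2 * (2 * x\<^sup>2)), 56 * s1\<^sup>2 / (\<eta>\<^sup>2 * (2 * x\<^sup>2)), ln 8 / \<kappa>, ln 4 / \<beta>}"
  have large: "\<forall>\<^sub>F \<epsilon> in at_right 0. c \<le> ln (N \<epsilon>)"
    using l_inf by (simp add: filterlim_at_top)
  have near: "\<forall>\<^sub>F \<epsilon> in at_right 0. ?a \<epsilon> < ereal x" by (rule Limsup_lessD[OF x(3)])
  have p1: "\<forall>\<^sub>F \<epsilon> in at_right 0. real (p \<epsilon>) / N \<epsilon> powr (1 - \<beta>) > 1/2"
    and p2: "\<forall>\<^sub>F \<epsilon> in at_right 0. real (p \<epsilon>) / N \<epsilon> powr (1 - \<beta>) < 2"
    unfolding N_def by (intro order_tendstoD[OF assms(8)]; simp)+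
  have radius: "\<forall>\<^sub>F \<epsilon> in at_right 0. \<exists>T0>0. extremal_problem.W2 (Zu {0..<k}) (csq \<sigma>) T0 > 0 \<and>
      2 * \<epsilon>^4 * x\<^sup>2 * ln (N \<epsilon>) \<le> extremal_problem.\<rho> (Zu {0..<k}) (csq \<sigma>) T0 \<and>
      2 * x\<^sup>2 * ln (N \<epsilon>) \<le> \<delta>\<^sup>2 * extremal_problem.W2 (Zu {0..<k}) (csq \<sigma>) T0"
    using assms(7) unfolding N_def by (intro eventually_radius assms(1,4) x(1) \<delta>(1))
  have "\<forall>\<^sub>F \<epsilon> in at_right 0. ereal (1/2) \<le> minimax_risk \<sigma> k (d \<epsilon>) (p \<epsilon>) \<epsilon> (r \<epsilon>)"
    using pos large near p1 p2 radius
  proof eventually_elim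
    case (elim \<epsilon>)
    let ?l = "ln (N \<epsilon>)"
    have c: "1 \<le> ?l" "40640 / (\<eta>\<^sup>2 * (2 * x\<^sup>2)) \<le> ?l" "56 * s1\<^sup>2 / (\<eta>\<^sup>2 * (2 * x\<^sup>2)) \<le> ?l"
        "ln 8 / \<kappa> \<le> ?l" "ln 4 / \<beta> \<le> ?l"
      using elim(2) by (auto simp: c_def)
    have "0 < \<eta>\<^sup>2 * (2 * x\<^sup>2)" using \<eta> x by simp
    with c(2,3) have V: "40640 \<le> \<eta>\<^sup>2 * (2 * x\<^sup>2 * ?l)" "56 * s1\<^sup>2 \<le> \<eta>\<^sup>2 * (2 * x\<^sup>2 * ?l)"
      by (simp_all add: divide_le_eq mult_ac)
    have "ln 8 \<le> \<kappa> * ?l" using c(4) \<kappa>(1) by (simp add: divide_le_eq mult.commute)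
    then have "exp (ln 8) \<le> exp (\<kappa> * ?l)" by (simp only: exp_le_cancel_iff)
    then have big: "8 \<le> exp (\<kappa> * ?l)" by simp
    have "ln 4 \<le> \<beta> * ?l" using c(5) assms(2) by (simp add: divide_le_eq mult.commute)
    then have "exp (ln 4) \<le> exp (\<beta> * ?l)" by (simp only: exp_le_cancel_iff)
    then have b4: "4 \<le> exp (\<beta> * ?l)" by simp
    \<comment> \<open>By convention \<open>ln 0 = 0\<close>, which the bound
      \<open>1 \<le> ?l\<close> excludes.\<close>
    have N0: "N \<epsilon> > 0"
    proof (rule ccontr)
      assume "\<not> N \<epsilon> > 0"
      then have "N \<epsilon> = 0" by (simp add: N_def)
      with c(1) show False by simp
    qed
    then have powr: "N \<epsilon> powr (1 - \<beta>) = exp ((1 - \<beta>) * ?l)" by (simp add: powr_def)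
    have lower: "exp ((1 - \<beta>) * ?l) / 2 \<le> real (p \<epsilon>)" using elim(4) unfolding powr by (simp add: field_simps)
    \<comment> \<open>N^beta at least 4 turns the bound 2 N^(1 - beta) into N / 2, so that at least
      half of the groups are inactive.\<close>
    have "real (p \<epsilon>) \<le> 2 * exp ((1 - \<beta>) * ?l)" using elim(5) unfolding powr by (simp add: field_simps)
    also have "\<dots> \<le> exp (\<beta> * ?l) / 2 * exp ((1 - \<beta>) * ?l)" using b4 by (intro mult_right_mono) auto
    also have "\<dots> = exp ?l / 2" by (simp add: exp_add[symmetric] algebra_simps)
    also have "\<dots> = N \<epsilon> / 2" using N0 by simp
    finally have upper: "real (p \<epsilon>) \<le> N \<epsilon> / 2" .
    have l0: "?l > 0" using c(1) by simp
    obtain \<theta> where \<theta>: "\<theta> \<in> Theta_ring \<sigma> (Zu {0..<k}) (r \<epsilon>)"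
        "(\<Sum>\<^sub>\<infinity>l\<in>Zu {0..<k}. (\<theta> l)^4) \<le> 2 * \<epsilon>^4 * x\<^sup>2 * ?l"
      by (rule ex_near_extremal_sequence[OF elim(3) l0 x(1) elim(1)])
    obtain T0 where T0: "T0 > 0" "extremal_problem.W2 (Zu {0..<k}) (csq \<sigma>) T0 > 0"
      "2 * \<epsilon>^4 * x\<^sup>2 * ?l \<le> extremal_problem.\<rho> (Zu {0..<k}) (csq \<sigma>) T0"
      "2 * x\<^sup>2 * ?l \<le> \<delta>\<^sup>2 * extremal_problem.W2 (Zu {0..<k}) (csq \<sigma>) T0"
      using elim(6) by blast
    show ?case
      by (rule risk_bound_nonasymptotic[OF assms(1,4) elim(1) x(1) l0[unfolded N_def] T0[unfolded N_def]
            \<theta>[unfolded N_def] less_imp_le[OF \<open>0 < s2\<close>] s1(1) \<eta> \<delta> V[unfolded N_def] \<kappa>'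
            upper[unfolded N_def] lower[unfolded N_def] big[unfolded N_def]])
  qed
  then have "ereal (1/2) \<le> Liminf (at_right 0) (\<lambda>\<epsilon>. minimax_risk \<sigma> k (d \<epsilon>) (p \<epsilon>) \<epsilon> (r \<epsilon>))"
    by (rule Liminf_bounded)
  then show ?thesis by (rule less_le_trans[rotated]) simp
qed

end
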